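(* Let $\mathcal{N}\subseteq\mathbb{V}^{m\times n}$ be a nonempty open set, let $g:\mathbb{R}^m\to\mathbb{R}^m$ be absolutely symmetric on an open set $\hat\sigma_{\mathcal{N}}\subseteq\mathbb{R}^m$ containing $\{\sigma(X)\mid X\in\mathcal{N}\}$, and let $G:\mathcal{N}\to\mathbb{V}^{m\times n}$ be the spectral operator with respect to $g$. Let $\overline{X}\in\mathcal{N}$, $\overline\sigma:=\sigma(\overline{X})$, and assume that $g$ is locally Lipschitz continuous near $\overline\sigma$ and directionally differentiable at $\overline\sigma$ (so that $G$ is locally Lipschitz continuous near $\overline{X}$ and directionally differentiable at $\overline{X}$). Suppose that there exists an open neighborhood $\mathcal{B}\subseteq\mathbb{R}^m$ of $\overline\sigma$ in $\hat\sigma_{\mathcal{N}}$ such that, for $\sigma\in\mathcal{B}$, $g$ is differentiable at $\sigma$ if and only if $g'(\overline\sigma;\cdot)$ is differentiable at $\sigma-\overline\sigma$. Assume further that the function $d:\mathbb{R}^m\to\mathbb{R}^m$ defined by $$d(h):=g(\overline\sigma+h)-g(\overline\sigma)-g'(\overline\sigma;h),\qquad h\in\mathbb{R}^m,$$ is strictly differentiable at zero. Let $\Psi(\cdot):=G'(\overline{X};\cdot):\mathbb{V}^{m\times n}\to\mathbb{V}^{m\times n}$ be the directional derivative of $G$ at $\overline{X}$ (a globally Lipschitz continuous function). Then $$\partial_BG(\overline{X})=\partial_B\Psi(0)\quad\text{and}\quad\partial G(\overline{X})=\partial\Psi(0).$$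
   Context: Fix $m\le n$. $\mathbb{V}^{m\times n}$ denotes either $\mathbb{R}^{m\times n}$ or $\mathbb{C}^{m\times n}$, viewed as a real Euclidean space with inner product $\langle X,Y\rangle=\mathrm{Re}(\mathrm{trace}(X^{*}Y))$ and induced norm, where $X^{*}$ is the (conjugate) transpose. $\mathbb{O}^p$ is the set of $p\times p$ orthogonal (real case) or unitary (complex case) matrices. $\sigma(Z)\in\mathbb{R}^m$ is the vector of singular values $\sigma_1(Z)\ge\cdots\ge\sigma_m(Z)\ge0$ of $Z\in\mathbb{V}^{m\times n}$; $\mathrm{Diag}(x)$ is the diagonal matrix with diagonal $x$; $\mathbb{O}^{m,n}(Z)$ is the set of pairs $(U,V)\in\mathbb{O}^m\times\mathbb{O}^n$ with $Z=U[\mathrm{Diag}(\sigma(Z))\quad 0]V^{*}$. A signed permutation matrix is a square matrix with exactly one nonzero entry in each row and each column, that entry being $\pm1$. The mapping $g:\mathbb{R}^m\to\mathbb{R}^m$ is absolutely symmetric on a set $D$ if $g(Qx)=Qg(x)$ for every $x\in D$ and every $m\times m$ signed permutation matrix $Q$. The spectral operator $G$ with respect to $g$ is $G(X)=U[\mathrm{Diag}(g(\sigma(X)))\quad 0]V^{*}$ for $X\in\mathcal{N}$, where $(U,V)\in\mathbb{O}^{m,n}(X)$ (the value does not depend on the choice of $(U,V)$). Differentiable means Fréchet differentiable over $\mathbb{R}$; $F'(z;h)=\lim_{t\downarrow0}\frac{F(z+th)-F(z)}{t}$ is the directional derivative. For a function $F$ that is locally Lipschitz continuous near $z$, with $\mathcal{D}_F$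 the set of points (in a neighborhood of $z$) where $F$ is differentiable, the B-subdifferential is $\partial_BF(z):=\{\lim_kF'(z^k)\mid z^k\in\mathcal{D}_F,\ z^k\to z\}$ (all limits that exist), and Clarke's generalized Jacobian is $\partial F(z):=\mathrm{conv}\,\partial_BF(z)$. Under the stated assumptions $d$ is differentiable at $0$ with $d'(0)=0$; strict differentiability of $d$ at zero then means $\lim_{w,w'\to0,\,w\ne w'}\frac{d(w)-d(w')}{\|w-w'\|}=0$. *)

theory Defs
  imports "HOL-Analysis.Analysis"
begin

subsection \<open>The scalars: real or complex numbers\<close>

text \<open>
  The class has exactly the members \<open>\<real>\<close> and \<open>\<complex>\<close>, up to isometric isomorphism; see
  \<open>real_or_complex_cases\<close> below. The axiom makes \<open>scnj\<close> the reflection in the real line,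
  so \<open>scnj\<close> is the identity on \<open>real\<close> and \<open>cnj\<close> on \<open>complex\<close>.
\<close>

class real_or_complex = real_normed_field + euclidean_space +
  fixes scnj :: "'a \<Rightarrow> 'a"
  assumes scnj_add_self: "scnj x + x = (2 * inner x 1) *\<^sub>R 1"

instantiation real :: real_or_complex
begin
definition scnj_real_def: "scnj (x::real) = x"
instance by standard (simp add: scnj_real_def)
end

instantiation complex :: real_or_complex
begin
definition scnj_complex_def: "scnj (z::complex) = cnj z"
instance by standard (simp add: scnj_complex_def complex_eq_iff inner_complex_def)
end

lemma imaginary_square:
  fixes x :: "'a::real_or_complex"
  assumes "inner x 1 = 0"
  shows "x * x = - of_real ((norm x)\<^sup>2)"
proof -
  have unit: "y * y = -1" if y: "inner y 1 = 0" "norm y = 1" for y :: 'a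
  proof -
    have y': "inner y y = 1" "inner 1 y = 0" "inner (1::'a) 1 = 1"
      using y by (simp_all add: dot_square_norm inner_commute)
    have "(norm (1 + y))\<^sup>2 = 2" "(norm (1 - y))\<^sup>2 = 2"
      using y y' by (simp_all add: power2_norm_eq_inner inner_add_left inner_add_right
        inner_diff_left inner_diff_right)
    hence "(norm ((1 - y) * (1 + y)))\<^sup>2 = 4"
      by (simp add: norm_mult power_mult_distrib)
    moreover have "(1 - y) * (1 + y) = 1 - y * y" by (simp add: algebra_simps)
    moreover have yy: "inner (y * y) (y * y) = 1"
      using y by (simp add: dot_square_norm norm_mult)
    ultimately have "inner 1 (y * y) = -1"
      using y' by (simp add: power2_norm_eq_inner inner_diff_left inner_diff_right inner_commute)
    hence "inner (y * y + 1) (y * y + 1) = 0"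
      using yy y' by (simp add: inner_add_left inner_add_right inner_commute)
    thus ?thesis by (simp add: eq_neg_iff_add_eq_0)
  qed
  show ?thesis
  proof (cases "x = 0")
    case False
    have "(x /\<^sub>R norm x) * (x /\<^sub>R norm x) = -1"
      using False assms by (intro unit) auto
    hence "(norm x * norm x) *\<^sub>R ((x /\<^sub>R norm x) * (x /\<^sub>R norm x)) = (norm x * norm x) *\<^sub>R (- 1)"
      by simp
    thus ?thesis using False by (simp add: power2_eq_square scaleR_conv_of_real field_simps)
  qed simp
qed

lemma scnj_mult_self: "scnj x * x = of_real ((norm x)\<^sup>2)"
  for x :: "'a::real_or_complex"
proof -
  define a where "a = inner x 1"
  define v where "v = x - of_real a"
  have one: "inner (1::'a) 1 = 1" by (simp add: dot_square_norm)
  have v1: "inner v 1 = 0"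
    by (simp add: v_def a_def inner_diff_left of_real_def one)
  have x: "x = of_real a + v" by (simp add: v_def)
  have "scnj x = of_real (2 * a) - x"
    using scnj_add_self[of x] by (simp add: a_def eq_diff_eq of_real_def)
  hence s: "scnj x = of_real a - v" by (simp add: v_def)
  have "(norm x)\<^sup>2 = a\<^sup>2 + (norm v)\<^sup>2"
    unfolding x power2_norm_eq_inner using v1 one
    by (simp add: inner_add_left inner_add_right of_real_def inner_commute power2_eq_square)
  moreover have "scnj x * x = of_real (a\<^sup>2) - v * v"
    unfolding s by (subst x) (simp add: algebra_simps power2_eq_square)
  ultimately show ?thesis using imaginary_square[OF v1] by simp
qed

lemma inner_scnj: "inner (scnj x * y) 1 = inner x y"
  for x y :: "'a::real_or_complex"
proof (cases "x = 0")
  case True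
  have "scnj (0::'a) = 0" using scnj_add_self[of "0::'a"] by simp
  with True show ?thesis by simp
next
  case False
  have mult: "inner (z * u) (z * w) = (norm z)\<^sup>2 * inner u w" for z u w :: 'a
  proof -
    have "inner (z * u) (z * w) = ((norm (z * (u + w)))\<^sup>2 - (norm (z * u))\<^sup>2 - (norm (z * w))\<^sup>2) / 2"
      by (simp add: power2_norm_eq_inner distrib_left inner_add_left inner_add_right inner_commute)
    also have "\<dots> = (norm z)\<^sup>2 * (((norm (u + w))\<^sup>2 - (norm u)\<^sup>2 - (norm w)\<^sup>2) / 2)"
      by (simp add: norm_mult power_mult_distrib right_diff_distrib)
    also have "((norm (u + w))\<^sup>2 - (norm u)\<^sup>2 - (norm w)\<^sup>2) / 2 = inner u w"
      by (simp add: power2_norm_eq_inner inner_add_left inner_add_right inner_commute)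
    finally show ?thesis .
  qed
  have "(norm x)\<^sup>2 * inner (scnj x * y) 1 = inner (x * (scnj x * y)) (x * 1)"
    by (rule mult[symmetric])
  also have "x * (scnj x * y) = of_real ((norm x)\<^sup>2) * y"
    by (metis scnj_mult_self mult.commute mult.assoc)
  also have "inner \<dots> (x * 1) = (norm x)\<^sup>2 * inner x y"
    by (simp add: inner_commute flip: scaleR_conv_of_real of_real_power)
  finally show ?thesis using False by simp
qed

lemma real_or_complex_cases:
  obtains (real) f :: "'a::real_or_complex \<Rightarrow> real"
      where "linear f" "bij f" "\<And>x y. f (x * y) = f x * f y" "\<And>x. norm (f x) = norm x"
        "\<And>x. f (scnj x) = f x"
  | (complex) f :: "'a::real_or_complex \<Rightarrow> complex"
      where "linear f" "bij f" "\<And>x y. f (x * y) = f x * f y" "\<And>x. norm (f x) = norm x"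
        "\<And>x. f (scnj x) = cnj (f x)"
proof -
  have one: "inner (1::'a) 1 = 1" by (simp add: dot_square_norm)
  have sc: "scnj x = of_real (2 * inner x 1) - x" for x :: 'a
    using scnj_add_self[of x] by (simp add: eq_diff_eq of_real_def)
  show thesis
  proof (cases "\<forall>x::'a. inner x 1 = 0 \<longrightarrow> x = 0")
    case True
    have eq: "x = of_real (inner x 1)" for x :: 'a
      using True[rule_format, of "x - of_real (inner x 1)"]
      by (simp add: inner_diff_left of_real_def one)
    show thesis
    proof (rule real)
      show "linear (\<lambda>x::'a. inner x 1)" by (intro linearI) (simp_all add: inner_add_left)
      show "bij (\<lambda>x::'a. inner x 1)"
        by (rule bij_betw_byWitness[where f' = of_real]) (auto simp: of_real_def one simp flip: eq[unfolded of_real_def])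
      show "inner (x * y) 1 = inner x 1 * inner y 1" for x y :: 'a
        by (subst eq[of x], subst eq[of y]) (simp add: of_real_def one)
      show "norm (inner x 1) = norm x" for x :: 'a
        by (metis eq norm_of_real real_norm_def)
      show "inner (scnj x) 1 = inner x 1" for x :: 'a
        by (simp add: sc inner_diff_left of_real_def one)
    qed
  next
    case False
    then obtain y :: 'a where y: "inner y 1 = 0" "y \<noteq> 0" by auto
    define j where "j = y /\<^sub>R norm y"
    have j: "inner j 1 = 0" "norm j = 1" "inner j j = 1" "inner 1 j = 0"
      using y by (simp_all add: j_def inner_commute dot_square_norm)
    have jj: "j * j = -1" using imaginary_square[OF j(1)] j(2) by simp
    define h where "h z = of_real (Re z) + Im z *\<^sub>R j" for z
    define f where "f x = Complex (inner x 1) (inner x j)" for x :: 'a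
    have fh: "f (h z) = z" for z
      using j one by (simp add: f_def h_def complex_eq_iff inner_add_left of_real_def)
    have hf: "h (f x) = x" for x
    proof -
      define v where "v = x - of_real (inner x 1)"
      define c where "c = norm v"
      have v1: "inner v 1 = 0" by (simp add: v_def inner_diff_left of_real_def one)
      have "(v - c *\<^sub>R j) * (v + c *\<^sub>R j) = v * v - (c * c) *\<^sub>R (j * j)"
        by (simp add: algebra_simps)
      also have "\<dots> = 0"
        using imaginary_square[OF v1]
        by (simp add: jj c_def power2_eq_square scaleR_conv_of_real)
      finally have "v = c *\<^sub>R j \<or> v = (- c) *\<^sub>R j" by (auto simp: eq_neg_iff_add_eq_0)
      then obtain b where b: "v = b *\<^sub>R j" by blast
      have "inner x j = inner v j" using j by (simp add: v_def inner_diff_left of_real_def)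
      also have "\<dots> = b" using j b by simp
      finally show ?thesis using b by (simp add: h_def f_def v_def algebra_simps)
    qed
    have hmult: "h (z * w) = h z * h w" for z w
    proof -
      have "h z * h w = of_real (Re z * Re w) + (Re z * Im w + Im z * Re w) *\<^sub>R j
          + (Im z * Im w) *\<^sub>R (j * j)"
        by (simp add: h_def algebra_simps scaleR_conv_of_real)
      thus ?thesis by (simp add: jj h_def scaleR_conv_of_real)
    qed
    show thesis
    proof (rule complex)
      show lf: "linear f"
        by (intro linearI) (simp_all add: f_def complex_eq_iff inner_add_left)
      show "bij f" by (rule bij_betw_byWitness[where f' = h]) (auto simp: fh hf)
      show "f (x * y) = f x * f y" for x y by (metis fh hf hmult)
      have nh: "norm (h z) = norm z" for z
      proof -
        have "(norm (h z))\<^sup>2 = (norm z)\<^sup>2"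
          unfolding h_def of_real_def cmod_power2 power2_norm_eq_inner using j one
          by (simp add: inner_add_left inner_add_right power2_eq_square)
        thus ?thesis by simp
      qed
      show "norm (f x) = norm x" for x by (metis nh hf)
      show "f (scnj x) = cnj (f x)" for x
        using j one by (simp add: sc f_def complex_eq_iff inner_diff_left of_real_def)
    qed
  qed
qed


subsection \<open>Matrices and singular values\<close>

text \<open>
  An \<open>m \<times> n\<close> matrix has type \<open>'a^'n^'m\<close>. The index types are linearly ordered; \<open>index_rank\<close>
  identifies such a type with \<open>{0, ..., CARD('i) - 1}\<close>, which makes the diagonal of a rectangular
  matrix and the order of the singular values meaningful.
\<close>

definition index_rank :: "'i::{finite,linorder} \<Rightarrow> nat" where
  "index_rank i = card {k. k < i}"

definition ctranspose :: "'a::real_or_complex^'n^'m \<Rightarrow> 'a^'m^'n" where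
  "ctranspose X = (\<chi> i j. scnj (X $ j $ i))"

lemma inner_matrix_eq_trace: "inner X Y = inner (trace (ctranspose X ** Y)) 1"
  for X Y :: "'a::real_or_complex^'n^'m"
proof -
  have "inner (trace (ctranspose X ** Y)) 1 = (\<Sum>i\<in>UNIV. \<Sum>k\<in>UNIV. inner (X$k$i) (Y$k$i))"
    by (simp add: trace_def ctranspose_def matrix_matrix_mult_def inner_sum_left inner_scnj)
  also have "\<dots> = (\<Sum>k\<in>UNIV. \<Sum>i\<in>UNIV. inner (X$k$i) (Y$k$i))" by (rule sum.swap)
  finally show ?thesis by (simp add: inner_vec_def)
qed

definition unitary_matrix :: "'a::real_or_complex^'p^'p \<Rightarrow> bool" where
  "unitary_matrix U \<longleftrightarrow> ctranspose U ** U = mat 1 \<and> U ** ctranspose U = mat 1"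

lemma unitary_matrix_real: "unitary_matrix U \<longleftrightarrow> orthogonal_matrix U" for U :: "real^'p^'p"
  by (simp add: unitary_matrix_def orthogonal_matrix_def ctranspose_def transpose_def scnj_real_def)

text \<open>The matrix \<open>[Diag(x) 0]\<close>.\<close>

definition rect_diag ::
  "real^'m::{finite,linorder} \<Rightarrow> 'a::real_or_complex^'n::{finite,linorder}^'m::{finite,linorder}" where
  "rect_diag x = (\<chi> i j. if index_rank i = index_rank j then of_real (x $ i) else 0)"

text \<open>
  For \<open>CARD('m) \<le> CARD('n)\<close> every matrix has a singular value decomposition, and its diagonal is
  unique once it is required to be nonnegative and nonincreasing.
\<close>

definition singular_values ::
  "'a::real_or_complex^'n::{finite,linorder}^'m::{finite,linorder} \<Rightarrow> real^'m::{finite,linorder}" where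
  "singular_values Z = (THE s.
     (\<forall>i j. i \<le> j \<longrightarrow> s $ j \<le> s $ i) \<and> (\<forall>i. 0 \<le> s $ i) \<and>
     (\<exists>U V. unitary_matrix U \<and> unitary_matrix V \<and> Z = U ** rect_diag s ** ctranspose V))"

definition svd_pairs ::
  "'a::real_or_complex^'n::{finite,linorder}^'m::{finite,linorder} \<Rightarrow>
     (('a^'m::{finite,linorder}^'m::{finite,linorder}) \<times>
      ('a^'n::{finite,linorder}^'n::{finite,linorder})) set" where
  "svd_pairs Z = {(U, V). unitary_matrix U \<and> unitary_matrix V \<and>
     Z = U ** rect_diag (singular_values Z) ** ctranspose V}"


subsection \<open>Spectral operators\<close>

definition signed_permutation_matrix :: "real^'m^'m \<Rightarrow> bool" where
  "signed_permutation_matrix Q \<longleftrightarrow>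
     (\<forall>i. \<exists>!j. Q $ i $ j \<noteq> 0) \<and> (\<forall>j. \<exists>!i. Q $ i $ j \<noteq> 0) \<and>
     (\<forall>i j. Q $ i $ j \<in> {-1, 0, 1})"

definition absolutely_symmetric_on :: "(real^'m) set \<Rightarrow> (real^'m \<Rightarrow> real^'m) \<Rightarrow> bool" where
  "absolutely_symmetric_on D g \<longleftrightarrow>
     (\<forall>x\<in>D. \<forall>Q. signed_permutation_matrix Q \<longrightarrow> g (Q *v x) = Q *v g x)"

text \<open>
  The value \<open>U [Diag(g(\<sigma>(X))) 0] V\<^sup>*\<close> is the same for all \<open>(U, V) \<in> svd_pairs X\<close> when \<open>g\<close> is
  absolutely symmetric at \<open>\<sigma>(X)\<close>, so the existential determines \<open>G\<close> on \<open>N\<close>.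
\<close>

definition spectral_operator_on ::
  "('a::real_or_complex^'n::{finite,linorder}^'m::{finite,linorder}) set \<Rightarrow> (real^'m::{finite,linorder} \<Rightarrow> real^'m::{finite,linorder}) \<Rightarrow>
     ('a^'n::{finite,linorder}^'m::{finite,linorder} \<Rightarrow> 'a^'n::{finite,linorder}^'m::{finite,linorder}) \<Rightarrow> bool" where
  "spectral_operator_on N g G \<longleftrightarrow>
     (\<forall>X\<in>N. \<exists>(U, V)\<in>svd_pairs X. G X = U ** rect_diag (g (singular_values X)) ** ctranspose V)"


subsection \<open>Nonsmooth analysis\<close>

definition lipschitz_near :: "('x::metric_space \<Rightarrow> 'y::metric_space) \<Rightarrow> 'x \<Rightarrow> bool" where
  "lipschitz_near F z \<longleftrightarrow> (\<exists>e>0. \<exists>L. L-lipschitz_on (ball z e) F)"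

definition has_dir_deriv ::
  "('x::real_normed_vector \<Rightarrow> 'y::real_normed_vector) \<Rightarrow> 'x \<Rightarrow> 'x \<Rightarrow> 'y \<Rightarrow> bool" where
  "has_dir_deriv F z h l \<longleftrightarrow> ((\<lambda>t. (F (z + t *\<^sub>R h) - F z) /\<^sub>R t) \<longlongrightarrow> l) (at_right 0)"

definition dir_differentiable ::
  "('x::real_normed_vector \<Rightarrow> 'y::real_normed_vector) \<Rightarrow> 'x \<Rightarrow> bool" where
  "dir_differentiable F z \<longleftrightarrow> (\<forall>h. \<exists>l. has_dir_deriv F z h l)"

definition dir_deriv ::
  "('x::real_normed_vector \<Rightarrow> 'y::real_normed_vector) \<Rightarrow> 'x \<Rightarrow> 'x \<Rightarrow> 'y" where
  "dir_deriv F z h = (THE l. has_dir_deriv F z h l)"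

text \<open>
  \<open>\<partial>\<^sub>BF(z)\<close> and \<open>\<partial>F(z)\<close> as sets of bounded linear maps, with convergence in operator norm.
\<close>

definition B_subdifferential ::
  "('x::real_normed_vector \<Rightarrow> 'y::real_normed_vector) \<Rightarrow> 'x \<Rightarrow> ('x \<Rightarrow>\<^sub>L 'y) set" where
  "B_subdifferential F z =
     {L. \<exists>(x :: nat \<Rightarrow> 'x) F'. (\<forall>k. (F has_derivative blinfun_apply (F' k)) (at (x k))) \<and>
        x \<longlonglongrightarrow> z \<and> F' \<longlonglongrightarrow> L}"

definition Clarke_jacobian ::
  "('x::real_normed_vector \<Rightarrow> 'y::real_normed_vector) \<Rightarrow> 'x \<Rightarrow> ('x \<Rightarrow>\<^sub>L 'y) set" where
  "Clarke_jacobian F z = convex hull (B_subdifferential F z)"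

definition strictly_differentiable_at ::
  "('x::real_normed_vector \<Rightarrow> 'y::real_normed_vector) \<Rightarrow> 'x \<Rightarrow> bool" where
  "strictly_differentiable_at F z \<longleftrightarrow>
     (\<exists>L. (F has_derivative L) (at z) \<and>
       ((\<lambda>(w, w'). (F w - F w' - L (w - w')) /\<^sub>R norm (w - w')) \<longlongrightarrow> 0)
         (at (z, z) within {(w, w'). w \<noteq> w'}))"

lemma strictly_differentiable_at_zero_deriv:
  assumes "(F has_derivative (\<lambda>_. 0)) (at z)"
  shows "strictly_differentiable_at F z \<longleftrightarrow>
    ((\<lambda>(w, w'). (F w - F w') /\<^sub>R norm (w - w')) \<longlongrightarrow> 0) (at (z, z) within {(w, w'). w \<noteq> w'})"
proof -
  have "L = (\<lambda>_. 0)" if "(F has_derivative L) (at z)" for L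
    using has_derivative_unique[OF that assms] .
  thus ?thesis using assms unfolding strictly_differentiable_at_def by fastforce
qed

end

theory Submission
  imports Defs
begin

text \<open>
  Write \<open>[x]\<close> for \<open>rect_diag x\<close>. Locally, \<open>G\<close> is the lift \<open>U [x] V\<^sup>* \<mapsto> U [g(x)] V\<^sup>*\<close> of \<open>g\<close>, for any
  decomposition with \<open>x\<close> near \<open>s0\<close>. Lifting preserves Lipschitz constants: the inner product of
  \<open>U [u] V\<^sup>*\<close> and \<open>U' [v] V'\<^sup>*\<close> is \<open>u \<bullet> W v\<close> with a doubly substochastic \<open>W\<close> independent of \<open>u\<close> and \<open>v\<close>,
  so by Birkhoff's theorem estimates reduce to signed permutation matrices, where symmetry applies.

  The lift \<open>G2\<close> of \<open>g(s0) + g'(s0; x - s0)\<close> differs from \<open>G\<close> by the lift of \<open>d\<close>, whose Lipschitz constant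
  tends to \<open>0\<close> at \<open>X0\<close>. As a lift is differentiable at \<open>U [x] V\<^sup>*\<close> iff the lifted map is
  differentiable at \<open>x\<close>, both operators are differentiable at the same points near \<open>X0\<close>, and hence have
  the same B-subdifferential at \<open>X0\<close>.

  Finally, \<open>H \<mapsto> P(H) (X0 + D(H)) Q(H)\<^sup>*\<close>, with \<open>P\<close> and \<open>Q\<close> Cayley transforms of linear maps and \<open>D\<close> linear
  into the normal space of the unitary orbit of \<open>X0\<close>, is a local diffeomorphism with derivative the identity
  at \<open>0\<close>. In this chart \<open>G2\<close> is \<open>P(H) (G(X0) + \<Psi>(D(H))) Q(H)\<^sup>*\<close>, while
  \<open>\<Psi>(H) = P'(0)H G(X0) + G(X0) (Q'(0)H)\<^sup>* + \<Psi>(D(H))\<close>; these have the same B-subdifferential at \<open>0\<close>.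
\<close>

section \<open>Extreme points of the doubly stochastic matrices\<close>

text \<open>The frames \<open>U\<close>, \<open>V\<close> of a decomposition jump where singular
  values coincide or vanish, so nothing is differentiated through them. It suffices that
  \<open>X0\<close> and each normal displacement have a common frame, because unitary invariance of
  the norm makes the estimates independent of it. The price is a comparison of two unrelated
  decompositions of nearby matrices, and convexity over the signed permutation matrices pays it. The
  detour through \<open>G2\<close> is forced: the directional derivative of \<open>G\<close> is
  linearised along the orbit and is not a lift, whereas the difference of two lifts is again a lift
  and inherits a Lipschitz constant. The balls around \<open>s0\<close> have radius at most a
  quarter of a lower bound for the nonzero distances by which signed permutations move
  \<open>s0\<close>. A signed permutation that carries a point of such a ball back into it therefore
  fixes \<open>s0\<close>. Cayley transforms are chosen because they are rational: the resolvent
  exists for every skew-Hermitian matrix, its derivative comes from the resolvent identity, and a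
  relation \<open>A ** X = X ** B\<close> passes to the transforms.\<close>

definition doubly_stochastic :: "(real^('m::finite \<times> 'm)) set" where
  "doubly_stochastic = {S. (\<forall>k. 0 \<le> S $ k) \<and> (\<forall>i. (\<Sum>j\<in>UNIV. S $ (i, j)) = 1) \<and>
     (\<forall>j. (\<Sum>i\<in>UNIV. S $ (i, j)) = 1)}"

lemma convex_doubly_stochastic: "convex (doubly_stochastic :: (real^('m::finite \<times> 'm)) set)"
  unfolding doubly_stochastic_def convex_def
  by (auto simp: sum.distrib sum_distrib_left[symmetric])

lemma doubly_stochastic_le_1:
  assumes "S \<in> doubly_stochastic" shows "S $ k \<le> 1"
proof -
  obtain i j where k: "k = (i, j)" by fastforce
  have "S $ (i, j) \<le> (\<Sum>j\<in>UNIV. S $ (i, j))"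
    using assms by (intro member_le_sum) (auto simp: doubly_stochastic_def)
  with assms k show ?thesis by (simp add: doubly_stochastic_def)
qed

lemma compact_doubly_stochastic: "compact (doubly_stochastic :: (real^('m::finite \<times> 'm)) set)"
proof -
  have "doubly_stochastic \<subseteq> cball (0 :: real^('m::finite \<times> 'm)) (\<Sum>k\<in>(UNIV::('m \<times> 'm) set). 1)"
  proof
    fix S :: "real^('m::finite \<times> 'm)" assume S: "S \<in> doubly_stochastic"
    have "norm S \<le> (\<Sum>k\<in>UNIV. \<bar>S $ k\<bar>)" by (rule norm_le_l1_cart)
    also have "\<dots> \<le> (\<Sum>k\<in>(UNIV::('m \<times> 'm) set). 1)"
      using S doubly_stochastic_le_1[OF S] by (intro sum_mono) (auto simp: doubly_stochastic_def)
    finally show "S \<in> cball 0 (\<Sum>k\<in>(UNIV::('m \<times> 'm) set). 1)" by simp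
  qed
  moreover have "closed (doubly_stochastic :: (real^('m::finite \<times> 'm)) set)"
    unfolding doubly_stochastic_def
    by (intro closed_Collect_conj closed_Collect_all closed_Collect_le closed_Collect_eq
        continuous_intros)
  ultimately show ?thesis using bounded_cball bounded_subset compact_eq_bounded_closed by blast
qed

text \<open>The mass \<open>1 - f j\<close> is positive, so some other entry is positive, and that
  entry stays below 1 because \<open>f j\<close> is positive.\<close>

lemma exists_other_fractional:
  fixes f :: "'m::finite \<Rightarrow> real"
  assumes "\<And>j. 0 \<le> f j" "sum f UNIV = 1" "0 < f j" "f j < 1"
  shows "2 \<le> card {j. 0 < f j \<and> f j < 1}"
proof -
  have "\<exists>k. k \<noteq> j \<and> 0 < f k"
  proof (rule ccontr)
    assume "\<not> ?thesis"
    hence "f k = 0" if "k \<noteq> j" for k using assms(1)[of k] that by force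
    hence "sum f UNIV = f j" by (subst sum.remove[of _ j]) auto
    thus False using assms by simp
  qed
  then obtain k where k: "k \<noteq> j" "0 < f k" by auto
  have "sum f {j, k} \<le> sum f UNIV" using assms(1) by (intro sum_mono2) auto
  hence "f k < 1" using k assms by simp
  hence "{j, k} \<subseteq> {j. 0 < f j \<and> f j < 1}" using k assms by auto
  hence "card {j, k} \<le> card {j. 0 < f j \<and> f j < 1}" by (intro card_mono) auto
  thus ?thesis using k by simp
qed

text \<open>Doubly stochastic matrices are stored as vectors indexed by pairs, so that the matrices
  supported on a given set of entries form such a coordinate subspace.\<close>

lemma dim_vanishing_off: "dim {x::real^'k. \<forall>i. i \<notin> d \<longrightarrow> x $ i = 0} = card d"
  using dim_substandard_cart[where 'a = real and d = d] by (simp add: dim_vec_eq)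

text \<open>
  There are at least as many fractional entries as rows and columns containing them, while the row
  and column sums of a matrix supported there are linearly dependent. So some nonzero matrix
  supported on the fractional entries has vanishing row and column sums.
\<close>

lemma fractional_perturbation:
  fixes S :: "real^('m::finite \<times> 'm)"
  assumes S: "S \<in> doubly_stochastic" and k: "0 < S $ k" "S $ k < 1"
  obtains E :: "real^('m::finite \<times> 'm)" where "E \<noteq> 0" "\<And>k. E $ k \<noteq> 0 \<Longrightarrow> 0 < S $ k \<and> S $ k < 1"
    "\<And>i. (\<Sum>j\<in>UNIV. E $ (i, j)) = 0" "\<And>j. (\<Sum>i\<in>UNIV. E $ (i, j)) = 0"
proof -
  define P where "P = {k. 0 < S $ k \<and> S $ k < 1}"
  define R where "R = fst ` P"
  define C where "C = snd ` P"
  define T :: "real^('m::finite \<times> 'm) \<Rightarrow> real^('m + 'm)" where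
    "T E = (\<chi> k. case k of Inl i \<Rightarrow> \<Sum>j\<in>UNIV. E $ (i, j) | Inr j \<Rightarrow> \<Sum>i\<in>UNIV. E $ (i, j))" for E
  define V :: "(real^('m::finite \<times> 'm)) set" where "V = {x. \<forall>i. i \<notin> P \<longrightarrow> x $ i = 0}"
  define Y :: "(real^('m + 'm)) set" where "Y = {x. \<forall>i. i \<notin> Inl ` R \<union> Inr ` C \<longrightarrow> x $ i = 0}"
  \<comment> \<open>The relation that makes the dimension count strict: row sums and column sums
    have the same total.\<close>
  define Y' where "Y' = {y\<in>Y. (\<Sum>i\<in>UNIV. y $ Inl i) = (\<Sum>j\<in>UNIV. y $ Inr j)}"
  have T: "linear T"
    by (rule linearI) (auto simp: T_def vec_eq_iff sum.distrib sum_distrib_left split: sum.split)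
  have V: "subspace V" by (auto simp: V_def subspace_def)
  have Y: "subspace Y" by (auto simp: Y_def subspace_def)
  have Y': "subspace Y'" using Y
    by (auto simp: Y'_def subspace_def sum.distrib sum_distrib_left[symmetric])
  have cardR: "2 * card R \<le> card P"
  proof -
    have "P = Sigma R (\<lambda>i. {j. 0 < S $ (i, j) \<and> S $ (i, j) < 1})"
      unfolding P_def R_def by (auto simp: image_iff)
    hence "card P = (\<Sum>i\<in>R. card {j. 0 < S $ (i, j) \<and> S $ (i, j) < 1})"
      using card_SigmaI[of R "\<lambda>i. {j. 0 < S $ (i, j) \<and> S $ (i, j) < 1}"] by simp
    also have "\<dots> \<ge> (\<Sum>i\<in>R. 2)"
    proof (rule sum_mono)
      fix i assume "i \<in> R"
      then obtain j where "(i, j) \<in> P" unfolding R_def by auto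
      thus "2 \<le> card {j. 0 < S $ (i, j) \<and> S $ (i, j) < 1}" using S
        by (intro exists_other_fractional[of _ j]) (auto simp: P_def doubly_stochastic_def)
    qed
    finally show ?thesis by simp
  qed
  have cardC: "2 * card C \<le> card P"
  proof -
    have "bij_betw prod.swap P (Sigma C (\<lambda>j. {i. 0 < S $ (i, j) \<and> S $ (i, j) < 1}))"
      unfolding P_def C_def by (rule bij_betw_byWitness[where f' = prod.swap]) (auto simp: image_iff)
    hence "card P = (\<Sum>j\<in>C. card {i. 0 < S $ (i, j) \<and> S $ (i, j) < 1})"
      using card_SigmaI[of C "\<lambda>j. {i. 0 < S $ (i, j) \<and> S $ (i, j) < 1}"]
      by (simp add: bij_betw_same_card)
    also have "\<dots> \<ge> (\<Sum>i\<in>C. 2)"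
    proof (rule sum_mono)
      fix j assume "j \<in> C"
      then obtain i where "(i, j) \<in> P" unfolding C_def by auto
      thus "2 \<le> card {i. 0 < S $ (i, j) \<and> S $ (i, j) < 1}" using S
        by (intro exists_other_fractional[of _ i]) (auto simp: P_def doubly_stochastic_def)
    qed
    finally show ?thesis by simp
  qed
  have dimY: "dim Y = card R + card C"
    unfolding Y_def dim_vanishing_off by (subst card_Un_disjoint) (auto simp: card_image)
  have "T ` V \<subseteq> Y'"
  proof safe
    fix E assume E: "E \<in> V"
    have "T E $ i = 0" if "i \<notin> Inl ` R \<union> Inr ` C" for i
    proof (cases i)
      case (Inl r)
      hence "(r, j) \<notin> P" for j using that unfolding R_def by force
      thus ?thesis using E Inl by (simp add: T_def V_def)
    next
      case (Inr c)
      hence "(j, c) \<notin> P" for j using that unfolding C_def by force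
      thus ?thesis using E Inr by (simp add: T_def V_def)
    qed
    moreover have "(\<Sum>i\<in>UNIV. T E $ Inl i) = (\<Sum>j\<in>UNIV. T E $ Inr j)"
      unfolding T_def by simp (rule sum.swap)
    ultimately show "T E \<in> Y'" by (simp add: Y'_def Y_def)
  qed
  moreover have "Y' \<subset> Y"
  proof -
    obtain i where i: "i \<in> R" using k by (auto simp: R_def P_def)
    have "axis (Inl i) 1 \<in> Y - Y'" using i
      by (auto simp: Y_def Y'_def axis_def)
    thus ?thesis unfolding Y'_def by blast
  qed
  ultimately have "dim (T ` V) < card R + card C"
    using dim_subset[of "T ` V" Y'] dim_psubset[of Y' Y] Y Y' dimY span_eq_iff by (metis le_less_trans)
  \<comment> \<open>Averaging \<open>cardR\<close> and \<open>cardC\<close> gives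
    \<open>card R + card C \<le> card P\<close>, and \<open>card P\<close> is the dimension of
    \<open>V\<close>.\<close>
  hence "dim (T ` V) < dim V"
    using cardR cardC unfolding V_def dim_vanishing_off by simp
  hence "\<not> inj_on T V" using dim_image_eq[OF T, of V] V by (metis less_irrefl span_eq_iff)
  then obtain x y where xy: "x \<in> V" "y \<in> V" "T x = T y" "x \<noteq> y" by (auto simp: inj_on_def)
  have TE: "T (x - y) = 0" using xy linear_diff[OF T] by simp
  show thesis
  proof
    show "x - y \<noteq> 0" using xy by simp
    show "0 < S $ k \<and> S $ k < 1" if "(x - y) $ k \<noteq> 0" for k
      using that xy by (force simp: V_def P_def simp del: split_paired_All)
    show "(\<Sum>j\<in>UNIV. (x - y) $ (i, j)) = 0" for i
      using arg_cong[OF TE, of "\<lambda>z. z $ Inl i"] by (simp add: T_def)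
    show "(\<Sum>i\<in>UNIV. (x - y) $ (i, j)) = 0" for j
      using arg_cong[OF TE, of "\<lambda>z. z $ Inr j"] by (simp add: T_def)
  qed
qed

text \<open>At a fractional entry a small multiple of the perturbation \<open>E\<close> can be both
  added and subtracted, which exhibits \<open>S\<close> as a midpoint of two other doubly stochastic
  matrices.\<close>

lemma extreme_point_doubly_stochastic:
  fixes S :: "real^('m::finite \<times> 'm)"
  assumes "S extreme_point_of doubly_stochastic"
  shows "S $ k = 0 \<or> S $ k = 1"
proof (rule ccontr)
  assume k: "\<not> ?thesis"
  have S: "S \<in> doubly_stochastic" using assms by (simp add: extreme_point_of_def)
  have "0 \<le> S $ k" using S by (simp add: doubly_stochastic_def del: split_paired_All)
  with k doubly_stochastic_le_1[OF S, of k] have "0 < S $ k" "S $ k < 1" by auto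
  then obtain E :: "real^('m::finite \<times> 'm)" where E: "E \<noteq> 0" "\<And>k. E $ k \<noteq> 0 \<Longrightarrow> 0 < S $ k \<and> S $ k < 1"
    "\<And>i. (\<Sum>j\<in>UNIV. E $ (i, j)) = 0" "\<And>j. (\<Sum>i\<in>UNIV. E $ (i, j)) = 0"
    using fractional_perturbation[OF S] by metis
  \<comment> \<open>A step for which \<open>S + t *\<^sub>R E\<close> and
    \<open>S - t *\<^sub>R E\<close> both stay nonnegative. It is positive since \<open>E\<close>
    lives on positive entries of \<open>S\<close>; the value 1 is a default where \<open>E\<close>
    vanishes.\<close>
  define t where "t = Min (range (\<lambda>k. if E $ k = 0 then 1 else S $ k / \<bar>E $ k\<bar>))"
  have t0: "0 < t" unfolding t_def using E(2) by (subst Min_gr_iff) auto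
  have tE: "t * \<bar>E $ k\<bar> \<le> S $ k" for k
  proof (cases "E $ k = 0")
    case True thus ?thesis using S by (simp add: doubly_stochastic_def del: split_paired_All)
  next
    case False
    have "t \<le> (if E $ k = 0 then 1 else S $ k / \<bar>E $ k\<bar>)" unfolding t_def by (intro Min_le) auto
    with False show ?thesis by (simp add: field_simps)
  qed
  have mem: "S + c *\<^sub>R E \<in> doubly_stochastic" if "\<bar>c\<bar> = t" for c
  proof -
    have "\<bar>c * E $ k\<bar> \<le> S $ k" for k using tE[of k] that by (simp add: abs_mult)
    hence "0 \<le> S $ k + c * E $ k" for k by (smt (verit) abs_ge_self abs_ge_minus_self)
    thus ?thesis using S E(3,4)
      by (auto simp: doubly_stochastic_def sum.distrib sum_distrib_left[symmetric])
  qed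
  have "S \<in> open_segment (S + t *\<^sub>R E) (S + (-t) *\<^sub>R E)"
  proof -
    have "S = midpoint (S + t *\<^sub>R E) (S + (-t) *\<^sub>R E)"
      by (simp add: midpoint_def vec_eq_iff)
    moreover have "S + t *\<^sub>R E \<noteq> S + (-t) *\<^sub>R E"
      using t0 E(1) by (auto simp: vec_eq_iff del: split_paired_All split_paired_Ex)
    ultimately show ?thesis using midpoint_in_open_segment by metis
  qed
  moreover have "S + t *\<^sub>R E \<in> doubly_stochastic" "S + (-t) *\<^sub>R E \<in> doubly_stochastic"
    using mem[of t] mem[of "- t"] t0 by auto
  ultimately show False using assms by (auto simp: extreme_point_of_def)
qed

lemma integral_doubly_stochastic:
  fixes S :: "real^('m::finite \<times> 'm)"
  assumes S: "S \<in> doubly_stochastic" and int: "\<And>k. S $ k = 0 \<or> S $ k = 1"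
  obtains p where "bij p" "\<And>i j. S $ (i, j) = (if j = p i then 1 else 0)"
proof -
  have ex1: "\<exists>!j. f j = 1" if "sum f UNIV = 1" "\<And>j. f j = 0 \<or> f j = (1::real)" for f :: "'m \<Rightarrow> real"
  proof -
    have "sum f UNIV = real (card {j. f j = 1})"
    proof -
      have "sum f UNIV = (\<Sum>j\<in>UNIV. if f j = 1 then 1 else 0)"
        using that(2) by (intro sum.cong) auto
      thus ?thesis by (simp add: sum.If_cases)
    qed
    hence "card {j. f j = 1} = 1" using that(1) by simp
    then obtain x where "{j. f j = 1} = {x}" by (auto simp: card_1_singleton_iff)
    hence "f j = 1 \<longleftrightarrow> j = x" for j by auto
    thus ?thesis by simp
  qed
  have row: "\<exists>!j. S $ (i, j) = 1" for i using S int by (intro ex1) (auto simp: doubly_stochastic_def)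
  have col: "\<exists>!i. S $ (i, j) = 1" for j using S int by (intro ex1) (auto simp: doubly_stochastic_def)
  define p where "p i = (THE j. S $ (i, j) = 1)" for i
  have p: "S $ (i, p i) = 1" for i unfolding p_def using row by (rule theI')
  have "inj p" using p col by (metis injI)
  hence "bij p" by (simp add: finite_UNIV_inj_surj bij_def)
  moreover have "S $ (i, j) = (if j = p i then 1 else 0)" for i j
    using p row int by (metis (full_types))
  ultimately show thesis using that by blast
qed

section \<open>Birkhoff's theorem and doubly substochastic matrices\<close>

text \<open>The half-space \<open>?H\<close> is convex and contains the extreme points, which are
  the permutation matrices; by Krein-Milman it contains their hull.\<close>

lemma doubly_stochastic_le_permutations:
  fixes S :: "real^('m::finite \<times> 'm)" and M :: "'m \<Rightarrow> 'm \<Rightarrow> real"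
  assumes S: "S \<in> doubly_stochastic" and perm: "\<And>p. bij p \<Longrightarrow> (\<Sum>i\<in>UNIV. M i (p i)) \<le> c"
  shows "(\<Sum>i\<in>UNIV. \<Sum>j\<in>UNIV. S $ (i, j) * M i j) \<le> c"
proof -
  let ?H = "{S::real^('m::finite \<times> 'm). (\<Sum>i\<in>UNIV. \<Sum>j\<in>UNIV. S $ (i, j) * M i j) \<le> c}"
  have "convex ?H"
  proof (rule convexI, safe)
    fix x y :: "real^('m::finite \<times> 'm)" and u v :: real
    let ?f = "\<lambda>S::real^('m::finite \<times> 'm). \<Sum>i\<in>UNIV. \<Sum>j\<in>UNIV. S $ (i, j) * M i j"
    assume "?f x \<le> c" "?f y \<le> c" "0 \<le> u" "0 \<le> v" "u + v = 1"
    moreover have "?f (u *\<^sub>R x + v *\<^sub>R y) = u * ?f x + v * ?f y"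
      by (simp add: distrib_right sum.distrib sum_distrib_left mult.assoc)
    ultimately show "?f (u *\<^sub>R x + v *\<^sub>R y) \<le> c" by (simp only: convex_bound_le)
  qed
  moreover have "{x. x extreme_point_of (doubly_stochastic :: (real^('m::finite \<times> 'm)) set)} \<subseteq> ?H"
  proof safe
    fix x :: "real^('m::finite \<times> 'm)" assume x: "x extreme_point_of doubly_stochastic"
    hence "x \<in> doubly_stochastic" by (simp add: extreme_point_of_def)
    then obtain p where p: "bij p" "\<And>i j. x $ (i, j) = (if j = p i then 1 else 0)"
      using integral_doubly_stochastic extreme_point_doubly_stochastic[OF x] by metis
    have "(\<Sum>i\<in>UNIV. \<Sum>j\<in>UNIV. x $ (i, j) * M i j) = (\<Sum>i\<in>UNIV. M i (p i))"
      by (simp add: p(2) if_distrib[of "\<lambda>x. x * _"] cong: if_cong)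
    thus "(\<Sum>i\<in>UNIV. \<Sum>j\<in>UNIV. x $ (i, j) * M i j) \<le> c" using perm[OF p(1)] by simp
  qed
  ultimately have "convex hull {x. x extreme_point_of (doubly_stochastic :: (real^('m::finite \<times> 'm)) set)} \<subseteq> ?H"
    by (metis (no_types, lifting) hull_minimal)
  thus ?thesis
    using Krein_Milman_Minkowski[OF compact_doubly_stochastic convex_doubly_stochastic] S by blast
qed

text \<open>Maximise the total sum over the compact set of doubly substochastic majorants of
  \<open>W\<close>. At a maximiser a deficient row and a deficient column cannot coexist, since
  their common entry could grow. As rows and columns have the same total, a deficiency on one side
  alone is impossible too.\<close>

lemma doubly_stochastic_majorant:
  fixes W :: "real^('m::finite \<times> 'm)"
  assumes W: "\<And>k. 0 \<le> W $ k" "\<And>i. (\<Sum>j\<in>UNIV. W $ (i, j)) \<le> 1" "\<And>j. (\<Sum>i\<in>UNIV. W $ (i, j)) \<le> 1"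
  obtains S where "S \<in> doubly_stochastic" "\<And>k. W $ k \<le> S $ k"
proof -
  define K where "K = {S. (\<forall>k. W $ k \<le> S $ k) \<and> (\<forall>i. (\<Sum>j\<in>UNIV. S $ (i, j)) \<le> 1) \<and>
     (\<forall>j. (\<Sum>i\<in>UNIV. S $ (i, j)) \<le> 1)}"
  have "K \<subseteq> cball (0 :: real^('m::finite \<times> 'm)) (\<Sum>k\<in>(UNIV::('m \<times> 'm) set). 1)"
  proof
    fix S :: "real^('m::finite \<times> 'm)" assume S: "S \<in> K"
    hence nn: "0 \<le> S $ k" for k
      using order_trans[OF W(1)[of k], of "S $ k"] by (simp add: K_def del: split_paired_All)
    have row: "(\<Sum>j\<in>UNIV. S $ (i, j)) \<le> 1" for i using S by (simp add: K_def)
    have "S $ (i, j) \<le> (\<Sum>j\<in>UNIV. S $ (i, j))" for i j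
      by (rule member_le_sum) (use nn in auto)
    hence "S $ (i, j) \<le> 1" for i j using row by (rule order_trans)
    hence "\<bar>S $ k\<bar> \<le> 1" for k using nn by (cases k) auto
    hence "(\<Sum>k\<in>UNIV. \<bar>S $ k\<bar>) \<le> (\<Sum>k\<in>(UNIV::('m \<times> 'm) set). 1)" by (intro sum_mono)
    thus "S \<in> cball 0 (\<Sum>k\<in>(UNIV::('m \<times> 'm) set). 1)" using norm_le_l1_cart[of S] by simp
  qed
  moreover have "closed K" unfolding K_def
    by (intro closed_Collect_conj closed_Collect_all closed_Collect_le closed_Collect_eq continuous_intros)
  ultimately have "compact K" using bounded_cball bounded_subset compact_eq_bounded_closed by blast
  moreover have "W \<in> K" using W by (simp add: K_def)
  moreover have "continuous_on K (\<lambda>S. \<Sum>k\<in>UNIV. S $ k)" by (intro continuous_intros)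
  ultimately obtain S where S: "S \<in> K" and max: "\<And>S'. S' \<in> K \<Longrightarrow> (\<Sum>k\<in>UNIV. S' $ k) \<le> (\<Sum>k\<in>UNIV. S $ k)"
    using continuous_attains_sup[of K "\<lambda>S. \<Sum>k\<in>UNIV. S $ k"] by blast
  have tot1: "(\<Sum>i\<in>UNIV. \<Sum>j\<in>UNIV. S $ (i, j)) = (\<Sum>j\<in>UNIV. \<Sum>i\<in>UNIV. S $ (i, j))" by (rule sum.swap)
  have not_both: False if i: "(\<Sum>j\<in>UNIV. S $ (i, j)) < 1" and j: "(\<Sum>i\<in>UNIV. S $ (i, j)) < 1" for i j
  proof -
    define e where "e = min (1 - (\<Sum>j\<in>UNIV. S $ (i, j))) (1 - (\<Sum>i\<in>UNIV. S $ (i, j)))"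
    have e: "0 < e" using i j by (simp add: e_def)
    let ?S = "S + axis (i, j) e"
    have row: "(\<Sum>j'\<in>UNIV. ?S $ (i', j')) = (\<Sum>j'\<in>UNIV. S $ (i', j')) + (if i' = i then e else 0)" for i'
      by (simp add: axis_def sum.distrib)
    have col: "(\<Sum>i'\<in>UNIV. ?S $ (i', j')) = (\<Sum>i'\<in>UNIV. S $ (i', j')) + (if j' = j then e else 0)" for j'
      by (simp add: axis_def sum.distrib)
    have "W $ k \<le> ?S $ k" for k using S e by (simp add: K_def axis_def add_increasing2 del: split_paired_All)
    hence "?S \<in> K" using S e unfolding K_def mem_Collect_eq row col by (auto simp: e_def)
    moreover have "(\<Sum>k\<in>UNIV. ?S $ k) = (\<Sum>k\<in>UNIV. S $ k) + e" by (simp add: axis_def sum.distrib)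
    ultimately show False using max e by fastforce
  qed
  have row1: "(\<Sum>j\<in>UNIV. S $ (i, j)) = 1" for i
  proof (rule ccontr)
    assume ni: "\<not> ?thesis"
    hence i: "(\<Sum>j\<in>UNIV. S $ (i, j)) < 1" using S unfolding K_def by (simp add: less_le)
    have "(\<Sum>i\<in>UNIV. \<Sum>j\<in>UNIV. S $ (i, j)) < (\<Sum>i\<in>(UNIV::'m set). 1)"
      using S i by (intro sum_strict_mono_ex1) (auto simp: K_def)
    moreover have "(\<Sum>i\<in>UNIV. S $ (i, j)) = 1" for j
      using not_both[OF i, of j] S unfolding K_def by (auto simp: less_le)
    ultimately show False using tot1 by simp
  qed
  have col1: "(\<Sum>i\<in>UNIV. S $ (i, j)) = 1" for j
  proof (rule ccontr)
    assume nj: "\<not> ?thesis"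
    hence j: "(\<Sum>i\<in>UNIV. S $ (i, j)) < 1" using S unfolding K_def by (simp add: less_le)
    have "(\<Sum>j\<in>UNIV. \<Sum>i\<in>UNIV. S $ (i, j)) < (\<Sum>i\<in>(UNIV::'m set). 1)"
      using S j by (intro sum_strict_mono_ex1) (auto simp: K_def)
    thus False using tot1 row1 by simp
  qed
  have "0 \<le> S $ k" for k
    using S order_trans[OF W(1)[of k], of "S $ k"] by (simp add: K_def del: split_paired_All)
  hence "S \<in> doubly_stochastic" using row1 col1 by (simp add: doubly_stochastic_def)
  thus thesis using that S by (auto simp: K_def)
qed

text \<open>The absolute values of \<open>W\<close> lie below a doubly stochastic \<open>S\<close>,
  and Birkhoff bounds the pairing of \<open>S\<close> with the absolute values of \<open>M\<close>
  by \<open>c\<close>. Signs are thus handled by the choice of \<open>Q\<close>, positions by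
  Birkhoff.\<close>

lemma affine_nonneg_of_signed_permutations:
  fixes W M :: "real^'m^'m"
  assumes nonneg: "\<And>Q. signed_permutation_matrix Q \<Longrightarrow> 0 \<le> c + inner Q M"
    and row: "\<And>i. (\<Sum>j\<in>UNIV. \<bar>W $ i $ j\<bar>) \<le> 1" and col: "\<And>j. (\<Sum>i\<in>UNIV. \<bar>W $ i $ j\<bar>) \<le> 1"
  shows "0 \<le> c + inner W M"
proof -
  obtain S :: "real^('m::finite \<times> 'm)" where S: "S \<in> doubly_stochastic" "\<And>i j. \<bar>W $ i $ j\<bar> \<le> S $ (i, j)"
    using doubly_stochastic_majorant[of "\<chi> k. \<bar>W $ fst k $ snd k\<bar>"] row col
    by (auto simp: split_paired_all)
  have "(\<Sum>i\<in>UNIV. \<Sum>j\<in>UNIV. S $ (i, j) * \<bar>M $ i $ j\<bar>) \<le> c"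
  proof (rule doubly_stochastic_le_permutations[OF S(1)])
    fix p :: "'m \<Rightarrow> 'm" assume p: "bij p"
    \<comment> \<open>The signs oppose those of \<open>M\<close>, so that \<open>inner Q M\<close>
      is as negative as the positions \<open>p\<close> allow.\<close>
    define Q :: "real^'m^'m" where
      "Q = (\<chi> i j. if j = p i then (if 0 \<le> M $ i $ j then -1 else 1) else 0)"
    have "signed_permutation_matrix Q"
      using p unfolding signed_permutation_matrix_def Q_def
      by (auto simp: bij_iff) (metis bij_pointE p)
    moreover have "inner Q M = - (\<Sum>i\<in>UNIV. \<bar>M $ i $ p i\<bar>)"
    proof -
      have "inner (Q $ i) (M $ i) = - \<bar>M $ i $ p i\<bar>" for i
      proof -
        have "inner (Q $ i) (M $ i) = (\<Sum>j\<in>UNIV. if j = p i then - \<bar>M $ i $ p i\<bar> else 0)"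
          unfolding inner_vec_def by (intro sum.cong) (auto simp: Q_def)
        thus ?thesis by simp
      qed
      thus ?thesis by (simp add: inner_vec_def[of Q] sum_negf)
    qed
    ultimately show "(\<Sum>i\<in>UNIV. \<bar>M $ i $ p i\<bar>) \<le> c" using nonneg[of Q] by simp
  qed
  moreover have "- inner W M \<le> (\<Sum>i\<in>UNIV. \<Sum>j\<in>UNIV. S $ (i, j) * \<bar>M $ i $ j\<bar>)"
  proof -
    have "- (W $ i $ j * M $ i $ j) \<le> S $ (i, j) * \<bar>M $ i $ j\<bar>" for i j
    proof -
      have "- (W $ i $ j * M $ i $ j) \<le> \<bar>W $ i $ j\<bar> * \<bar>M $ i $ j\<bar>"
        by (metis abs_ge_minus_self abs_mult)
      also have "\<dots> \<le> S $ (i, j) * \<bar>M $ i $ j\<bar>" using S(2) by (simp add: mult_right_mono)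
      finally show ?thesis .
    qed
    thus ?thesis by (simp add: inner_vec_def sum_negf[symmetric] sum_mono)
  qed
  ultimately show ?thesis by linarith
qed

section \<open>Matrices over the scalars\<close>

lemma scnj_eq: "scnj x = of_real (2 * inner x 1) - x" for x :: "'a::real_or_complex"
  using scnj_add_self[of x] by (simp add: eq_diff_eq of_real_def)

lemma linear_scnj: "linear (scnj :: 'a::real_or_complex \<Rightarrow> 'a)"
  by (rule linearI) (simp_all add: scnj_eq inner_add_left of_real_def algebra_simps)

lemma scnj_of_real [simp]: "scnj (of_real r) = (of_real r :: 'a::real_or_complex)"
proof -
  have "inner (1::'a) 1 = 1" by (simp add: dot_square_norm)
  thus ?thesis by (simp add: scnj_eq of_real_def flip: scaleR_left.diff)
qed

lemma scnj_0 [simp]: "scnj (0::'a::real_or_complex) = 0"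
  using scnj_of_real[of 0, where 'a = 'a] by simp

lemma scnj_1 [simp]: "scnj (1::'a::real_or_complex) = 1"
  using scnj_of_real[of 1, where 'a = 'a] by simp

lemma scnj_add: "scnj (x + y) = scnj x + (scnj y :: 'a::real_or_complex)"
  using linear_add[OF linear_scnj] .

lemma scnj_sum: "scnj (sum f A) = (\<Sum>i\<in>A. scnj (f i :: 'a::real_or_complex))"
  using linear_sum[OF linear_scnj] .

lemma scnj_scaleR: "scnj (r *\<^sub>R x) = r *\<^sub>R (scnj x :: 'a::real_or_complex)"
  using linear_scale[OF linear_scnj] .

lemma inner_scnj_1: "inner (scnj x) 1 = inner (x :: 'a::real_or_complex) 1"
  using inner_scnj[of x 1] by simp

lemma scnj_scnj [simp]: "scnj (scnj x) = (x :: 'a::real_or_complex)"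
  unfolding scnj_eq[of "scnj x"] inner_scnj_1 by (simp add: scnj_eq)

lemma norm_scnj [simp]: "norm (scnj x) = norm (x :: 'a::real_or_complex)"
proof (cases "x = 0")
  case False
  have "norm (scnj x) * norm x = (norm x)\<^sup>2"
    using arg_cong[OF scnj_mult_self[of x], of norm] by (simp add: norm_mult norm_power)
  with False show ?thesis by (simp add: power2_eq_square)
qed simp

lemma scnj_mult: "scnj (x * y) = scnj x * (scnj y :: 'a::real_or_complex)"
proof (cases "x * y = 0")
  case False
  have "scnj (x * y) * (x * y) = (scnj x * scnj y) * (x * y)"
    using scnj_mult_self[of "x * y"] scnj_mult_self[of x] scnj_mult_self[of y]
    by (simp add: norm_mult power_mult_distrib algebra_simps)
  with False show ?thesis using mult_right_cancel by blast
qed auto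

lemma scnj_eq_self: "scnj x = x \<Longrightarrow> x = of_real (inner x 1)" for x :: "'a::real_or_complex"
  using scnj_add_self[of x] by (simp add: of_real_def scaleR_2[symmetric] flip: scaleR_scaleR)

lemma ctranspose_nth [simp]: "ctranspose X $ i $ j = scnj (X $ j $ i)"
  by (simp add: ctranspose_def)

lemma ctranspose_ctranspose [simp]: "ctranspose (ctranspose X) = X"
  by (simp add: vec_eq_iff)

lemma linear_ctranspose: "linear ctranspose"
  by (rule linearI) (simp_all add: vec_eq_iff scnj_add scnj_scaleR)

lemma bounded_linear_ctranspose: "bounded_linear ctranspose"
  using linear_ctranspose by (rule linear_conv_bounded_linear[THEN iffD1])

lemmas ctranspose_add = linear_add[OF linear_ctranspose]
  and ctranspose_diff = linear_diff[OF linear_ctranspose]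
  and ctranspose_scaleR = linear_scale[OF linear_ctranspose]
  and ctranspose_0 = linear_0[OF linear_ctranspose]

lemma ctranspose_mult: "ctranspose (X ** Y) = ctranspose Y ** ctranspose X"
  by (simp add: vec_eq_iff matrix_matrix_mult_def scnj_sum scnj_mult mult.commute)

lemma ctranspose_mat_1 [simp]: "ctranspose (mat 1) = (mat 1 :: 'a::real_or_complex^'n^'n)"
  by (simp add: vec_eq_iff mat_def)

lemma bounded_bilinear_matrix_mult:
  "bounded_bilinear ((**) :: 'a::real_or_complex^'n^'m \<Rightarrow> 'a^'p^'n \<Rightarrow> 'a^'p^'m)"
proof -
  have "bilinear ((**) :: 'a^'n^'m \<Rightarrow> 'a^'p^'n \<Rightarrow> 'a^'p^'m)"
    unfolding bilinear_def
    by (auto intro!: linearI simp: vec_eq_iff matrix_matrix_mult_def distrib_left distrib_right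
        sum.distrib scaleR_sum_right)
  thus ?thesis by (simp add: bilinear_conv_bounded_bilinear)
qed

interpretation mat_mult: bounded_bilinear "(**) :: 'a::real_or_complex^'n^'m \<Rightarrow> 'a^'p^'n \<Rightarrow> 'a^'p^'m"
  by (rule bounded_bilinear_matrix_mult)

section \<open>Adjoints of multiplication and unitary invariance\<close>

lemma inner_mult_left: "inner (A ** X) Y = inner X (ctranspose A ** Y)"
  for A :: "'a::real_or_complex^'m^'k" and X :: "'a^'n^'m"
  by (simp add: inner_matrix_eq_trace ctranspose_mult matrix_mul_assoc)

lemma inner_mult_right: "inner (X ** B) Y = inner X (Y ** ctranspose B)"
  for X :: "'a::real_or_complex^'m^'k" and B :: "'a^'n^'m"
proof -
  have "trace (ctranspose B ** (ctranspose X ** Y)) = trace ((ctranspose X ** Y) ** ctranspose B)"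
    by (rule trace_mul_sym)
  thus ?thesis by (simp add: inner_matrix_eq_trace ctranspose_mult matrix_mul_assoc)
qed

lemma inner_ctranspose: "inner (ctranspose X) (ctranspose Y) = inner X Y"
  for X Y :: "'a::real_or_complex^'n^'m"
proof -
  have sc: "inner (scnj x) (scnj y) = inner x y" for x y :: 'a
    using inner_scnj[of "scnj x" "scnj y"] inner_scnj[of y x]
    by (simp add: mult.commute inner_commute)
  show ?thesis unfolding inner_vec_def by (simp add: sc) (rule sum.swap)
qed

lemma unitary_matrixD:
  assumes "unitary_matrix U"
  shows "ctranspose U ** U = mat 1" "U ** ctranspose U = mat 1"
    "ctranspose U ** (U ** X) = X" "U ** (ctranspose U ** Y) = Y"
    "Z ** U ** ctranspose U = Z" "Z ** ctranspose U ** U = Z"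
  using assms by (simp_all add: unitary_matrix_def matrix_mul_assoc)
    (simp_all flip: matrix_mul_assoc)

lemma unitary_ctranspose [simp]: "unitary_matrix (ctranspose U) \<longleftrightarrow> unitary_matrix U"
  by (auto simp: unitary_matrix_def)

lemma unitary_mat_1 [simp]: "unitary_matrix (mat 1)"
  by (simp add: unitary_matrix_def)

lemma unitary_mult: "unitary_matrix U \<Longrightarrow> unitary_matrix V \<Longrightarrow> unitary_matrix (U ** V)"
  by (simp add: unitary_matrix_def ctranspose_mult) (metis matrix_mul_assoc matrix_mul_rid)

lemma inner_mult_both: "inner (U ** X ** ctranspose V) Z = inner X (ctranspose U ** Z ** V)"
proof -
  have "inner (U ** X ** ctranspose V) Z = inner (U ** X) (Z ** V)"
    using inner_mult_right[of "U ** X" "ctranspose V" Z] by simp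
  also have "\<dots> = inner X (ctranspose U ** (Z ** V))" by (rule inner_mult_left)
  finally show ?thesis by (simp add: matrix_mul_assoc)
qed

lemma inner_unitary:
  assumes "unitary_matrix U" "unitary_matrix V"
  shows "inner (U ** X ** ctranspose V) (U ** Y ** ctranspose V) = inner X Y"
  using assms by (simp add: inner_mult_both matrix_mul_assoc unitary_matrixD)

lemma norm_unitary:
  assumes "unitary_matrix U" "unitary_matrix V"
  shows "norm (U ** X ** ctranspose V) = norm X"
  using inner_unitary[OF assms, of X X] by (simp add: norm_eq_sqrt_inner)

lemma norm_unitary_matrix: "unitary_matrix U \<Longrightarrow> norm U = norm (mat 1 :: 'a^'p^'p)"
  for U :: "'a::real_or_complex^'p^'p"
  using norm_unitary[of U "mat 1" "mat 1"] by simp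

lemma compact_unitary: "compact {U :: 'a::real_or_complex^'p^'p. unitary_matrix U}"
proof -
  have "closed {U :: 'a^'p^'p. unitary_matrix U}" unfolding unitary_matrix_def
    by (intro closed_Collect_conj closed_Collect_eq continuous_intros mat_mult.continuous_on
        bounded_linear.continuous_on[OF bounded_linear_ctranspose])
  moreover have "bounded {U :: 'a^'p^'p. unitary_matrix U}"
    by (rule boundedI[of _ "norm (mat 1 :: 'a^'p^'p)"]) (metis mem_Collect_eq norm_unitary_matrix order_refl)
  ultimately show ?thesis by (simp add: compact_eq_bounded_closed)
qed

section \<open>The diagonal of a rectangular matrix\<close>

lemma index_rank_inj: "inj (index_rank :: 'i::{finite,linorder} \<Rightarrow> nat)"
proof (rule linorder_injI)
  fix x y :: 'i assume "x < y"
  hence "{k. k < x} \<subset> {k. k < y}" by auto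
  thus "index_rank x \<noteq> index_rank y" unfolding index_rank_def
    by (metis finite psubset_card_mono less_irrefl)
qed

lemma range_index_rank: "range (index_rank :: 'i::{finite,linorder} \<Rightarrow> nat) = {..<CARD('i)}"
proof (rule card_subset_eq)
  show "range (index_rank :: 'i \<Rightarrow> nat) \<subseteq> {..<CARD('i)}"
    unfolding index_rank_def by (auto intro!: psubset_card_mono)
  show "card (range (index_rank :: 'i \<Rightarrow> nat)) = card {..<CARD('i)}"
    by (simp add: card_image index_rank_inj)
qed simp

text \<open>The embedding of row indices into column indices along which \<open>rect_diag\<close>
  has its entries. It is meaningful only if there are at least as many columns as rows; otherwise
  \<open>inv\<close> is applied outside the range of \<open>index_rank\<close>.\<close>

definition diag_col :: "'m::{finite,linorder} \<Rightarrow> 'n::{finite,linorder}" where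
  "diag_col i = inv index_rank (index_rank i)"

lemma index_rank_diag_col:
  assumes "CARD('m) \<le> CARD('n)"
  shows "index_rank (diag_col i :: 'n::{finite,linorder}) = index_rank (i :: 'm::{finite,linorder})"
proof -
  have "index_rank i \<in> range (index_rank :: 'n \<Rightarrow> nat)"
    using assms rangeI[of index_rank i] unfolding range_index_rank by simp
  thus ?thesis unfolding diag_col_def by (rule f_inv_into_f)
qed

lemma inj_diag_col:
  assumes "CARD('m) \<le> CARD('n)"
  shows "inj (diag_col :: 'm::{finite,linorder} \<Rightarrow> 'n::{finite,linorder})"
  by (metis assms index_rank_diag_col index_rank_inj injD injI)

lemma rect_diag_nth:
  assumes "CARD('m) \<le> CARD('n)"
  shows "(rect_diag x :: 'a::real_or_complex^'n::{finite,linorder}^'m::{finite,linorder}) $ i $ j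
    = (if j = diag_col i then of_real (x $ i) else 0)"
proof -
  have "index_rank i = index_rank j \<longleftrightarrow> j = diag_col i"
    using index_rank_diag_col[OF assms, of i] index_rank_inj[where 'i = 'n] by (metis injD)
  thus ?thesis by (simp add: rect_diag_def)
qed

lemma linear_rect_diag: "linear (rect_diag :: _ \<Rightarrow> 'a::real_or_complex^'n::{finite,linorder}^'m::{finite,linorder})"
  by (rule linearI) (simp_all add: rect_diag_def vec_eq_iff scaleR_conv_of_real[where 'a = 'a])

text \<open>The vector \<open>x\<close> may have any signs and any order, so this is a singular
  value decomposition only up to a signed permutation.\<close>

definition svd_form ::
  "'a::real_or_complex^'m::{finite,linorder}^'m::{finite,linorder} \<Rightarrow> real^'m::{finite,linorder} \<Rightarrow>
    'a^'n::{finite,linorder}^'n::{finite,linorder} \<Rightarrow> 'a^'n::{finite,linorder}^'m::{finite,linorder}" where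
  "svd_form U x V = U ** rect_diag x ** ctranspose V"

lemma linear_svd_form: "linear (\<lambda>x. svd_form U x V)"
  unfolding svd_form_def
  by (intro linearI) (simp_all add: linear_add[OF linear_rect_diag] linear_scale[OF linear_rect_diag]
      mat_mult.add_left mat_mult.add_right mat_mult.scaleR_left mat_mult.scaleR_right)

lemma inner_rect_diag:
  assumes "CARD('m) \<le> CARD('n)"
  shows "inner (rect_diag x :: 'a::real_or_complex^'n::{finite,linorder}^'m::{finite,linorder}) Y
    = (\<Sum>i\<in>UNIV. x $ i * inner 1 (Y $ i $ diag_col i))"
proof -
  have "inner ((rect_diag x :: 'a^'n::{finite,linorder}^'m::{finite,linorder}) $ i) (Y $ i) = x $ i * inner 1 (Y $ i $ diag_col i)" for i
  proof -
    have "inner ((rect_diag x :: 'a^'n::{finite,linorder}^'m::{finite,linorder}) $ i) (Y $ i)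
        = (\<Sum>j\<in>(UNIV::'n set). if j = diag_col i then x $ i * inner 1 (Y $ i $ diag_col i) else 0)"
      unfolding inner_vec_def[of _ "Y $ i"]
      by (intro sum.cong refl) (simp add: rect_diag_nth[OF assms] of_real_def)
    thus ?thesis by simp
  qed
  thus ?thesis by (simp add: inner_vec_def[of _ Y])
qed

lemma inner_rect_diag_rect_diag:
  assumes "CARD('m) \<le> CARD('n)"
  shows "inner (rect_diag x :: 'a::real_or_complex^'n::{finite,linorder}^'m::{finite,linorder}) (rect_diag y)
    = inner x y"
  unfolding inner_rect_diag[OF assms] by (simp add: rect_diag_nth[OF assms] inner_vec_def of_real_def dot_square_norm)

lemma norm_svd_form:
  fixes U :: "'a::real_or_complex^'m::{finite,linorder}^'m::{finite,linorder}" and V :: "'a^'n::{finite,linorder}^'n::{finite,linorder}"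
  assumes "CARD('m) \<le> CARD('n)" "unitary_matrix U" "unitary_matrix V"
  shows "norm (svd_form U x V) = norm x"
  using norm_unitary[OF assms(2,3), of "rect_diag x"] inner_rect_diag_rect_diag[OF assms(1), of x x, where 'a = 'a]
  by (simp add: svd_form_def norm_eq_sqrt_inner)

lemma svd_form_mult: "P ** svd_form U x V ** ctranspose Q = svd_form (P ** U) x (Q ** V)"
  by (simp add: svd_form_def ctranspose_mult matrix_mul_assoc)

text \<open>The matrix \<open>W\<close> is \<open>W\<^sub>i\<^sub>j = Re (A\<^sub>i\<^sub>j conj B\<^sub>i\<^sub>j)\<close> with \<open>A = U\<^sup>* U'\<close> and \<open>B = V\<^sup>* V'\<close>.\<close>

lemma inner_svd_form:
  fixes U U' :: "'a::real_or_complex^'m::{finite,linorder}^'m::{finite,linorder}" and V V' :: "'a^'n::{finite,linorder}^'n::{finite,linorder}"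
  assumes card: "CARD('m) \<le> CARD('n)"
    and un: "unitary_matrix U" "unitary_matrix V" "unitary_matrix U'" "unitary_matrix V'"
  obtains W :: "real^'m::{finite,linorder}^'m::{finite,linorder}" where "\<And>i. (\<Sum>j\<in>UNIV. \<bar>W $ i $ j\<bar>) \<le> 1" "\<And>j. (\<Sum>i\<in>UNIV. \<bar>W $ i $ j\<bar>) \<le> 1"
    "\<And>u v. inner (svd_form U u V) (svd_form U' v V') = inner u (W *v v)"
proof -
  define A where "A = ctranspose U ** U'"
  define B where "B = ctranspose V ** V'"
  define e where "e = (diag_col :: 'm \<Rightarrow> 'n)"
  have e: "inj e" unfolding e_def by (rule inj_diag_col[OF card])
  have A: "unitary_matrix A" and B: "unitary_matrix B"
    unfolding A_def B_def using un by (auto intro: unitary_mult)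
  have row1: "(\<Sum>j\<in>UNIV. (norm (M $ i $ j))\<^sup>2) = 1" if "unitary_matrix M" for M :: "'a^'p^'p" and i
  proof -
    have "(M ** ctranspose M) $ i $ i = 1" using that by (simp add: unitary_matrix_def mat_def)
    hence "(\<Sum>j\<in>UNIV. of_real ((norm (M $ i $ j))\<^sup>2)) = (1::'a)"
      using scnj_mult_self[where 'a = 'a] by (simp add: matrix_matrix_mult_def mult.commute)
    hence "of_real (\<Sum>j\<in>UNIV. (norm (M $ i $ j))\<^sup>2) = (of_real 1::'a)" by simp
    thus ?thesis using of_real_eq_iff by blast
  qed
  have col1: "(\<Sum>i\<in>UNIV. (norm (M $ i $ j))\<^sup>2) = 1" if "unitary_matrix M" for M :: "'a^'p^'p" and j
    using row1[of "ctranspose M" j] that by simp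
  define W :: "real^'m::{finite,linorder}^'m::{finite,linorder}" where "W = (\<chi> i j. inner 1 (A $ i $ j * scnj (B $ e i $ e j)))"
  \<comment> \<open>The mean of two squared moduli has controlled row and column sums because
    \<open>A\<close> and \<open>B\<close> are unitary. Only substochasticity results, since the
    columns of \<open>B\<close> off the diagonal positions are dropped.\<close>
  have W: "\<bar>W $ i $ j\<bar> \<le> ((norm (A $ i $ j))\<^sup>2 + (norm (B $ e i $ e j))\<^sup>2) / 2" for i j
  proof -
    have "\<bar>W $ i $ j\<bar> \<le> norm (A $ i $ j) * norm (B $ e i $ e j)"
      using Cauchy_Schwarz_ineq2[of 1 "A $ i $ j * scnj (B $ e i $ e j)"] by (simp add: W_def norm_mult)
    also have "\<dots> \<le> ((norm (A $ i $ j))\<^sup>2 + (norm (B $ e i $ e j))\<^sup>2) / 2"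
      using sum_squares_bound[of "norm (A $ i $ j)" "norm (B $ e i $ e j)"] by simp
    finally show ?thesis .
  qed
  have sub: "(\<Sum>i\<in>UNIV. h (e i)) \<le> sum h UNIV" if "\<And>p. 0 \<le> h p" for h :: "'n \<Rightarrow> real"
    using that e by (subst sum.reindex[OF e, unfolded o_def, symmetric]) (auto intro: sum_mono2)
  show thesis
  proof
    fix i
    have "(\<Sum>j\<in>UNIV. \<bar>W $ i $ j\<bar>) \<le> (\<Sum>j\<in>UNIV. ((norm (A $ i $ j))\<^sup>2 + (norm (B $ e i $ e j))\<^sup>2) / 2)"
      by (intro sum_mono W)
    also have "\<dots> \<le> (1 + 1) / 2"
      using row1[OF A, of i] row1[OF B, of "e i"] sub[of "\<lambda>p. (norm (B $ e i $ p))\<^sup>2"]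
      by (simp add: sum.distrib sum_divide_distrib[symmetric])
    finally show "(\<Sum>j\<in>UNIV. \<bar>W $ i $ j\<bar>) \<le> 1" by simp
  next
    fix j
    have "(\<Sum>i\<in>UNIV. \<bar>W $ i $ j\<bar>) \<le> (\<Sum>i\<in>UNIV. ((norm (A $ i $ j))\<^sup>2 + (norm (B $ e i $ e j))\<^sup>2) / 2)"
      by (intro sum_mono W)
    also have "\<dots> \<le> (1 + 1) / 2"
      using col1[OF A, of j] col1[OF B, of "e j"] sub[of "\<lambda>p. (norm (B $ p $ e j))\<^sup>2"]
      by (simp add: sum.distrib sum_divide_distrib[symmetric])
    finally show "(\<Sum>i\<in>UNIV. \<bar>W $ i $ j\<bar>) \<le> 1" by simp
  next
    fix u v :: "real^'m::{finite,linorder}"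
    have "inner (svd_form U u V) (svd_form U' v V') = inner (rect_diag u) (A ** rect_diag v ** ctranspose B)"
      by (simp add: svd_form_def A_def B_def inner_mult_both ctranspose_mult matrix_mul_assoc)
    also have "\<dots> = (\<Sum>i\<in>UNIV. u $ i * (\<Sum>j\<in>UNIV. W $ i $ j * v $ j))"
    proof -
      have "(A ** rect_diag v ** ctranspose B) $ i $ e i
          = (\<Sum>j\<in>UNIV. (v $ j) *\<^sub>R (A $ i $ j * scnj (B $ e i $ e j)))" for i
      proof -
        have "(A ** rect_diag v ** ctranspose B) $ i $ e i
            = (\<Sum>p\<in>UNIV. \<Sum>j\<in>UNIV. A $ i $ j * rect_diag v $ j $ p * scnj (B $ e i $ p))"
          by (simp only: matrix_matrix_mult_def vec_lambda_beta sum_distrib_right ctranspose_nth)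
        also have "\<dots> = (\<Sum>j\<in>UNIV. \<Sum>p\<in>UNIV. A $ i $ j * rect_diag v $ j $ p * scnj (B $ e i $ p))"
          by (rule sum.swap)
        also have "\<dots> = (\<Sum>j\<in>UNIV. \<Sum>p\<in>UNIV.
            if p = e j then (v $ j) *\<^sub>R (A $ i $ j * scnj (B $ e i $ e j)) else 0)"
          by (intro sum.cong refl) (simp add: rect_diag_nth[OF card] e_def scaleR_conv_of_real)
        finally show ?thesis by simp
      qed
      thus ?thesis unfolding inner_rect_diag[OF card]
        by (simp add: e_def[symmetric] inner_sum_right W_def mult.commute)
    qed
    finally show "inner (svd_form U u V) (svd_form U' v V') = inner u (W *v v)"
      by (simp add: inner_vec_def matrix_vector_mult_def)
  qed
qed

section \<open>Comparison of two decompositions\<close>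

lemma signed_permutation_transpose:
  "signed_permutation_matrix Q \<Longrightarrow> signed_permutation_matrix (transpose Q)"
  by (simp add: signed_permutation_matrix_def transpose_def)

lemma signed_permutation_orthogonal:
  assumes "signed_permutation_matrix Q"
  shows "transpose Q ** Q = mat 1"
proof -
  have "(\<Sum>k\<in>UNIV. Q $ k $ i * Q $ k $ j) = (if i = j then 1 else 0)" for i j
  proof -
    have col: "\<exists>!k. Q $ k $ i \<noteq> 0" and row: "\<exists>!j. Q $ k $ j \<noteq> 0" and Q: "Q $ k $ j \<in> {-1, 0, 1}" for i j k
      using assms by (simp_all add: signed_permutation_matrix_def)
    obtain k where k: "Q $ k $ i \<noteq> 0" "\<And>l. Q $ l $ i \<noteq> 0 \<Longrightarrow> l = k"
      using col[of i] by blast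
    have "Q $ k $ i * Q $ k $ i = 1" using Q[of k i] k(1) by auto
    moreover have "Q $ k $ j = 0" if "i \<noteq> j" using row[of k] k(1) that by blast
    moreover have "(\<Sum>k\<in>UNIV. Q $ k $ i * Q $ k $ j) = Q $ k $ i * Q $ k $ j"
      using k(2) by (subst sum.mono_neutral_right[of _ "{k}"]) auto
    ultimately show ?thesis by auto
  qed
  thus ?thesis by (simp add: vec_eq_iff matrix_matrix_mult_def transpose_def mat_def)
qed

lemma signed_permutation_inverse:
  assumes "signed_permutation_matrix Q"
  shows "transpose Q *v (Q *v x) = x" "Q *v (transpose Q *v x) = x"
  using signed_permutation_orthogonal[OF assms]
    signed_permutation_orthogonal[OF signed_permutation_transpose[OF assms]]
  by (simp_all add: matrix_vector_mul_assoc del: transpose_matrix_vector)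

lemma inner_signed_permutation:
  assumes "signed_permutation_matrix Q"
  shows "inner (Q *v x) (Q *v y) = inner x y"
  by (metis assms dot_lmul_matrix signed_permutation_inverse(1) transpose_matrix_vector inner_commute)

lemma norm_signed_permutation:
  "signed_permutation_matrix Q \<Longrightarrow> norm (Q *v x) = norm x"
  by (simp add: norm_eq_sqrt_inner inner_signed_permutation)

lemma norm_diff_signed_permutation:
  assumes "signed_permutation_matrix Q"
  shows "(norm (x - Q *v y))\<^sup>2 = inner x x + inner y y - 2 * inner x (Q *v y)"
  unfolding power2_norm_eq_inner
  by (simp add: inner_diff_left inner_diff_right inner_signed_permutation[OF assms] inner_commute)

lemma finite_signed_permutations: "finite {Q :: real^'m^'m. signed_permutation_matrix Q}"
proof -
  have "finite (Pi\<^sub>E (UNIV :: ('m \<times> 'm) set) (\<lambda>_. {-1, 0, 1::real}))"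
    by (intro finite_PiE) auto
  moreover have "{Q. signed_permutation_matrix Q} \<subseteq>
      (\<lambda>f. \<chi> i j. f (i, j)) ` (Pi\<^sub>E (UNIV :: ('m \<times> 'm) set) (\<lambda>_. {-1, 0, 1}))"
  proof
    fix Q :: "real^'m^'m" assume "Q \<in> {Q. signed_permutation_matrix Q}"
    hence "(\<lambda>(i, j). Q $ i $ j) \<in> Pi\<^sub>E UNIV (\<lambda>_. {-1, 0, 1})"
      by (auto simp: signed_permutation_matrix_def PiE_def Pi_def)
    moreover have "Q = (\<chi> i j. (\<lambda>(i, j). Q $ i $ j) (i, j))" by (simp add: vec_eq_iff)
    ultimately show "Q \<in> (\<lambda>f. \<chi> i j. f (i, j)) ` (Pi\<^sub>E UNIV (\<lambda>_. {-1, 0, 1}))"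
      by blast
  qed
  ultimately show ?thesis using finite_surj by blast
qed

definition outer_product :: "real^'m \<Rightarrow> real^'m \<Rightarrow> real^'m^'m" where
  "outer_product u v = (\<chi> i j. u $ i * v $ j)"

text \<open>Displays \<open>inner u (W *v v)\<close> as linear in \<open>W\<close>, the form to
  which \<open>affine_nonneg_of_signed_permutations\<close> applies.\<close>

lemma inner_outer_product: "inner W (outer_product u v) = inner u (W *v v)"
proof -
  have "inner W (outer_product u v) = (\<Sum>i\<in>UNIV. \<Sum>j\<in>UNIV. W $ i $ j * (u $ i * v $ j))"
    by (simp add: inner_vec_def outer_product_def)
  also have "\<dots> = inner u (W *v v)"
    by (simp add: inner_vec_def matrix_vector_mult_def sum_distrib_left mult.left_commute)
  finally show ?thesis .
qed

text \<open>
  Both squared norms in the conclusion are values at one doubly substochastic matrix of affine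
  functions whose values at a signed permutation matrix \<open>Q\<close> are the squares of
  \<open>norm (u - Q *v v)\<close> and \<open>norm (x - Q *v y)\<close>.
\<close>

lemma norm_svd_form_diff_le:
  fixes U U' :: "'a::real_or_complex^'m::{finite,linorder}^'m::{finite,linorder}"
    and V V' :: "'a^'n::{finite,linorder}^'n::{finite,linorder}"
  assumes card: "CARD('m) \<le> CARD('n)"
    and un: "unitary_matrix U" "unitary_matrix V" "unitary_matrix U'" "unitary_matrix V'"
    and L: "0 \<le> L"
    and le: "\<And>Q. signed_permutation_matrix Q \<Longrightarrow> norm (u - Q *v v) \<le> L * norm (x - Q *v y)"
  shows "norm (svd_form U u V - svd_form U' v V') \<le> L * norm (svd_form U x V - svd_form U' y V')"
proof -
  obtain W :: "real^'m::{finite,linorder}^'m::{finite,linorder}" where W: "\<And>i. (\<Sum>j\<in>UNIV. \<bar>W $ i $ j\<bar>) \<le> 1"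
      "\<And>j. (\<Sum>i\<in>UNIV. \<bar>W $ i $ j\<bar>) \<le> 1"
      "\<And>u v. inner (svd_form U u V) (svd_form U' v V') = inner u (W *v v)"
    using inner_svd_form[OF card un] by blast
  define c where "c = L\<^sup>2 * (inner x x + inner y y) - (inner u u + inner v v)"
  define M where "M = 2 *\<^sub>R outer_product u v - (2 * L\<^sup>2) *\<^sub>R outer_product x y"
  have val: "c + inner P M = L\<^sup>2 * (inner x x + inner y y - 2 * inner x (P *v y))
      - (inner u u + inner v v - 2 * inner u (P *v v))" for P
    by (simp add: c_def M_def inner_diff_right inner_outer_product algebra_simps)
  have "0 \<le> c + inner W M"
  proof (rule affine_nonneg_of_signed_permutations[OF _ W(1,2)])
    fix Q :: "real^'m::{finite,linorder}^'m::{finite,linorder}" assume Q: "signed_permutation_matrix Q"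
    have "(norm (u - Q *v v))\<^sup>2 \<le> (L * norm (x - Q *v y))\<^sup>2"
      using le[OF Q] by (intro power_mono) auto
    thus "0 \<le> c + inner Q M"
      unfolding val by (simp add: power_mult_distrib norm_diff_signed_permutation[OF Q])
  qed
  moreover have sq: "(norm (svd_form U a V - svd_form U' b V'))\<^sup>2
      = inner a a + inner b b - 2 * inner a (W *v b)" for a b
  proof -
    have "inner (svd_form U a V) (svd_form U a V) = inner a a"
      "inner (svd_form U' b V') (svd_form U' b V') = inner b b"
      using norm_svd_form[OF card un(1,2), of a] norm_svd_form[OF card un(3,4), of b]
      by (simp_all add: norm_eq_sqrt_inner)
    thus ?thesis unfolding power2_norm_eq_inner
      by (simp add: inner_diff_left inner_diff_right W(3) inner_commute[of "svd_form U' b V'" "svd_form U a V"])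
  qed
  ultimately have "(norm (svd_form U u V - svd_form U' v V'))\<^sup>2
      \<le> (L * norm (svd_form U x V - svd_form U' y V'))\<^sup>2"
    by (simp add: val power_mult_distrib sq)
  thus ?thesis using L by (meson norm_ge_zero mult_nonneg_nonneg power2_le_imp_le)
qed

text \<open>The source of well-definedness of lifts. As there are finitely many \<open>Q\<close>,
  one constant \<open>L\<close> serves all with \<open>x \<noteq> Q *v y\<close>, and for the others
  the left side of the estimate vanishes by hypothesis; so a zero distance on the right forces one
  on the left.\<close>

lemma svd_form_eqI:
  fixes U U' :: "'a::real_or_complex^'m::{finite,linorder}^'m::{finite,linorder}"
    and V V' :: "'a^'n::{finite,linorder}^'n::{finite,linorder}"
  assumes card: "CARD('m) \<le> CARD('n)"
    and un: "unitary_matrix U" "unitary_matrix V" "unitary_matrix U'" "unitary_matrix V'"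
    and eq: "svd_form U x V = svd_form U' y V'"
    and Q: "\<And>Q. signed_permutation_matrix Q \<Longrightarrow> x = Q *v y \<Longrightarrow> u = Q *v v"
  shows "svd_form U u V = svd_form U' v V'"
proof -
  define c where "c Q = norm (u - Q *v v) / norm (x - Q *v y)" for Q
  define L where "L = (\<Sum>Q | signed_permutation_matrix Q. c Q)"
  have c0: "0 \<le> c Q" for Q by (simp add: c_def)
  have "norm (svd_form U u V - svd_form U' v V') \<le> L * norm (svd_form U x V - svd_form U' y V')"
  proof (rule norm_svd_form_diff_le[OF card un])
    show "0 \<le> L" unfolding L_def using c0 by (intro sum_nonneg)
    fix P :: "real^'m::{finite,linorder}^'m::{finite,linorder}" assume P: "signed_permutation_matrix P"
    have "c P \<le> L" unfolding L_def
      using P c0 finite_signed_permutations by (intro member_le_sum) auto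
    show "norm (u - P *v v) \<le> L * norm (x - P *v y)"
    proof (cases "x = P *v y")
      case True thus ?thesis using Q[OF P] by simp
    next
      case False
      hence "norm (u - P *v v) = c P * norm (x - P *v y)" by (simp add: c_def)
      also have "\<dots> \<le> L * norm (x - P *v y)" using \<open>c P \<le> L\<close> by (simp add: mult_right_mono)
      finally show ?thesis .
    qed
  qed
  with eq show ?thesis by simp
qed

text \<open>
  The penalty \<open>C * (inner x x - inner x (P *v x))\<close> vanishes at the matrices fixing \<open>x\<close>, is positive
  at the other signed permutation matrices, and vanishes at \<open>W\<close>.
\<close>

lemma inner_svd_form_adjoint:
  fixes U U' :: "'a::real_or_complex^'m::{finite,linorder}^'m::{finite,linorder}"
    and V V' :: "'a^'n::{finite,linorder}^'n::{finite,linorder}"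
    and L :: "real^'m::{finite,linorder} \<Rightarrow> real^'m::{finite,linorder}"
  assumes card: "CARD('m) \<le> CARD('n)"
    and un: "unitary_matrix U" "unitary_matrix V" "unitary_matrix U'" "unitary_matrix V'"
    and eq: "svd_form U x V = svd_form U' x V'"
    and L: "linear L"
    and Q: "\<And>Q v. signed_permutation_matrix Q \<Longrightarrow> Q *v x = x \<Longrightarrow> L (Q *v v) = Q *v L v"
  shows "inner (svd_form U (L u) V) (svd_form U' v V') = inner (svd_form U u V) (svd_form U' (adjoint L v) V')"
proof -
  obtain W :: "real^'m::{finite,linorder}^'m::{finite,linorder}" where W: "\<And>i. (\<Sum>j\<in>UNIV. \<bar>W $ i $ j\<bar>) \<le> 1"
      "\<And>j. (\<Sum>i\<in>UNIV. \<bar>W $ i $ j\<bar>) \<le> 1"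
      "\<And>u v. inner (svd_form U u V) (svd_form U' v V') = inner u (W *v v)"
    using inner_svd_form[OF card un] by blast
  define p where "p P = inner (L u) (P *v v) - inner u (P *v adjoint L v)" for P :: "real^'m::{finite,linorder}^'m::{finite,linorder}"
  define gap where "gap P = inner x x - inner x (P *v x)" for P :: "real^'m::{finite,linorder}^'m::{finite,linorder}"
  \<comment> \<open>Division by a zero gap contributes 0; this is harmless because \<open>p\<close>
    vanishes at the matrices fixing \<open>x\<close>, as shown next.\<close>
  define C where "C = (\<Sum>Q | signed_permutation_matrix Q. \<bar>p Q\<bar> / \<bar>gap Q\<bar>)"
  have bound: "\<bar>p P\<bar> \<le> C * gap P" if P: "signed_permutation_matrix P" for P
  proof (cases "P *v x = x")
    case True
    have T: "transpose P *v x = x" using signed_permutation_inverse(1)[OF P, of x] True by simp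
    have tr: "inner a (P *v b) = inner (transpose P *v a) b" for a b
      by (metis dot_lmul_matrix transpose_matrix_vector transpose_transpose)
    have "inner (L u) (P *v v) = inner (L (transpose P *v u)) v"
      using Q[OF signed_permutation_transpose[OF P] T] by (simp add: tr)
    also have "\<dots> = inner (transpose P *v u) (adjoint L v)"
      by (rule adjoint_works[OF L, symmetric])
    finally have "p P = 0" by (simp add: p_def tr)
    thus ?thesis using True by (simp add: gap_def)
  next
    case False
    hence "0 < (norm (x - P *v x))\<^sup>2" by simp
    hence g: "0 < gap P" unfolding norm_diff_signed_permutation[OF P] gap_def by simp
    have "\<bar>p P\<bar> / \<bar>gap P\<bar> \<le> C" unfolding C_def
      using P finite_signed_permutations by (intro member_le_sum) auto
    with g show ?thesis by (simp add: field_simps)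
  qed
  \<comment> \<open>Both signs of \<open>r\<close> are used: at \<open>W\<close> the penalty
    disappears, and the two inequalities squeeze \<open>p W\<close> to 0.\<close>
  have nonneg: "0 \<le> C * gap W + r * p W" if r: "r = 1 \<or> r = -1" for r
  proof -
    define M where "M = r *\<^sub>R (outer_product (L u) v - outer_product u (adjoint L v)) - C *\<^sub>R outer_product x x"
    have val: "C * inner x x + inner P M = C * gap P + r * p P" for P
      by (simp add: M_def inner_diff_right inner_outer_product gap_def p_def algebra_simps)
    have "0 \<le> C * inner x x + inner W M"
    proof (rule affine_nonneg_of_signed_permutations[OF _ W(1,2)])
      fix P :: "real^'m::{finite,linorder}^'m::{finite,linorder}" assume "signed_permutation_matrix P"
      thus "0 \<le> C * inner x x + inner P M" using bound[of P] r by (auto simp: val)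
    qed
    thus ?thesis by (simp add: val)
  qed
  \<comment> \<open>The two frames represent the same matrix, so the pairing that defines
    \<open>W\<close> returns its squared norm.\<close>
  have "inner x (W *v x) = inner x x"
    using W(3)[of x x] eq norm_svd_form[OF card un(3,4), of x] by (simp add: norm_eq_sqrt_inner)
  hence "gap W = 0" by (simp add: gap_def)
  hence "p W = 0" using nonneg[of 1] nonneg[of "-1"] by simp
  thus ?thesis by (simp add: W(3) p_def)
qed

section \<open>The normal space of a unitary orbit\<close>

text \<open>The orthogonal complement of the tangent space, spanned by
  \<open>A ** X - X ** B\<close> with \<open>A\<close> and \<open>B\<close> skew-Hermitian, of the
  orbit of \<open>X\<close>. Orthogonality says that the skew parts of
  \<open>K ** ctranspose X\<close> and \<open>ctranspose X ** K\<close> vanish.\<close>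

definition normal_space :: "'a::real_or_complex^'n^'m \<Rightarrow> ('a^'n^'m) set" where
  "normal_space X = {K. K ** ctranspose X = X ** ctranspose K \<and> ctranspose X ** K = ctranspose K ** X}"

lemma subspace_normal_space: "subspace (normal_space X)"
  unfolding subspace_def normal_space_def
  by (simp add: ctranspose_0 ctranspose_add ctranspose_scaleR mat_mult.zero_left mat_mult.zero_right
      mat_mult.add_left mat_mult.add_right mat_mult.scaleR_left mat_mult.scaleR_right)

lemma normal_space_unitary:
  assumes "unitary_matrix U" "unitary_matrix V" "K \<in> normal_space X"
  shows "U ** K ** ctranspose V \<in> normal_space (U ** X ** ctranspose V)"
proof -
  have 1: "(U ** A ** ctranspose V) ** ctranspose (U ** B ** ctranspose V)
      = U ** (A ** ctranspose B) ** ctranspose U" for A B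
    using assms(2) by (simp add: ctranspose_mult matrix_mul_assoc unitary_matrixD)
  have 2: "ctranspose (U ** A ** ctranspose V) ** (U ** B ** ctranspose V)
      = V ** (ctranspose A ** B) ** ctranspose V" for A B
    using assms(1) by (simp add: ctranspose_mult matrix_mul_assoc unitary_matrixD)
  show ?thesis using assms(3) unfolding normal_space_def mem_Collect_eq 1 2 by simp
qed

lemma rect_diag_mult_ctranspose:
  assumes "CARD('m) \<le> CARD('n)"
  shows "(rect_diag x ** ctranspose (Y :: 'a::real_or_complex^'n::{finite,linorder}^'m::{finite,linorder})) $ i $ j
    = of_real (x $ i) * scnj (Y $ j $ diag_col i)"
    "(Y ** ctranspose (rect_diag x)) $ i $ j = Y $ i $ diag_col j * of_real (x $ j)"
  by (simp_all add: matrix_matrix_mult_def rect_diag_nth[OF assms] if_distrib[of "\<lambda>t. t * _"]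
      if_distrib[of "\<lambda>t. _ * t"] if_distrib[of scnj] cong: if_cong)

lemma ctranspose_rect_diag_mult:
  assumes "CARD('m) \<le> CARD('n)"
  shows "(ctranspose (rect_diag x :: 'a^'n::{finite,linorder}^'m::{finite,linorder}) ** (Y :: 'a::real_or_complex^'n::{finite,linorder}^'m::{finite,linorder})) $ diag_col i $ q
    = of_real (x $ i) * Y $ i $ q"
    "(ctranspose Y ** (rect_diag x :: 'a^'n::{finite,linorder}^'m::{finite,linorder})) $ p $ diag_col j = scnj (Y $ j $ p) * of_real (x $ j)"
    "q \<notin> range (diag_col :: 'm \<Rightarrow> 'n) \<Longrightarrow> (ctranspose Y ** rect_diag x) $ p $ q = 0"
    "p \<notin> range (diag_col :: 'm \<Rightarrow> 'n) \<Longrightarrow> (ctranspose (rect_diag x :: 'a^'n::{finite,linorder}^'m::{finite,linorder}) ** Y) $ p $ q = 0"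
proof -
  have e: "diag_col i = (diag_col j :: 'n) \<longleftrightarrow> i = j" for i j :: 'm
    using inj_diag_col[OF assms] by (metis injD)
  show "(ctranspose (rect_diag x :: 'a^'n::{finite,linorder}^'m::{finite,linorder}) ** Y) $ diag_col i $ q = of_real (x $ i) * Y $ i $ q"
    "(ctranspose Y ** (rect_diag x :: 'a^'n::{finite,linorder}^'m::{finite,linorder})) $ p $ diag_col j = scnj (Y $ j $ p) * of_real (x $ j)"
    by (simp_all add: matrix_matrix_mult_def rect_diag_nth[OF assms] e if_distrib[of "\<lambda>t. t * _"]
      if_distrib[of "\<lambda>t. _ * t"] if_distrib[of scnj] cong: if_cong)
  show "q \<notin> range (diag_col :: 'm \<Rightarrow> 'n) \<Longrightarrow> (ctranspose Y ** rect_diag x) $ p $ q = 0"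
    "p \<notin> range (diag_col :: 'm \<Rightarrow> 'n) \<Longrightarrow> (ctranspose (rect_diag x :: 'a^'n::{finite,linorder}^'m::{finite,linorder}) ** Y) $ p $ q = 0"
    by (auto simp: matrix_matrix_mult_def rect_diag_nth[OF assms] intro!: sum.neutral)
qed

lemma rect_diag_in_normal_space:
  assumes card: "CARD('m) \<le> CARD('n)"
  shows "rect_diag k \<in> normal_space (rect_diag x :: 'a::real_or_complex^'n::{finite,linorder}^'m::{finite,linorder})"
proof -
  have e: "diag_col i = (diag_col j :: 'n) \<longleftrightarrow> i = j" for i j :: 'm
    using inj_diag_col[OF card] by (metis injD)
  have "(rect_diag k ** ctranspose (rect_diag x :: 'a^'n::{finite,linorder}^'m::{finite,linorder})) $ i $ j
      = (rect_diag x ** ctranspose (rect_diag k :: 'a^'n::{finite,linorder}^'m::{finite,linorder})) $ i $ j" for i j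
    by (auto simp: rect_diag_mult_ctranspose[OF card] rect_diag_nth[OF card] e)
  moreover have "(ctranspose (rect_diag x :: 'a^'n::{finite,linorder}^'m::{finite,linorder}) ** (rect_diag k :: 'a^'n::{finite,linorder}^'m::{finite,linorder})) $ p $ q
      = (ctranspose (rect_diag k :: 'a^'n::{finite,linorder}^'m::{finite,linorder}) ** (rect_diag x :: 'a^'n::{finite,linorder}^'m::{finite,linorder})) $ p $ q" for p q
    by (cases "p \<in> range (diag_col :: 'm \<Rightarrow> 'n)")
      (auto simp: ctranspose_rect_diag_mult[OF card] rect_diag_nth[OF card])
  ultimately show ?thesis by (simp add: normal_space_def vec_eq_iff)
qed

lemma svd_form_in_normal_space:
  fixes U :: "'a::real_or_complex^'m::{finite,linorder}^'m::{finite,linorder}"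
    and V :: "'a^'n::{finite,linorder}^'n::{finite,linorder}"
  assumes "CARD('m) \<le> CARD('n)" "unitary_matrix U" "unitary_matrix V"
  shows "svd_form U k V \<in> normal_space (svd_form U x V)"
  using normal_space_unitary[OF assms(2,3) rect_diag_in_normal_space[OF assms(1)]]
  by (simp add: svd_form_def)

text \<open>Combining both equations multiplies each off-diagonal entry by a difference of squares
  of entries of \<open>z\<close>, which is nonzero as these are positive and distinct. Positivity
  also kills the surplus columns, and the first equation makes the diagonal real.\<close>

lemma normal_space_rect_diag:
  fixes K :: "'a::real_or_complex^'n::{finite,linorder}^'m::{finite,linorder}"
  assumes card: "CARD('m) \<le> CARD('n)"
    and z: "\<And>i. 0 < z $ i" "\<And>i j. i \<noteq> j \<Longrightarrow> z $ i \<noteq> z $ j"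
    and K: "K \<in> normal_space (rect_diag z)"
  shows "K = rect_diag (\<chi> i. inner (K $ i $ diag_col i) 1)"
proof -
  define e where "e = (diag_col :: 'm \<Rightarrow> 'n)"
  have K1: "K ** ctranspose (rect_diag z) = rect_diag z ** ctranspose K"
    and K2: "ctranspose (rect_diag z) ** K = ctranspose K ** rect_diag z"
    using K by (simp_all add: normal_space_def)
  have 1: "K $ i $ e j * of_real (z $ j) = of_real (z $ i) * scnj (K $ j $ e i)" for i j
    using arg_cong[OF K1, of "\<lambda>M. M $ i $ j"] by (simp add: rect_diag_mult_ctranspose[OF card] e_def)
  have 2: "of_real (z $ i) * K $ i $ e j = scnj (K $ j $ e i) * of_real (z $ j)" for i j
    using arg_cong[OF K2, of "\<lambda>M. M $ e i $ e j"] by (simp add: ctranspose_rect_diag_mult[OF card] e_def)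
  have 3: "K $ i $ q = 0" if "q \<notin> range e" for i q
    using arg_cong[OF K2, of "\<lambda>M. M $ e i $ q"] that z(1)[of i]
    by (simp add: ctranspose_rect_diag_mult[OF card] e_def)
  have off: "K $ i $ e j = 0" if "i \<noteq> j" for i j
  proof -
    let ?a = "of_real (z $ i) :: 'a" and ?b = "of_real (z $ j) :: 'a"
    have "?b * (K $ i $ e j * ?b) = ?a * (?b * scnj (K $ j $ e i))" by (simp add: 1)
    also have "?b * scnj (K $ j $ e i) = ?a * K $ i $ e j" by (simp add: 2 mult.commute)
    finally have "(?a * ?a - ?b * ?b) * K $ i $ e j = 0"
      by (simp only: left_diff_distrib mult.assoc mult.left_commute mult.commute[of "K $ i $ e j"] diff_self)
    moreover have ne: "?a * ?a \<noteq> ?b * ?b"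
    proof
      assume "?a * ?a = ?b * ?b"
      hence "of_real (z $ i * z $ i) = (of_real (z $ j * z $ j) :: 'a)" by simp
      hence "z $ i * z $ i = z $ j * z $ j" using of_real_eq_iff by blast
      hence "z $ i = z $ j" using z(1)[of i] z(1)[of j] by (simp add: square_eq_iff)
      thus False using z(2) that by blast
    qed
    ultimately show ?thesis by simp
  qed
  have diag: "K $ i $ e i = of_real (inner (K $ i $ e i) 1)" for i
  proof (rule scnj_eq_self)
    show "scnj (K $ i $ e i) = K $ i $ e i" using 1[of i i] z(1)[of i] by (simp add: mult.commute)
  qed
  have "K $ i $ q = rect_diag (\<chi> i. inner (K $ i $ diag_col i) 1) $ i $ q" for i q
  proof (cases "q \<in> range e")
    case True
    then obtain j where q: "q = e j" by auto
    show ?thesis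
    proof (cases "i = j")
      case True thus ?thesis using diag[of i] q by (simp add: rect_diag_nth[OF card] e_def)
    next
      case False
      hence "e j \<noteq> diag_col i" using inj_diag_col[OF card] unfolding e_def by (metis injD)
      thus ?thesis using off[OF False] q by (simp add: rect_diag_nth[OF card])
    qed
  next
    case False
    hence "q \<noteq> diag_col i" by (auto simp: e_def)
    thus ?thesis using 3[OF False] by (simp add: rect_diag_nth[OF card])
  qed
  thus ?thesis unfolding vec_eq_iff by blast
qed

lemma normal_space_svd_form:
  fixes U :: "'a::real_or_complex^'m::{finite,linorder}^'m::{finite,linorder}"
    and V :: "'a^'n::{finite,linorder}^'n::{finite,linorder}"
  assumes card: "CARD('m) \<le> CARD('n)"
    and un: "unitary_matrix U" "unitary_matrix V"
    and z: "\<And>i. 0 < z $ i" "\<And>i j. i \<noteq> j \<Longrightarrow> z $ i \<noteq> z $ j"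
    and K: "K \<in> normal_space (svd_form U z V)"
  obtains k where "K = svd_form U k V"
proof -
  let ?K = "ctranspose U ** K ** V"
  have diag: "ctranspose U ** (svd_form U z V) ** V = rect_diag z"
    using un by (simp add: svd_form_def matrix_mul_assoc unitary_matrixD)
  have "?K \<in> normal_space (rect_diag z)"
    using normal_space_unitary[of "ctranspose U" "ctranspose V" K "svd_form U z V"] un K
    by (simp add: diag)
  from normal_space_rect_diag[OF card z this] obtain k where "?K = rect_diag k" by blast
  hence "K = svd_form U k V" using un unfolding svd_form_def
    by (metis matrix_mul_assoc unitary_matrixD(4,5))
  thus thesis using that by blast
qed

section \<open>Cayley transforms and simultaneous decompositions\<close>

definition skew_hermitian :: "'a::real_or_complex^'p^'p \<Rightarrow> bool" where
  "skew_hermitian A \<longleftrightarrow> ctranspose A = - A"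

lemma subspace_skew_hermitian: "subspace {A. skew_hermitian A}"
  by (simp add: subspace_def skew_hermitian_def ctranspose_0 ctranspose_add ctranspose_scaleR)

text \<open>\<open>ctranspose\<close> is an isometry. The identity shows that a matrix orthogonal to
  its own skew part has none.\<close>

lemma inner_diff_ctranspose:
  "2 * inner (M - ctranspose M) M = inner (M - ctranspose M) (M - ctranspose M)"
  for M :: "'a::real_or_complex^'p^'p"
  using inner_ctranspose[of M M]
  by (simp add: inner_diff_left inner_diff_right inner_commute[of M "ctranspose M"])

lemma inner_skew_hermitian:
  assumes "skew_hermitian A"
  shows "inner (A ** Y) Y = 0"
proof -
  have "inner (A ** Y) Y = - inner (A ** Y) Y"
    using inner_mult_left[of A Y Y] assms
    by (simp add: skew_hermitian_def mat_mult.minus_left inner_commute)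
  thus ?thesis by simp
qed

definition skew_resolvent :: "'a::real_or_complex^'p^'p \<Rightarrow> 'a^'p^'p" where
  "skew_resolvent A = matrix_inv (mat 1 - A)"

text \<open>\<open>A ** Y\<close> is orthogonal to \<open>Y\<close>, so this is Pythagoras. It makes
  \<open>mat 1 - A\<close> invertible and its inverse nonexpansive without any smallness of
  \<open>A\<close>.\<close>

lemma norm_le_skew_hermitian:
  assumes "skew_hermitian A"
  shows "norm Y \<le> norm ((mat 1 - A) ** Y)"
proof -
  have "(norm ((mat 1 - A) ** Y))\<^sup>2 = (norm Y)\<^sup>2 + (norm (A ** Y))\<^sup>2"
    using inner_skew_hermitian[OF assms, of Y] unfolding power2_norm_eq_inner
    by (simp add: mat_mult.diff_left inner_diff_left inner_diff_right inner_commute)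
  hence "(norm Y)\<^sup>2 \<le> (norm ((mat 1 - A) ** Y))\<^sup>2" by simp
  thus ?thesis by (rule power2_le_imp_le) simp
qed

lemma skew_resolvent:
  fixes A :: "'a::real_or_complex^'p^'p"
  assumes A: "skew_hermitian A"
  shows "(mat 1 - A) ** skew_resolvent A = mat 1" "skew_resolvent A ** (mat 1 - A) = mat 1"
proof -
  let ?f = "\<lambda>Y :: 'a^'p^'p. (mat 1 - A) ** Y"
  have lin: "linear ?f" by (intro linearI) (simp_all add: mat_mult.add_right mat_mult.scaleR_right)
  have "inj ?f" unfolding linear_injective_0[OF lin]
    using norm_le_skew_hermitian[OF A] by (metis norm_le_zero_iff norm_zero)
  hence "surj ?f" by (rule linear_inj_imp_surj[OF lin])
  then obtain R where "(mat 1 - A) ** R = mat 1" by (metis surjD)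
  hence "\<exists>R. (mat 1 - A) ** R = mat 1 \<and> R ** (mat 1 - A) = mat 1"
    using matrix_left_right_inverse by blast
  from someI_ex[OF this] show "(mat 1 - A) ** skew_resolvent A = mat 1" "skew_resolvent A ** (mat 1 - A) = mat 1"
    unfolding skew_resolvent_def matrix_inv_def by blast+
qed

lemma norm_skew_resolvent_mult_le:
  assumes "skew_hermitian A"
  shows "norm (skew_resolvent A ** Y) \<le> norm Y"
  using norm_le_skew_hermitian[OF assms, of "skew_resolvent A ** Y"] skew_resolvent(1)[OF assms]
  by (simp add: matrix_mul_assoc)

text \<open>The resolvent identity, from which the derivative of the resolvent is read off.\<close>

lemma skew_resolvent_diff:
  assumes A: "skew_hermitian A" and B: "skew_hermitian B"
  shows "skew_resolvent B - skew_resolvent A = skew_resolvent B ** (B - A) ** skew_resolvent A"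
proof -
  have "B - A = (mat 1 - A) - (mat 1 - B)" by simp
  hence "skew_resolvent B ** (B - A) ** skew_resolvent A =
      skew_resolvent B ** ((mat 1 - A) ** skew_resolvent A)
      - (skew_resolvent B ** (mat 1 - B)) ** skew_resolvent A"
    by (simp only: mat_mult.diff_left mat_mult.diff_right matrix_mul_assoc)
  thus ?thesis by (simp add: skew_resolvent[OF A] skew_resolvent[OF B])
qed

text \<open>Using the resolvent identity twice leaves a remainder with two factors
  \<open>a (y - H)\<close>. Resolvents do not increase norms, so the remainder is quadratic with a
  constant independent of \<open>y\<close>.\<close>

lemma has_derivative_skew_resolvent:
  fixes a :: "'v::real_normed_vector \<Rightarrow> 'a::real_or_complex^'p^'p"
  assumes a: "bounded_linear a" and skew: "\<And>H. skew_hermitian (a H)"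
  shows "((\<lambda>H. skew_resolvent (a H)) has_derivative
      (\<lambda>E. skew_resolvent (a H) ** a E ** skew_resolvent (a H))) (at H)"
proof -
  let ?R = "\<lambda>H. skew_resolvent (a H)"
  have lin: "bounded_linear (\<lambda>E. ?R H ** a E ** ?R H)"
    by (intro bounded_linear_compose[OF mat_mult.bounded_linear_left]
        bounded_linear_compose[OF mat_mult.bounded_linear_right] a)
  obtain C where C: "0 < C" "\<And>E. norm (a E ** ?R H) \<le> C * norm E"
  proof -
    have "bounded_linear (\<lambda>E. a E ** ?R H)"
      by (intro bounded_linear_compose[OF mat_mult.bounded_linear_left] a)
    from bounded_linear.pos_bounded[OF this] show thesis using that by (auto simp: mult.commute)
  qed
  obtain K where K: "0 < K" "\<And>E Y. norm (a E ** (Y :: 'a^'p^'p)) \<le> norm E * K * norm Y"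
  proof -
    obtain K1 where K1: "0 < K1" "\<And>E. norm (a E) \<le> norm E * K1"
      using bounded_linear.pos_bounded[OF a] by blast
    obtain K2 where K2: "0 < K2" "\<And>(A :: 'a^'p^'p) (Y :: 'a^'p^'p). norm (A ** Y) \<le> norm A * norm Y * K2"
      using mat_mult.pos_bounded[where ?'m = 'p and ?'n = 'p and ?'p = 'p and ?'a = 'a] by blast
    have "norm (a E ** Y) \<le> norm E * (K1 * K2) * norm Y" for E and Y :: "'a^'p^'p"
    proof -
      have "norm (a E ** Y) \<le> norm (a E) * (norm Y * K2)" using K2(2)[of "a E" Y] by (simp add: mult.assoc)
      also have "\<dots> \<le> (norm E * K1) * (norm Y * K2)"
        using K1 K2 by (intro mult_right_mono) auto
      finally show ?thesis by (simp add: mult_ac)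
    qed
    thus thesis using that[of "K1 * K2"] K1 K2 by simp
  qed
  have bound: "norm (?R y - ?R H - ?R H ** a (y - H) ** ?R H) / norm (y - H) \<le> K * C * norm (y - H)"
    if "y \<noteq> H" for y
  proof -
  have d: "?R y - ?R H = ?R y ** a (y - H) ** ?R H"
    using skew_resolvent_diff[OF skew skew, of y H] by (simp add: linear_diff[OF bounded_linear.linear[OF a]])
  have "?R y - ?R H - ?R H ** a (y - H) ** ?R H = (?R y - ?R H) ** (a (y - H) ** ?R H)"
    unfolding d[symmetric] by (subst d) (simp only: mat_mult.diff_left matrix_mul_assoc)
  also have "\<dots> = ?R y ** (a (y - H) ** (?R H ** (a (y - H) ** ?R H)))"
    unfolding d by (simp only: matrix_mul_assoc)
  finally have "norm (?R y - ?R H - ?R H ** a (y - H) ** ?R H)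
      \<le> norm (a (y - H) ** (?R H ** (a (y - H) ** ?R H)))"
    using norm_skew_resolvent_mult_le[OF skew] by simp
  also have "\<dots> \<le> norm (y - H) * K * norm (?R H ** (a (y - H) ** ?R H))" by (rule K(2))
  also have "\<dots> \<le> norm (y - H) * K * (C * norm (y - H))"
    using C(2)[of "y - H"] norm_skew_resolvent_mult_le[OF skew, of H "a (y - H) ** ?R H"] K(1)
    by (intro mult_left_mono) auto
  finally show ?thesis using that by (simp add: field_simps)
  qed
  have "((\<lambda>y. K * C * norm (y - H)) \<longlongrightarrow> 0) (at H)" by (auto intro!: tendsto_eq_intros)
  thus ?thesis using bound by (intro has_derivativeI_sandwich[OF zero_less_one lin])
qed

text \<open>Equals \<open>(mat 1 + A) ** skew_resolvent A\<close>, because \<open>mat 1 + A\<close>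
  is twice the identity minus \<open>mat 1 - A\<close>. In this form the resolvent is the only
  nonlinear part, and the derivative at 0 is twice the identity.\<close>

definition cayley :: "'a::real_or_complex^'p^'p \<Rightarrow> 'a^'p^'p" where
  "cayley A = 2 *\<^sub>R skew_resolvent A - mat 1"

lemma skew_resolvent_0: "skew_resolvent 0 = mat 1"
  using skew_resolvent(1)[of 0] by (simp add: skew_hermitian_def ctranspose_0)

lemma cayley_0: "cayley 0 = mat 1"
  by (simp add: cayley_def skew_resolvent_0 scaleR_2)

lemma unitary_cayley:
  fixes A :: "'a::real_or_complex^'p^'p"
  assumes A: "skew_hermitian A"
  shows "unitary_matrix (cayley A)"
proof -
  let ?R = "skew_resolvent A"
  have star: "ctranspose (mat 1 - A) = mat 1 + A"
    using A by (simp add: ctranspose_diff skew_hermitian_def)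
  have s1: "ctranspose ?R ** (mat 1 + A) = mat 1"
    using arg_cong[OF skew_resolvent(1)[OF A], of ctranspose] by (simp add: ctranspose_mult star)
  have "(mat 1 + A) ** ?R = 2 *\<^sub>R ?R - (mat 1 - A) ** ?R"
    by (simp add: mat_mult.add_left mat_mult.diff_left scaleR_2)
  hence cay: "cayley A = (mat 1 + A) ** ?R" by (simp add: cayley_def skew_resolvent[OF A])
  have "ctranspose (cayley A) ** cayley A = ctranspose ?R ** ((mat 1 - A) ** (mat 1 + A)) ** ?R"
    unfolding cay using star
    by (simp add: ctranspose_mult matrix_mul_assoc) (metis ctranspose_ctranspose)
  also have "(mat 1 - A) ** (mat 1 + A) = (mat 1 + A) ** (mat 1 - A)"
    by (simp add: mat_mult.diff_left mat_mult.diff_right mat_mult.add_left mat_mult.add_right)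
  also have "ctranspose ?R ** ((mat 1 + A) ** (mat 1 - A)) ** ?R
      = (ctranspose ?R ** (mat 1 + A)) ** ((mat 1 - A) ** ?R)"
    by (simp add: matrix_mul_assoc)
  also have "\<dots> = mat 1" by (simp add: s1 skew_resolvent[OF A])
  finally show ?thesis using matrix_left_right_inverse unfolding unitary_matrix_def by blast
qed

text \<open>Intertwining passes to inverses and hence to rational functions. It keeps
  \<open>X\<close> fixed when both transforms act on it.\<close>

lemma cayley_intertwine:
  assumes A: "skew_hermitian A" and B: "skew_hermitian B" and AB: "A ** X = X ** B"
  shows "cayley A ** X = X ** cayley B"
proof -
  have "(mat 1 - A) ** X = X ** (mat 1 - B)" using AB by (simp add: mat_mult.diff_left mat_mult.diff_right)
  hence "skew_resolvent A ** ((mat 1 - A) ** X) ** skew_resolvent B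
      = skew_resolvent A ** (X ** (mat 1 - B)) ** skew_resolvent B" by simp
  also have "\<dots> = skew_resolvent A ** X ** ((mat 1 - B) ** skew_resolvent B)"
    by (simp only: matrix_mul_assoc)
  finally have "X ** skew_resolvent B = skew_resolvent A ** X"
    by (simp add: matrix_mul_assoc skew_resolvent[OF A] skew_resolvent[OF B])
  thus ?thesis by (simp add: cayley_def mat_mult.diff_left mat_mult.diff_right mat_mult.scaleR_left mat_mult.scaleR_right)
qed

lemma has_derivative_cayley:
  fixes a :: "'v::real_normed_vector \<Rightarrow> 'a::real_or_complex^'p^'p"
  assumes a: "bounded_linear a" and skew: "\<And>H. skew_hermitian (a H)"
  shows "((\<lambda>H. cayley (a H)) has_derivative
      (\<lambda>E. 2 *\<^sub>R (skew_resolvent (a H) ** a E ** skew_resolvent (a H)))) (at H)"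
  unfolding cayley_def
  by (rule has_derivative_eq_rhs[OF has_derivative_diff[OF has_derivative_scaleR_right[OF
      has_derivative_skew_resolvent[OF assms]] has_derivative_const]]) simp

text \<open>
  Among the decompositions of \<open>X\<close> maximise the pairing of \<open>Z = U [z] V\<^sup>*\<close> with \<open>K\<close>. Moving along
  the Cayley transforms of \<open>A = K Z\<^sup>* - Z K\<^sup>*\<close> and \<open>B = K\<^sup>* Z - Z\<^sup>* K\<close>, which fix \<open>X\<close> because
  \<open>A X = X B\<close>, changes the pairing at the rate \<open>\<parallel>A\<parallel>\<^sup>2 + \<parallel>B\<parallel>\<^sup>2\<close>. So both vanish at the maximum,
  that is, \<open>K\<close> is normal to the orbit of \<open>Z\<close>.
\<close>

lemma simultaneous_svd:
  fixes U0 :: "'a::real_or_complex^'m::{finite,linorder}^'m::{finite,linorder}"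
    and V0 :: "'a^'n::{finite,linorder}^'n::{finite,linorder}"
  assumes card: "CARD('m) \<le> CARD('n)"
    and un0: "unitary_matrix U0" "unitary_matrix V0"
    and X: "X = svd_form U0 x V0"
    and K: "K \<in> normal_space X"
  obtains U V k where "unitary_matrix U" "unitary_matrix V" "X = svd_form U x V" "K = svd_form U k V"
proof -
  \<comment> \<open>Any vector with distinct positive entries serves as reference; the summand 1 is
    there because ranks start at 0.\<close>
  define z :: "real^'m::{finite,linorder}" where "z = (\<chi> i. real (index_rank i) + 1)"
  have z: "0 < z $ i" "i \<noteq> j \<Longrightarrow> z $ i \<noteq> z $ j" for i j
    using index_rank_inj[where 'i = 'm] by (auto simp: z_def inj_def)
  define S where "S = ({U. unitary_matrix U} \<times> {V. unitary_matrix V}) \<inter> {p. svd_form (fst p) x (snd p) = X}"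
  have cont: "continuous_on T (\<lambda>p. svd_form (fst p) y (snd p) :: 'a^'n::{finite,linorder}^'m::{finite,linorder})" for T y
    unfolding svd_form_def
    by (intro continuous_intros mat_mult.continuous_on bounded_linear.continuous_on[OF bounded_linear_ctranspose])
  have "compact S" unfolding S_def
    by (intro compact_Int_closed compact_Times compact_unitary closed_Collect_eq cont continuous_intros)
  moreover have "(U0, V0) \<in> S" using un0 X by (simp add: S_def)
  ultimately obtain U V where UV: "(U, V) \<in> S"
    and max: "\<And>U' V'. (U', V') \<in> S \<Longrightarrow> inner (svd_form U' z V') K \<le> inner (svd_form U z V) K"
    using continuous_attains_sup[of S "\<lambda>p. inner (svd_form (fst p) z (snd p)) K"]
      continuous_on_inner[OF cont continuous_on_const] by fastforce
  have un: "unitary_matrix U" "unitary_matrix V" and XUV: "X = svd_form U x V"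
    using UV by (auto simp: S_def)
  define Z where "Z = svd_form U z V"
  have ZX: "Z \<in> normal_space X" unfolding Z_def XUV by (rule svd_form_in_normal_space[OF card un])
  define A where "A = K ** ctranspose Z - Z ** ctranspose K"
  define B where "B = ctranspose K ** Z - ctranspose Z ** K"
  have A: "skew_hermitian A" and B: "skew_hermitian B"
    by (simp_all add: A_def B_def skew_hermitian_def ctranspose_diff ctranspose_mult)
  \<comment> \<open>Rests on the normality of both \<open>Z\<close> and \<open>K\<close> to the
    orbit of \<open>X\<close>.\<close>
  have AX: "A ** X = X ** B"
  proof -
    have "A ** X = K ** (ctranspose Z ** X) - Z ** (ctranspose K ** X)"
      by (simp add: A_def mat_mult.diff_left matrix_mul_assoc)
    also have "\<dots> = K ** (ctranspose X ** Z) - Z ** (ctranspose X ** K)"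
      using ZX K by (simp add: normal_space_def)
    also have "\<dots> = (K ** ctranspose X) ** Z - (Z ** ctranspose X) ** K"
      by (simp only: matrix_mul_assoc)
    also have "\<dots> = (X ** ctranspose K) ** Z - (X ** ctranspose Z) ** K"
      using ZX K by (simp add: normal_space_def)
    also have "\<dots> = X ** B"
      by (simp only: B_def mat_mult.diff_right matrix_mul_assoc)
    finally show ?thesis .
  qed
  have skew: "skew_hermitian (t *\<^sub>R M)" if "skew_hermitian M" for t and M :: "'a^'q^'q"
    using that subspace_skew_hermitian[where 'a = 'a and 'b = 'q] by (simp add: subspace_def)
  define f where "f t = inner (cayley (t *\<^sub>R A) ** Z ** ctranspose (cayley (t *\<^sub>R B))) K" for t
  have f_le: "f t \<le> f 0" for t
  proof -
    let ?P = "cayley (t *\<^sub>R A)" and ?Q = "cayley (t *\<^sub>R B)"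
    have P: "unitary_matrix ?P" and Q: "unitary_matrix ?Q"
      using A B by (simp_all add: skew unitary_cayley)
    have "?P ** X = X ** ?Q"
      using A B AX by (intro cayley_intertwine skew) (simp_all add: mat_mult.scaleR_left mat_mult.scaleR_right)
    hence "?P ** X ** ctranspose ?Q = X" using Q by (simp add: unitary_matrixD)
    hence "(?P ** U, ?Q ** V) \<in> S"
      using P Q un by (simp add: S_def unitary_mult XUV svd_form_mult)
    from max[OF this] show ?thesis
      by (simp add: f_def Z_def svd_form_mult cayley_0)
  qed
  have bl: "bounded_linear (\<lambda>t::real. t *\<^sub>R M)" for M :: "'a^'q^'q"
    by (rule bounded_linear_scaleR_left)
  have dA: "((\<lambda>t. cayley (t *\<^sub>R A)) has_derivative (\<lambda>t. 2 *\<^sub>R t *\<^sub>R A)) (at 0)"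
    using has_derivative_cayley[OF bl skew[OF A], of 0] by (simp add: skew_resolvent_0)
  have "((\<lambda>t. cayley (t *\<^sub>R B)) has_derivative (\<lambda>t. 2 *\<^sub>R t *\<^sub>R B)) (at 0)"
    using has_derivative_cayley[OF bl skew[OF B], of 0] by (simp add: skew_resolvent_0)
  from bounded_linear.has_derivative[OF bounded_linear_ctranspose this]
  have dB: "((\<lambda>t. ctranspose (cayley (t *\<^sub>R B))) has_derivative (\<lambda>t. - (2 *\<^sub>R t *\<^sub>R B))) (at 0)"
    using B by (simp add: ctranspose_scaleR skew_hermitian_def)
  have "(f has_derivative (*) (2 * inner (A ** Z - Z ** B) K)) (at 0)"
    unfolding f_def
    by (rule has_derivative_eq_rhs[OF has_derivative_inner_left[OF
        mat_mult.FDERIV[OF mat_mult.FDERIV[OF dA has_derivative_const] dB]]])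
      (simp add: fun_eq_iff cayley_0 mat_mult.scaleR_left mat_mult.scaleR_right mat_mult.zero_right mat_mult.minus_right
        inner_diff_left inner_add_left algebra_simps)
  hence "DERIV f 0 :> 2 * inner (A ** Z - Z ** B) K"
    by (simp add: has_field_derivative_def)
  hence "2 * inner (A ** Z - Z ** B) K = 0"
    using f_le by (intro DERIV_local_max[of f _ 0 1]) auto
  moreover have "2 * inner (A ** Z) K = inner A A"
    using inner_diff_ctranspose[of "K ** ctranspose Z"]
    by (simp add: A_def inner_mult_right ctranspose_mult)
  moreover have "2 * inner (Z ** B) K = - inner B B"
  proof -
    define M where "M = ctranspose Z ** K - ctranspose (ctranspose Z ** K)"
    have "B = - M" by (simp add: B_def M_def ctranspose_mult)
    thus ?thesis using inner_diff_ctranspose[of "ctranspose Z ** K"]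
      unfolding M_def[symmetric] inner_mult_left by simp
  qed
  ultimately have "inner A A + inner B B = 0" by (simp add: inner_diff_left)
  hence "A = 0" "B = 0" using inner_ge_zero[of A] inner_ge_zero[of B]
    by (simp_all add: add_nonneg_eq_0_iff)
  \<comment> \<open>Since the entries of \<open>z\<close> are distinct and positive, normality to
    the orbit of \<open>Z\<close> already forces \<open>K\<close> to be diagonal in the frame of
    \<open>Z\<close>.\<close>
  hence "K \<in> normal_space Z" by (simp add: A_def B_def normal_space_def)
  then obtain k where "K = svd_form U k V"
    using normal_space_svd_form[OF card un, of z K] z unfolding Z_def by blast
  thus thesis using that un XUV by blast
qed

section \<open>Charts normal to a unitary orbit\<close>

text \<open>Split \<open>H\<close> along the tangent space. That the orthogonal part is normal is
  seen by testing it against the tangent vectors built from the skew parts of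
  \<open>K ** ctranspose X\<close> and \<open>ctranspose X ** K\<close> themselves.\<close>

lemma normal_space_decomposition:
  fixes X H :: "'a::real_or_complex^'n^'m"
  obtains A B K where "skew_hermitian A" "skew_hermitian B" "K \<in> normal_space X"
    "H = K + (A ** X - X ** B)"
proof -
  define T where "T = (\<lambda>(A, B). A ** X - X ** B) ` ({A. skew_hermitian A} \<times> {B. skew_hermitian B})"
  have lin: "linear (\<lambda>(A, B). A ** X - X ** B)"
    by (rule linearI) (auto simp: mat_mult.add_left mat_mult.add_right mat_mult.scaleR_left mat_mult.scaleR_right scaleR_diff_right)
  have "subspace T" unfolding T_def
    by (intro linear_subspace_image lin subspace_Times subspace_skew_hermitian)
  hence span: "span T = T" by (simp add: span_eq_iff)
  obtain t K where tK: "t \<in> T" "\<And>w. w \<in> T \<Longrightarrow> orthogonal K w" "H = t + K"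
    using orthogonal_subspace_decomp_exists[of T H] unfolding span by blast
  obtain A B where AB: "skew_hermitian A" "skew_hermitian B" "t = A ** X - X ** B"
    using tK(1) unfolding T_def by auto
  have 0: "inner (A ** X - X ** B) K = 0" if "skew_hermitian A" "skew_hermitian B" for A B
  proof -
    have "A ** X - X ** B \<in> T" unfolding T_def using that by force
    from tK(2)[OF this] show ?thesis by (simp add: orthogonal_def inner_commute)
  qed
  have s0: "skew_hermitian (0 :: 'a^'q^'q)" by (simp add: skew_hermitian_def ctranspose_0)
  have "K \<in> normal_space X"
  proof -
    define A where "A = K ** ctranspose X - X ** ctranspose K"
    define B where "B = ctranspose X ** K - ctranspose K ** X"
    have A: "skew_hermitian A" and B: "skew_hermitian B"
      by (simp_all add: A_def B_def skew_hermitian_def ctranspose_diff ctranspose_mult)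
    have "inner A A = 2 * inner (A ** X) K"
      using inner_diff_ctranspose[of "K ** ctranspose X"]
      by (simp add: A_def inner_mult_right ctranspose_mult)
    also have "\<dots> = 0" using 0[OF A s0] by (simp add: mat_mult.zero_right)
    finally have "A = 0" by simp
    moreover have "inner B B = 2 * inner (X ** B) K"
      using inner_diff_ctranspose[of "ctranspose X ** K"]
      by (simp add: B_def inner_mult_left ctranspose_mult)
    hence "inner B B = 0" using 0[OF s0 B] by (simp add: mat_mult.zero_left)
    hence "B = 0" by simp
    ultimately show ?thesis by (simp add: A_def B_def normal_space_def)
  qed
  thus thesis using that[of A B K] AB tK(3) by (simp add: add.commute)
qed

text \<open>
  A chart of the matrix space around \<open>X\<close> adapted to the two-sided unitary action: the curves
  \<open>P H\<close>, \<open>Q H\<close> of unitary matrices move along the orbit of \<open>X\<close>, and \<open>D H\<close> is normal to the orbit.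
\<close>

locale normal_chart =
  fixes X :: "'a::real_or_complex^'n^'m"
    and P P' Q Q' and D :: "'a^'n^'m \<Rightarrow> 'a^'n^'m"
  assumes unitary_P: "unitary_matrix (P H :: 'a^'m^'m)"
    and unitary_Q: "unitary_matrix (Q H :: 'a^'n^'n)"
    and P_0: "P 0 = mat 1" and Q_0: "Q 0 = mat 1"
    and P_deriv: "(P has_derivative P' H) (at H)"
    and Q_deriv: "(Q has_derivative Q' H) (at H)"
    and P'_cont: "continuous_on UNIV (\<lambda>H. P' H E)"
    and Q'_cont: "continuous_on UNIV (\<lambda>H. Q' H E)"
    and P'_skew: "skew_hermitian (P' 0 E)" and Q'_skew: "skew_hermitian (Q' 0 E)"
    and D_linear: "bounded_linear D" and D_normal: "D H \<in> normal_space X"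
    and decomp: "D H + P' 0 H ** X + X ** ctranspose (Q' 0 H) = H"

text \<open>The decomposition of \<open>H\<close> is not unique, so it is chosen on the standard
  basis and extended linearly; this makes all three parts linear in \<open>H\<close>.\<close>

lemma normal_chart_exists:
  fixes X :: "'a::real_or_complex^'n^'m"
  obtains P P' Q Q' D where "normal_chart X P P' Q Q' D"
proof -
  have "\<exists>A B K. skew_hermitian A \<and> skew_hermitian B \<and> K \<in> normal_space X \<and> H = K + (A ** X - X ** B)" for H
    using normal_space_decomposition[of X H] by metis
  then obtain A B K where ABK: "\<And>H. skew_hermitian (A H)" "\<And>H. skew_hermitian (B H)"
    "\<And>H. K H \<in> normal_space X" "\<And>H. H = K H + (A H ** X - X ** B H)" by metis
  \<comment> \<open>The factor 1/2 cancels the factor 2 in the derivative of \<open>cayley\<close>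
    at 0.\<close>
  define a where "a H = (1/2) *\<^sub>R (\<Sum>b\<in>Basis. inner H b *\<^sub>R A b)" for H
  define b where "b H = (1/2) *\<^sub>R (\<Sum>b\<in>Basis. inner H b *\<^sub>R B b)" for H
  define D where "D H = (\<Sum>b\<in>Basis. inner H b *\<^sub>R K b)" for H
  have a: "bounded_linear a" and b: "bounded_linear b" and D: "bounded_linear D"
    unfolding a_def b_def D_def by (intro bounded_linear_intros)+
  have "a H \<in> {A. skew_hermitian A}" "b H \<in> {A. skew_hermitian A}" for H
    unfolding a_def b_def using ABK(1,2)
    by (intro subspace_mul subspace_sum subspace_skew_hermitian; simp)+
  hence skew: "skew_hermitian (a H)" "skew_hermitian (b H)" for H by auto
  have normal: "D H \<in> normal_space X" for H
    unfolding D_def using ABK(3) subspace_normal_space by (intro subspace_sum subspace_mul)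
  have decomp: "D H + 2 *\<^sub>R a H ** X - X ** (2 *\<^sub>R b H) = H" for H
  proof -
    have "H = (\<Sum>b\<in>Basis. inner H b *\<^sub>R b)" by (simp add: euclidean_representation)
    also have "\<dots> = (\<Sum>b\<in>Basis. inner H b *\<^sub>R (K b + (A b ** X - X ** B b)))"
      using ABK(4) by simp
    also have "\<dots> = D H + 2 *\<^sub>R a H ** X - X ** (2 *\<^sub>R b H)"
      by (simp add: D_def a_def b_def scaleR_add_right scaleR_diff_right sum.distrib sum_subtractf
          mat_mult.sum_left mat_mult.sum_right mat_mult.scaleR_left mat_mult.scaleR_right)
    finally show ?thesis by simp
  qed
  let ?P' = "\<lambda>H E. 2 *\<^sub>R (skew_resolvent (a H) ** a E ** skew_resolvent (a H))"
  let ?Q' = "\<lambda>H E. 2 *\<^sub>R (skew_resolvent (b H) ** b E ** skew_resolvent (b H))"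
  have "a 0 = 0" "b 0 = 0" using a b by (simp_all add: linear_0 bounded_linear.linear)
  have cont: "continuous_on UNIV (\<lambda>H. skew_resolvent (c H))"
    if "bounded_linear c" "\<And>H. skew_hermitian (c H)" for c :: "'a^'n^'m \<Rightarrow> 'a^'q^'q"
    by (intro continuous_at_imp_continuous_on ballI
        has_derivative_continuous[OF has_derivative_skew_resolvent[OF that]])
  have "normal_chart X (\<lambda>H. cayley (a H)) ?P' (\<lambda>H. cayley (b H)) ?Q' D"
  proof (unfold normal_chart_def, intro conjI allI)
    show "unitary_matrix (cayley (a H))" "unitary_matrix (cayley (b H))" for H
      using skew by (simp_all add: unitary_cayley)
    show "cayley (a 0) = mat 1" "cayley (b 0) = mat 1"
      using \<open>a 0 = 0\<close> \<open>b 0 = 0\<close> by (simp_all add: cayley_0)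
    show "((\<lambda>H. cayley (a H)) has_derivative ?P' H) (at H)" "((\<lambda>H. cayley (b H)) has_derivative ?Q' H) (at H)" for H
      by (intro has_derivative_cayley a b skew)+
    show "continuous_on UNIV (\<lambda>H. ?P' H E)" "continuous_on UNIV (\<lambda>H. ?Q' H E)" for E
      by (intro continuous_intros mat_mult.continuous_on cont a b skew)+
    show "skew_hermitian (?P' 0 E)" "skew_hermitian (?Q' 0 E)" for E
      using skew[of E] \<open>a 0 = 0\<close> \<open>b 0 = 0\<close>
      by (simp_all add: skew_resolvent_0 skew_hermitian_def ctranspose_scaleR)
    show "D H + ?P' 0 H ** X + X ** ctranspose (?Q' 0 H) = H" for H
      using decomp[of H] \<open>a 0 = 0\<close> \<open>b 0 = 0\<close> skew(2)[of H]
      by (simp add: skew_resolvent_0 skew_hermitian_def ctranspose_scaleR mat_mult.minus_right mat_mult.scaleR_right)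
  qed (rule D normal)+
  thus thesis by (rule that)
qed

context normal_chart
begin

definition chart :: "'a^'n^'m \<Rightarrow> 'a^'n^'m" where
  "chart H = P H ** (X + D H) ** ctranspose (Q H)"

definition chart' :: "'a^'n^'m \<Rightarrow> (('a^'n^'m) \<Rightarrow>\<^sub>L ('a^'n^'m))" where
  "chart' H = Blinfun (\<lambda>E. (P' H E ** (X + D H) + P H ** D E) ** ctranspose (Q H)
     + P H ** (X + D H) ** ctranspose (Q' H E))"

lemma D_0: "D 0 = 0"
  using D_linear by (simp add: linear_0 bounded_linear.linear)

lemma chart_0: "chart 0 = X"
  by (simp add: chart_def P_0 Q_0 D_0)

lemma has_derivative_ctranspose_Q: "((\<lambda>H. ctranspose (Q H)) has_derivative (\<lambda>E. ctranspose (Q' H E))) (at H)"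
  by (rule bounded_linear.has_derivative[OF bounded_linear_ctranspose Q_deriv])

lemma has_derivative_two_sided:
  assumes "(Y has_derivative Y') (at H)"
  shows "((\<lambda>H. P H ** Y H ** ctranspose (Q H)) has_derivative
    (\<lambda>E. (P' H E ** Y H + P H ** Y' E) ** ctranspose (Q H) + P H ** Y H ** ctranspose (Q' H E))) (at H)"
  by (rule has_derivative_eq_rhs[OF mat_mult.FDERIV[OF mat_mult.FDERIV[OF P_deriv assms] has_derivative_ctranspose_Q]])
    (simp add: fun_eq_iff add.commute)

lemma has_derivative_D: "((\<lambda>H. X + D H) has_derivative D) (at H)"
  by (rule has_derivative_eq_rhs[OF has_derivative_add[OF has_derivative_const
      bounded_linear.has_derivative[OF D_linear has_derivative_ident]]]) simp

lemma chart'_apply: "blinfun_apply (chart' H) E = (P' H E ** (X + D H) + P H ** D E) ** ctranspose (Q H)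
     + P H ** (X + D H) ** ctranspose (Q' H E)"
  using has_derivative_bounded_linear[OF has_derivative_two_sided[OF has_derivative_D]]
  unfolding chart'_def by (simp add: bounded_linear_Blinfun_apply)

lemma has_derivative_chart: "(chart has_derivative blinfun_apply (chart' H)) (at H)"
  using has_derivative_two_sided[OF has_derivative_D, of H]
  unfolding chart_def[abs_def] chart'_apply[abs_def] .

lemma chart'_0: "chart' 0 = id_blinfun"
  using decomp by (intro blinfun_eqI) (simp add: chart'_apply P_0 Q_0 D_0 add.commute)

lemma continuous_P: "continuous_on UNIV P" and continuous_Q: "continuous_on UNIV Q"
  by (intro continuous_at_imp_continuous_on ballI has_derivative_continuous[OF P_deriv]
      has_derivative_continuous[OF Q_deriv])+

lemma continuous_ctranspose_Q: "continuous_on UNIV (\<lambda>H. ctranspose (Q H))"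
  by (intro bounded_linear.continuous_on[OF bounded_linear_ctranspose] continuous_Q)

lemma continuous_chart': "continuous_on UNIV chart'"
proof (rule continuous_on_blinfun_componentwise)
  show "continuous_on UNIV (\<lambda>H. blinfun_apply (chart' H) E)" for E
    unfolding chart'_apply
    by (intro continuous_intros mat_mult.continuous_on continuous_P continuous_ctranspose_Q
        bounded_linear.continuous_on[OF bounded_linear_ctranspose] P'_cont Q'_cont
        bounded_linear.continuous_on[OF D_linear])
qed

lemma local_inverse:
  obtains S T inv_chart where "open S" "0 \<in> S" "open T" "X \<in> T" "homeomorphism S T chart inv_chart"
    "\<And>Y. Y \<in> T \<Longrightarrow> inv_chart differentiable (at Y)"
proof -
  have "id_blinfun o\<^sub>L chart' 0 = id_blinfun" by (intro blinfun_eqI) (simp add: chart'_0)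
  from inverse_function_theorem[OF open_UNIV has_derivative_chart continuous_chart' UNIV_I this]
  obtain S T g g' where "open S" "0 \<in> S" "open T" "chart 0 \<in> T" "homeomorphism S T chart g"
    "\<And>Y. Y \<in> T \<Longrightarrow> (g has_derivative g' Y) (at Y)" by metis
  thus thesis using that chart_0 unfolding differentiable_def by metis
qed

end

section \<open>Directional derivatives and B-subdifferentials under perturbation and change of
  chart\<close>

lemma B_subdifferential_eventuallyI:
  assumes "\<forall>\<^sub>F k in sequentially. (F has_derivative blinfun_apply (F' k)) (at (x k))"
    and "x \<longlonglongrightarrow> z" "F' \<longlonglongrightarrow> L"
  shows "L \<in> B_subdifferential F z"
proof -
  obtain n where "\<forall>k\<ge>n. (F has_derivative blinfun_apply (F' k)) (at (x k))"
    using assms(1) unfolding eventually_sequentially by blast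
  thus ?thesis unfolding B_subdifferential_def
    using LIMSEQ_ignore_initial_segment[OF assms(2), of n] LIMSEQ_ignore_initial_segment[OF assms(3), of n]
    by (intro CollectI exI[of _ "\<lambda>k. x (k + n)"] exI[of _ "\<lambda>k. F' (k + n)"]) auto
qed

text \<open>Turns a one-sided limit into a derivative along a ray, so that the chain and product
  rules apply to it.\<close>

lemma has_dir_deriv_iff_has_derivative:
  "has_dir_deriv F z h l \<longleftrightarrow> ((\<lambda>t. F (z + t *\<^sub>R h)) has_derivative (\<lambda>t. t *\<^sub>R l)) (at_right 0)"
proof -
  have "has_dir_deriv F z h l \<longleftrightarrow> ((\<lambda>t. norm ((F (z + t *\<^sub>R h) - F z) /\<^sub>R t - l)) \<longlongrightarrow> 0) (at_right 0)"
    unfolding has_dir_deriv_def by (simp only: tendsto_norm_zero_iff LIM_zero_iff)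
  also have "\<dots> \<longleftrightarrow> ((\<lambda>t. norm (F (z + t *\<^sub>R h) - F z - t *\<^sub>R l) / norm t) \<longlongrightarrow> 0) (at_right 0)"
  proof (rule filterlim_cong[OF refl refl])
    have "norm ((F (z + t *\<^sub>R h) - F z) /\<^sub>R t - l) = norm (F (z + t *\<^sub>R h) - F z - t *\<^sub>R l) / norm t"
      if "t \<noteq> 0" for t
    proof -
      have "(F (z + t *\<^sub>R h) - F z) /\<^sub>R t - l = (F (z + t *\<^sub>R h) - F z - t *\<^sub>R l) /\<^sub>R t"
        using that by (simp add: scaleR_diff_right)
      thus ?thesis using that by (simp add: divide_inverse mult.commute)
    qed
    thus "\<forall>\<^sub>F t in at_right 0. norm ((F (z + t *\<^sub>R h) - F z) /\<^sub>R t - l)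
        = norm (F (z + t *\<^sub>R h) - F z - t *\<^sub>R l) / norm t"
      by (auto simp: eventually_at_filter)
  qed
  also have "\<dots> \<longleftrightarrow> ((\<lambda>t. F (z + t *\<^sub>R h)) has_derivative (\<lambda>t. t *\<^sub>R l)) (at_right 0)"
    by (simp add: has_derivative_iff_norm bounded_linear_scaleR_left)
  finally show ?thesis .
qed

lemma has_derivative_imp_has_dir_deriv:
  assumes "(F has_derivative F') (at z)"
  shows "has_dir_deriv F z h (F' h)"
proof -
  have "((\<lambda>t. z + t *\<^sub>R h) has_derivative (\<lambda>t. t *\<^sub>R h)) (at_right 0)"
    by (auto intro!: derivative_eq_intros)
  from has_derivative_compose[OF this, of F F'] assms
  show ?thesis unfolding has_dir_deriv_iff_has_derivative
    using linear_scale[OF has_derivative_linear[OF assms]] by simp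
qed

lemma has_dir_deriv_unique: "has_dir_deriv F z h l \<Longrightarrow> has_dir_deriv F z h l' \<Longrightarrow> l = l'"
  unfolding has_dir_deriv_def by (rule tendsto_unique[OF trivial_limit_at_right_real])

lemma dir_deriv_eq: "has_dir_deriv F z h l \<Longrightarrow> dir_deriv F z h = l"
  unfolding dir_deriv_def using has_dir_deriv_unique by blast

lemma tendsto_line: "((\<lambda>t. z + t *\<^sub>R h) \<longlongrightarrow> z) (at_right 0)" for h :: "'v::real_normed_vector"
  by (auto intro!: tendsto_eq_intros)

lemma norm_has_dir_deriv_le:
  assumes F: "has_dir_deriv F z h l"
    and le: "\<forall>\<^sub>F y in nhds z. norm (F y - F z) \<le> C * norm (y - z)"
  shows "norm l \<le> C * norm h"
proof (rule tendsto_upperbound)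
  show "((\<lambda>t. norm ((F (z + t *\<^sub>R h) - F z) /\<^sub>R t)) \<longlongrightarrow> norm l) (at_right 0)"
    using F unfolding has_dir_deriv_def by (rule tendsto_norm)
  show "\<forall>\<^sub>F t in at_right 0. norm ((F (z + t *\<^sub>R h) - F z) /\<^sub>R t) \<le> C * norm h"
    using eventually_compose_filterlim[OF le tendsto_line[of z h]] eventually_at_right_less[of "0::real"]
  proof eventually_elim
    case (elim t)
    have "norm ((F (z + t *\<^sub>R h) - F z) /\<^sub>R t) = norm (F (z + t *\<^sub>R h) - F z) / t"
      using elim(2) by (simp add: divide_inverse mult.commute)
    also have "\<dots> \<le> C * norm h" using elim by (simp add: field_simps)
    finally show ?case .
  qed
qed simp

lemma norm_derivative_le:
  assumes "(F has_derivative F') (at z)"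
    and "\<forall>\<^sub>F y in nhds z. norm (F y - F z) \<le> C * norm (y - z)"
  shows "norm (F' h) \<le> C * norm h"
  using norm_has_dir_deriv_le[OF has_derivative_imp_has_dir_deriv[OF assms(1)] assms(2)] .

text \<open>At points near \<open>z\<close> the derivative of \<open>F - F2\<close> is bounded by
  the local Lipschitz constant, which tends to 0. The same sequence of points therefore yields the
  same limit for \<open>F2\<close>.\<close>

lemma B_subdifferential_subset_small_perturbation:
  assumes diff: "\<forall>\<^sub>F x in nhds z. F differentiable (at x) \<longrightarrow> F2 differentiable (at x)"
    and small: "\<And>e. 0 < e \<Longrightarrow> \<exists>d>0. \<forall>x\<in>ball z d. \<forall>y\<in>ball z d. norm ((F x - F2 x) - (F y - F2 y)) \<le> e * norm (x - y)"
  shows "B_subdifferential F z \<subseteq> B_subdifferential F2 z"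
proof
  fix L assume "L \<in> B_subdifferential F z"
  then obtain x F' where x: "\<And>k. (F has_derivative blinfun_apply (F' k)) (at (x k))"
    "x \<longlonglongrightarrow> z" "F' \<longlonglongrightarrow> L" unfolding B_subdifferential_def by blast
  have "\<forall>\<^sub>F k in sequentially. F2 differentiable (at (x k))"
    using eventually_compose_filterlim[OF diff x(2)]
    by (rule eventually_mono) (use x(1) differentiable_def in blast)
  define F2' where "F2' k = Blinfun (frechet_derivative F2 (at (x k)))" for k
  have F2': "(F2 has_derivative blinfun_apply (F2' k)) (at (x k))" if "F2 differentiable (at (x k))" for k
    using that unfolding F2'_def
    by (metis bounded_linear_Blinfun_apply frechet_derivative_works has_derivative_bounded_linear)
  have ev: "\<forall>\<^sub>F k in sequentially. (F2 has_derivative blinfun_apply (F2' k)) (at (x k))"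
    using \<open>\<forall>\<^sub>F k in sequentially. F2 differentiable (at (x k))\<close> F2' by (auto elim: eventually_mono)
  have "(\<lambda>k. F' k - F2' k) \<longlonglongrightarrow> 0"
  proof (rule tendstoI)
    fix e :: real assume "0 < e"
    then obtain d where d: "0 < d"
      "\<And>x y. x \<in> ball z d \<Longrightarrow> y \<in> ball z d \<Longrightarrow> norm ((F x - F2 x) - (F y - F2 y)) \<le> e / 2 * norm (x - y)"
      using small[of "e / 2"] by auto
    have "\<forall>\<^sub>F k in sequentially. x k \<in> ball z d"
      using x(2) d(1) by (auto simp: tendsto_iff dist_commute)
    with ev show "\<forall>\<^sub>F k in sequentially. dist (F' k - F2' k) 0 < e"
    proof eventually_elim
      case (elim k)
      have "((\<lambda>y. F y - F2 y) has_derivative blinfun_apply (F' k - F2' k)) (at (x k))"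
        by (rule has_derivative_eq_rhs[OF has_derivative_diff[OF x(1) elim(1)]])
          (simp add: fun_eq_iff blinfun.diff_left)
      moreover have "\<forall>\<^sub>F y in nhds (x k). norm ((F y - F2 y) - (F (x k) - F2 (x k))) \<le> e / 2 * norm (y - x k)"
        using elim(2) by (intro eventually_mono[OF eventually_nhds_in_open[OF open_ball elim(2)]] d(2))
      ultimately have "norm (blinfun_apply (F' k - F2' k) h) \<le> e / 2 * norm h" for h
        by (rule norm_derivative_le)
      hence "norm (F' k - F2' k) \<le> e / 2" using \<open>0 < e\<close> by (intro norm_blinfun_bound) auto
      thus ?case using \<open>0 < e\<close> by simp
    qed
  qed
  from tendsto_diff[OF x(3) this] have "F2' \<longlonglongrightarrow> L" by simp
  thus "L \<in> B_subdifferential F2 z" using ev x(2) by (intro B_subdifferential_eventuallyI)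
qed

text \<open>Derivatives of \<open>G\<close> and of \<open>G \<circ> chart\<close> at corresponding
  points differ by the factor \<open>chart'\<close>, which tends to the identity at 0.\<close>

lemma (in normal_chart) B_subdifferential_chart:
  "B_subdifferential (G \<circ> chart) 0 = B_subdifferential G X"
proof
  obtain S T g where ST: "open S" "0 \<in> S" "open T" "X \<in> T" and hom: "homeomorphism S T chart g"
    and g: "\<And>Y. Y \<in> T \<Longrightarrow> g differentiable (at Y)" by (rule local_inverse) blast
  have g_X: "g X = 0" using hom ST chart_0 by (metis homeomorphism_apply1)
  have chart'_lim: "(\<lambda>k. chart' (x k)) \<longlonglongrightarrow> id_blinfun" if "x \<longlonglongrightarrow> 0" for x
    using continuous_on_tendsto_compose[OF continuous_chart' that] chart'_0 by simp
  show "B_subdifferential G X \<subseteq> B_subdifferential (G \<circ> chart) 0"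
  proof
    fix L assume "L \<in> B_subdifferential G X"
    then obtain x G' where x: "\<And>k. (G has_derivative blinfun_apply (G' k)) (at (x k))"
      "x \<longlonglongrightarrow> X" "G' \<longlonglongrightarrow> L" unfolding B_subdifferential_def by blast
    have "continuous_on T g" using hom by (simp add: homeomorphism_def)
    hence lim: "(\<lambda>k. g (x k)) \<longlonglongrightarrow> 0"
      using x(2) ST g_X by (metis continuous_on_eq_continuous_at isCont_tendsto_compose)
    have "\<forall>\<^sub>F k in sequentially. x k \<in> T" using x(2) ST topological_tendstoD by blast
    hence "\<forall>\<^sub>F k in sequentially. (G \<circ> chart has_derivative blinfun_apply (G' k o\<^sub>L chart' (g (x k)))) (at (g (x k)))"
    proof eventually_elim
      case (elim k)
      hence "chart (g (x k)) = x k" using hom by (metis homeomorphism_apply2)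
      thus ?case using diff_chain_at[OF has_derivative_chart[of "g (x k)"], of G "blinfun_apply (G' k)"] x(1)[of k]
        by (simp add: blinfun_compose.rep_eq)
    qed
    moreover have "(\<lambda>k. G' k o\<^sub>L chart' (g (x k))) \<longlonglongrightarrow> (L o\<^sub>L id_blinfun)"
      by (rule bounded_bilinear.tendsto[OF bounded_bilinear_blinfun_compose x(3) chart'_lim[OF lim]])
    moreover have "L o\<^sub>L id_blinfun = L" by (intro blinfun_eqI) simp
    ultimately show "L \<in> B_subdifferential (G \<circ> chart) 0"
      using B_subdifferential_eventuallyI[OF _ lim] by simp
  qed
  show "B_subdifferential (G \<circ> chart) 0 \<subseteq> B_subdifferential G X"
  proof
    fix L assume "L \<in> B_subdifferential (G \<circ> chart) 0"
    then obtain x N where x: "\<And>k. (G \<circ> chart has_derivative blinfun_apply (N k)) (at (x k))"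
      "x \<longlonglongrightarrow> 0" "N \<longlonglongrightarrow> L" unfolding B_subdifferential_def by blast
    have lim: "(\<lambda>k. chart (x k)) \<longlonglongrightarrow> X"
      using x(2) chart_0 has_derivative_continuous[OF has_derivative_chart]
      by (metis isCont_tendsto_compose)
    define M where "M k = Blinfun (frechet_derivative G (at (chart (x k))))" for k
    have "\<forall>\<^sub>F k in sequentially. x k \<in> S" using x(2) ST topological_tendstoD by blast
    hence M: "\<forall>\<^sub>F k in sequentially. (G has_derivative blinfun_apply (M k)) (at (chart (x k)))"
    proof eventually_elim
      case (elim k)
      have cT: "chart (x k) \<in> T" and gc: "g (chart (x k)) = x k"
        using elim hom by (auto simp: homeomorphism_def)
      have "(G \<circ> chart) \<circ> g differentiable (at (chart (x k)))"
        using x(1)[of k] g[OF cT] gc unfolding differentiable_def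
        by (metis diff_chain_at)
      moreover have "((G \<circ> chart) \<circ> g) Y = G Y" if "Y \<in> T" for Y
        using that hom by (simp add: homeomorphism_def)
      ultimately have "G differentiable (at (chart (x k)))"
        using cT \<open>open T\<close> unfolding differentiable_def
        by (metis (no_types, lifting) has_derivative_transform_within_open)
      thus ?case unfolding M_def
        by (metis bounded_linear_Blinfun_apply frechet_derivative_works has_derivative_bounded_linear)
    qed
    hence MN: "\<forall>\<^sub>F k in sequentially. M k o\<^sub>L chart' (x k) = N k"
    proof eventually_elim
      case (elim k)
      from diff_chain_at[OF has_derivative_chart elim] x(1)[of k]
      have "blinfun_apply (M k) \<circ> blinfun_apply (chart' (x k)) = blinfun_apply (N k)"
        using has_derivative_unique by blast
      thus ?case by (intro blinfun_eqI) (simp add: fun_eq_iff)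
    qed
    have c0: "(\<lambda>k. norm (chart' (x k) - id_blinfun)) \<longlonglongrightarrow> 0"
      using chart'_lim[OF x(2)] by (simp add: tendsto_norm_zero LIM_zero)
    hence "\<forall>\<^sub>F k in sequentially. norm (chart' (x k) - id_blinfun) < 1/2"
      by (rule order_tendstoD) simp
    \<comment> \<open>Convergence of \<open>M\<close> is not yet known. While \<open>chart'\<close>
      is within 1/2 of the identity, \<open>norm (M k)\<close> is at most
      \<open>2 * norm (N k)\<close>, which bounds the difference by convergent quantities.\<close>
    with MN have "\<forall>\<^sub>F k in sequentially. norm (M k - N k) \<le> (2 * norm (N k)) * norm (chart' (x k) - id_blinfun)"
    proof eventually_elim
      case (elim k)
      have "M k - N k = - (M k o\<^sub>L (chart' (x k) - id_blinfun))"
        by (rule blinfun_eqI) (simp add: elim(1)[symmetric] blinfun.diff_left blinfun.diff_right blinfun.minus_left)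
      hence le: "norm (M k - N k) \<le> norm (M k) * norm (chart' (x k) - id_blinfun)"
        by (simp add: norm_blinfun_compose)
      also have "\<dots> \<le> norm (M k) * (1/2)" using elim(2) by (intro mult_left_mono) auto
      finally have "norm (M k) \<le> 2 * norm (N k)"
        using norm_triangle_sub[of "M k" "N k"] by linarith
      thus ?case using le by (meson mult_right_mono norm_ge_zero order_trans)
    qed
    moreover have "(\<lambda>k. (2 * norm (N k)) * norm (chart' (x k) - id_blinfun)) \<longlonglongrightarrow> (2 * norm L) * 0"
      by (intro tendsto_intros x(3) c0)
    ultimately have "(\<lambda>k. M k - N k) \<longlonglongrightarrow> 0" by (simp add: Lim_null_comparison)
    from tendsto_add[OF this x(3)] have "M \<longlonglongrightarrow> L" by simp
    thus "L \<in> B_subdifferential G X" using M lim by (intro B_subdifferential_eventuallyI)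
  qed
qed

text \<open>On a finite-dimensional domain pointwise convergence of linear maps is convergence in
  operator norm.\<close>

lemma B_subdifferentialI_pointwise:
  fixes F :: "'x::euclidean_space \<Rightarrow> 'y::real_normed_vector"
  assumes F': "\<And>k. (F has_derivative F' k) (at (x k))" and x: "x \<longlonglongrightarrow> z"
    and lim: "\<And>h. (\<lambda>k. F' k h) \<longlonglongrightarrow> blinfun_apply L h"
  shows "L \<in> B_subdifferential F z"
proof -
  have app: "blinfun_apply (Blinfun (F' k)) = F' k" for k
    by (rule bounded_linear_Blinfun_apply[OF has_derivative_bounded_linear[OF F']])
  have "(\<lambda>k. Blinfun (F' k)) \<longlonglongrightarrow> L" using lim by (intro tendsto_componentwise1) (simp add: app)
  with F' x show ?thesis by (intro B_subdifferential_eventuallyI[of _ "\<lambda>k. Blinfun (F' k)" x]) (simp_all add: app)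
qed

lemma differentiable_cong_nhds:
  assumes "\<forall>\<^sub>F y in nhds x. F y = F2 y"
  shows "F differentiable (at x) \<longleftrightarrow> F2 differentiable (at x)"
proof -
  obtain S where "open S" "x \<in> S" "\<And>y. y \<in> S \<Longrightarrow> F y = F2 y"
    using assms unfolding eventually_nhds by blast
  thus ?thesis unfolding differentiable_def
    by (metis has_derivative_transform_within_open)
qed

lemma B_subdifferential_cong:
  assumes "\<forall>\<^sub>F y in nhds z. F y = F2 y"
  shows "B_subdifferential F z = B_subdifferential F2 z"
proof -
  have sub: "B_subdifferential F z \<subseteq> B_subdifferential F2 z"
    if ev: "\<forall>\<^sub>F y in nhds z. F y = F2 y" for F F2 :: "'a \<Rightarrow> 'b"
  proof (rule B_subdifferential_subset_small_perturbation)
    have "\<forall>\<^sub>F x in nhds z. \<forall>\<^sub>F y in nhds x. F y = F2 y" using ev by (simp add: eventually_eventually)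
    thus "\<forall>\<^sub>F x in nhds z. F differentiable (at x) \<longrightarrow> F2 differentiable (at x)"
      by eventually_elim (simp add: differentiable_cong_nhds)
    obtain d where "0 < d" "\<And>y. dist y z < d \<Longrightarrow> F y = F2 y"
      using ev unfolding eventually_nhds_metric by blast
    thus "\<exists>d>0. \<forall>x\<in>ball z d. \<forall>y\<in>ball z d. norm ((F x - F2 x) - (F y - F2 y)) \<le> e * norm (x - y)"
      if "0 < e" for e using that by (intro exI[of _ d]) (simp add: dist_commute)
  qed
  show ?thesis using sub[OF assms] sub[of F2 F] assms by (auto simp: eq_commute)
qed

context normal_chart
begin

lemma differentiable_chartD:
  assumes "G \<circ> chart differentiable (at 0)"
  shows "G differentiable (at X)"
proof -
  obtain S T g where ST: "open S" "0 \<in> S" "open T" "X \<in> T" and hom: "homeomorphism S T chart g"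
    and g: "\<And>Y. Y \<in> T \<Longrightarrow> g differentiable (at Y)" by (rule local_inverse) blast
  have "g X = 0" using hom ST chart_0 by (metis homeomorphism_apply1)
  hence "(G \<circ> chart) \<circ> g differentiable (at X)"
    using assms g[OF ST(4)] by (simp add: differentiable_chain_at)
  moreover have "((G \<circ> chart) \<circ> g) Y = G Y" if "Y \<in> T" for Y
    using that hom by (simp add: homeomorphism_def)
  ultimately show ?thesis
    using ST differentiable_cong_nhds[of "(G \<circ> chart) \<circ> g" G X] by (auto simp: eventually_nhds)
qed

lemma tendsto_chart_data:
  assumes "x \<longlonglongrightarrow> 0"
  shows "(\<lambda>k. P (x k)) \<longlonglongrightarrow> mat 1" "(\<lambda>k. ctranspose (P (x k))) \<longlonglongrightarrow> mat 1"
    "(\<lambda>k. Q (x k)) \<longlonglongrightarrow> mat 1" "(\<lambda>k. ctranspose (Q (x k))) \<longlonglongrightarrow> mat 1"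
    "(\<lambda>k. P' (x k) E) \<longlonglongrightarrow> P' 0 E" "(\<lambda>k. Q' (x k) E) \<longlonglongrightarrow> Q' 0 E"
    "(\<lambda>k. ctranspose (P' (x k) E)) \<longlonglongrightarrow> ctranspose (P' 0 E)"
    "(\<lambda>k. ctranspose (Q' (x k) E)) \<longlonglongrightarrow> ctranspose (Q' 0 E)"
proof -
  show P: "(\<lambda>k. P (x k)) \<longlonglongrightarrow> mat 1" and Q: "(\<lambda>k. Q (x k)) \<longlonglongrightarrow> mat 1"
    using continuous_on_tendsto_compose[OF continuous_P assms] continuous_on_tendsto_compose[OF continuous_Q assms]
    by (simp_all add: P_0 Q_0)
  show P': "(\<lambda>k. P' (x k) E) \<longlonglongrightarrow> P' 0 E" and Q': "(\<lambda>k. Q' (x k) E) \<longlonglongrightarrow> Q' 0 E"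
    using continuous_on_tendsto_compose[OF P'_cont assms] continuous_on_tendsto_compose[OF Q'_cont assms] by simp_all
  note ct = bounded_linear.tendsto[OF bounded_linear_ctranspose]
  show "(\<lambda>k. ctranspose (P (x k))) \<longlonglongrightarrow> mat 1" "(\<lambda>k. ctranspose (Q (x k))) \<longlonglongrightarrow> mat 1"
    "(\<lambda>k. ctranspose (P' (x k) E)) \<longlonglongrightarrow> ctranspose (P' 0 E)"
    "(\<lambda>k. ctranspose (Q' (x k) E)) \<longlonglongrightarrow> ctranspose (Q' 0 E)"
    using ct[OF P] ct[OF Q] ct[OF P'] ct[OF Q'] by simp_all
qed

lemma bounded_linear_orbit_part: "bounded_linear (\<lambda>H. P' 0 H ** M + M ** ctranspose (Q' 0 H))"
  by (intro bounded_linear_add bounded_linear_compose[OF mat_mult.bounded_linear_left]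
      bounded_linear_compose[OF mat_mult.bounded_linear_right] bounded_linear_compose[OF bounded_linear_ctranspose]
      has_derivative_bounded_linear[OF P_deriv] has_derivative_bounded_linear[OF Q_deriv])

text \<open>
  Since \<open>P\<close> and \<open>Q\<close> are continuously differentiable and equal to the identity at \<open>0\<close>, the two
  functions have the same points of differentiability, and their derivatives differ by a quantity
  vanishing at \<open>0\<close>.
\<close>

lemma B_subdifferential_two_sided:
  assumes Y: "(Y \<longlongrightarrow> 0) (nhds 0)"
  shows "B_subdifferential (\<lambda>H. P H ** (M + Y H) ** ctranspose (Q H)) 0 =
    B_subdifferential (\<lambda>H. P' 0 H ** M + M ** ctranspose (Q' 0 H) + Y H) 0"
    (is "B_subdifferential ?F 0 = B_subdifferential ?G 0")
proof
  have lin: "((\<lambda>H. P' 0 H ** M + M ** ctranspose (Q' 0 H)) has_derivative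
      (\<lambda>E. P' 0 E ** M + M ** ctranspose (Q' 0 E))) (at H)" for H
    using bounded_linear_orbit_part by (rule bounded_linear_imp_has_derivative)
  show "B_subdifferential ?F 0 \<subseteq> B_subdifferential ?G 0"
  proof
    fix L assume "L \<in> B_subdifferential ?F 0"
    then obtain x F' where x: "\<And>k. (?F has_derivative blinfun_apply (F' k)) (at (x k))"
      "x \<longlonglongrightarrow> 0" "F' \<longlonglongrightarrow> L" unfolding B_subdifferential_def by blast
    have Ylim: "(\<lambda>k. Y (x k)) \<longlonglongrightarrow> 0" using filterlim_compose[OF Y x(2)] .
    have Flim: "(\<lambda>k. ?F (x k)) \<longlonglongrightarrow> M"
      using mat_mult.tendsto[OF mat_mult.tendsto[OF tendsto_chart_data(1)[OF x(2)] tendsto_add[OF tendsto_const[of M] Ylim]]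
        tendsto_chart_data(4)[OF x(2)]] by simp
    have F'lim: "(\<lambda>k. blinfun_apply (F' k) E) \<longlonglongrightarrow> blinfun_apply L E" for E
      by (intro blinfun.tendsto x(3) tendsto_const)
    \<comment> \<open>Unitarity of \<open>P H\<close> and \<open>Q H\<close> solves for
      \<open>Y\<close>, so differentiability of \<open>?F\<close> at a point gives that of
      \<open>Y\<close>.\<close>
    have Y_eq: "Y = (\<lambda>H. ctranspose (P H) ** ?F H ** Q H - M)"
      using unitary_P unitary_Q by (simp add: fun_eq_iff matrix_mul_assoc unitary_matrixD)
    define Y' where "Y' k E = ctranspose (P (x k)) ** ?F (x k) ** Q' (x k) E
      + (ctranspose (P (x k)) ** blinfun_apply (F' k) E + ctranspose (P' (x k) E) ** ?F (x k)) ** Q (x k)" for k E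
    have Y': "(Y has_derivative Y' k) (at (x k))" for k
      by (subst Y_eq, rule has_derivative_eq_rhs[OF has_derivative_diff[OF mat_mult.FDERIV[OF mat_mult.FDERIV[OF
          bounded_linear.has_derivative[OF bounded_linear_ctranspose P_deriv] x(1)] Q_deriv] has_derivative_const]])
        (simp add: Y'_def fun_eq_iff)
    show "L \<in> B_subdifferential ?G 0"
    proof (rule B_subdifferentialI_pointwise[OF has_derivative_add[OF lin Y'] x(2)])
      fix E
      have "(\<lambda>k. Y' k E) \<longlonglongrightarrow> mat 1 ** M ** Q' 0 E + (mat 1 ** blinfun_apply L E + ctranspose (P' 0 E) ** M) ** mat 1"
        unfolding Y'_def by (intro tendsto_add mat_mult.tendsto tendsto_chart_data[OF x(2)] Flim F'lim)
      hence "(\<lambda>k. P' 0 E ** M + M ** ctranspose (Q' 0 E) + Y' k E) \<longlonglongrightarrow> P' 0 E ** M + M ** ctranspose (Q' 0 E)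
        + (mat 1 ** M ** Q' 0 E + (mat 1 ** blinfun_apply L E + ctranspose (P' 0 E) ** M) ** mat 1)"
        by (intro tendsto_add tendsto_const)
      \<comment> \<open>The orbit terms cancel because \<open>P' 0 E\<close> and
        \<open>Q' 0 E\<close> are skew-Hermitian.\<close>
      thus "(\<lambda>k. P' 0 E ** M + M ** ctranspose (Q' 0 E) + Y' k E) \<longlonglongrightarrow> blinfun_apply L E"
        using P'_skew[of E] Q'_skew[of E] by (simp add: skew_hermitian_def mat_mult.minus_left mat_mult.minus_right)
    qed
  qed
  show "B_subdifferential ?G 0 \<subseteq> B_subdifferential ?F 0"
  proof
    fix L assume "L \<in> B_subdifferential ?G 0"
    then obtain x G' where x: "\<And>k. (?G has_derivative blinfun_apply (G' k)) (at (x k))"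
      "x \<longlonglongrightarrow> 0" "G' \<longlonglongrightarrow> L" unfolding B_subdifferential_def by blast
    have Ylim: "(\<lambda>k. M + Y (x k)) \<longlonglongrightarrow> M"
      using tendsto_add[OF tendsto_const[of M] filterlim_compose[OF Y x(2)]] by simp
    have G'lim: "(\<lambda>k. blinfun_apply (G' k) E) \<longlonglongrightarrow> blinfun_apply L E" for E
      by (intro blinfun.tendsto x(3) tendsto_const)
    define Y' where "Y' k E = blinfun_apply (G' k) E - (P' 0 E ** M + M ** ctranspose (Q' 0 E))" for k E
    have Y': "((\<lambda>H. M + Y H) has_derivative Y' k) (at (x k))" for k
    proof -
      have "((\<lambda>H. M + (?G H - (P' 0 H ** M + M ** ctranspose (Q' 0 H)))) has_derivative (\<lambda>E. 0 + Y' k E)) (at (x k))"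
        unfolding Y'_def by (intro has_derivative_add has_derivative_const has_derivative_diff x(1) lin)
      thus ?thesis by simp
    qed
    show "L \<in> B_subdifferential ?F 0"
    proof (rule B_subdifferentialI_pointwise[OF has_derivative_two_sided[OF Y'] x(2)])
      fix E
      have "(\<lambda>k. (P' (x k) E ** (M + Y (x k)) + P (x k) ** Y' k E) ** ctranspose (Q (x k))
          + P (x k) ** (M + Y (x k)) ** ctranspose (Q' (x k) E))
        \<longlonglongrightarrow> (P' 0 E ** M + mat 1 ** (blinfun_apply L E - (P' 0 E ** M + M ** ctranspose (Q' 0 E)))) ** mat 1
          + mat 1 ** M ** ctranspose (Q' 0 E)"
        unfolding Y'_def
        by (intro tendsto_add tendsto_diff mat_mult.tendsto tendsto_chart_data[OF x(2)] Ylim G'lim tendsto_const)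
      thus "(\<lambda>k. (P' (x k) E ** (M + Y (x k)) + P (x k) ** Y' k E) ** ctranspose (Q (x k))
          + P (x k) ** (M + Y (x k)) ** ctranspose (Q' (x k) E)) \<longlonglongrightarrow> blinfun_apply L E"
        by simp
    qed
  qed
qed

lemma has_dir_deriv_two_sided:
  assumes "has_dir_deriv Y 0 H l"
  shows "has_dir_deriv (\<lambda>H. P H ** Y H ** ctranspose (Q H)) 0 H (P' 0 H ** Y 0 + Y 0 ** ctranspose (Q' 0 H) + l)"
proof -
  have "((\<lambda>t. P (0 + t *\<^sub>R H)) has_derivative (\<lambda>t. t *\<^sub>R P' 0 H)) (at_right 0)"
    "((\<lambda>t. ctranspose (Q (0 + t *\<^sub>R H))) has_derivative (\<lambda>t. t *\<^sub>R ctranspose (Q' 0 H))) (at_right 0)"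
    "((\<lambda>t. Y (0 + t *\<^sub>R H)) has_derivative (\<lambda>t. t *\<^sub>R l)) (at_right 0)"
    using has_derivative_imp_has_dir_deriv[OF P_deriv, of 0 H]
      has_derivative_imp_has_dir_deriv[OF has_derivative_ctranspose_Q, of 0 H] assms
    by (simp_all only: has_dir_deriv_iff_has_derivative)
  from mat_mult.FDERIV[OF mat_mult.FDERIV[OF this(1,3)] this(2)] show ?thesis
    unfolding has_dir_deriv_iff_has_derivative
    by (rule has_derivative_eq_rhs)
      (simp add: fun_eq_iff P_0 Q_0 mat_mult.scaleR_left mat_mult.scaleR_right scaleR_add_right add_ac)
qed

text \<open>The curve \<open>chart (t *\<^sub>R H)\<close> deviates from the line
  \<open>X + t *\<^sub>R H\<close> by \<open>o(t)\<close>, and Lipschitz continuity of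
  \<open>G\<close> carries this over to the difference quotients.\<close>

lemma has_dir_deriv_chartD:
  assumes G: "has_dir_deriv (G \<circ> chart) 0 H l"
    and d: "0 < d" and lip: "\<And>Y Z. Y \<in> ball X d \<Longrightarrow> Z \<in> ball X d \<Longrightarrow> norm (G Y - G Z) \<le> C * norm (Y - Z)"
  shows "has_dir_deriv G X H l"
proof -
  have lim: "((\<lambda>t. chart (0 + t *\<^sub>R H)) \<longlongrightarrow> X) (at_right 0)"
    using isCont_tendsto_compose[OF has_derivative_continuous[OF has_derivative_chart] tendsto_line[of 0 H]]
    by (simp add: chart_0)
  have "((\<lambda>t. (chart (0 + t *\<^sub>R H) - chart 0) /\<^sub>R t) \<longlongrightarrow> H) (at_right 0)"
    using has_derivative_imp_has_dir_deriv[OF has_derivative_chart, of 0 H]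
    unfolding has_dir_deriv_def chart'_0 by simp
  from tendsto_norm_zero[OF LIM_zero[OF this]]
  have lim0: "((\<lambda>t. C * norm ((chart (0 + t *\<^sub>R H) - chart 0) /\<^sub>R t - H)) \<longlongrightarrow> 0) (at_right 0)"
    by (auto intro: tendsto_mult_right_zero)
  have near: "\<forall>\<^sub>F t in at_right 0. chart (0 + t *\<^sub>R H) \<in> ball X d"
      "\<forall>\<^sub>F t in at_right 0. X + t *\<^sub>R H \<in> ball X d"
    using d by (intro topological_tendstoD[OF lim] topological_tendstoD[OF tendsto_line] open_ball; simp)+
  have "\<forall>\<^sub>F t in at_right 0. norm ((G (X + t *\<^sub>R H) - G (chart (0 + t *\<^sub>R H))) /\<^sub>R t)
      \<le> C * norm ((chart (0 + t *\<^sub>R H) - chart 0) /\<^sub>R t - H)"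
    using near eventually_at_right_less[of "0::real"]
  proof eventually_elim
    case (elim t)
    have "norm ((G (X + t *\<^sub>R H) - G (chart (0 + t *\<^sub>R H))) /\<^sub>R t)
        \<le> inverse t * (C * norm ((X + t *\<^sub>R H) - chart (0 + t *\<^sub>R H)))"
      using elim d lip[of "X + t *\<^sub>R H" "chart (0 + t *\<^sub>R H)"] by simp
    also have "\<dots> = C * norm (((X + t *\<^sub>R H) - chart (0 + t *\<^sub>R H)) /\<^sub>R t)"
      using elim by simp
    also have "((X + t *\<^sub>R H) - chart (0 + t *\<^sub>R H)) /\<^sub>R t = - ((chart (0 + t *\<^sub>R H) - chart 0) /\<^sub>R t - H)"
      using elim by (simp add: chart_0 scaleR_diff_right scaleR_add_right)
    finally show ?case by (simp only: norm_minus_cancel)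
  qed
  from Lim_null_comparison[OF this lim0]
  have "((\<lambda>t. (G (X + t *\<^sub>R H) - G (chart (0 + t *\<^sub>R H))) /\<^sub>R t) \<longlongrightarrow> 0) (at_right 0)" .
  moreover have "((\<lambda>t. (G (chart (0 + t *\<^sub>R H)) - G X) /\<^sub>R t) \<longlongrightarrow> l) (at_right 0)"
    using G by (simp add: has_dir_deriv_def chart_0)
  ultimately have "((\<lambda>t. (G (X + t *\<^sub>R H) - G (chart (0 + t *\<^sub>R H))) /\<^sub>R t + (G (chart (0 + t *\<^sub>R H)) - G X) /\<^sub>R t)
      \<longlongrightarrow> 0 + l) (at_right 0)" by (rule tendsto_add)
  thus ?thesis by (simp add: has_dir_deriv_def scaleR_diff_right)
qed

end

section \<open>Lifting symmetric maps to matrices\<close>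

text \<open>Equivariance is asked only when both points lie in \<open>S\<close>: the balls used
  below need not be invariant under signed permutations.\<close>

definition symmetric_on :: "(real^'m) set \<Rightarrow> (real^'m \<Rightarrow> real^'m) \<Rightarrow> bool" where
  "symmetric_on S f \<longleftrightarrow>
     (\<forall>x\<in>S. \<forall>Q. signed_permutation_matrix Q \<longrightarrow> Q *v x \<in> S \<longrightarrow> f (Q *v x) = Q *v f x)"

text \<open>
  \<open>svd_lift S f X\<close> is junk unless \<open>X\<close> has a decomposition \<open>U [x] V\<^sup>*\<close> with \<open>x \<in> S\<close>; here \<open>x\<close> is
  neither required to be nonnegative nor to be ordered.
\<close>

definition svd_lift :: "(real^'m::{finite,linorder}) set \<Rightarrow> (real^'m::{finite,linorder} \<Rightarrow> real^'m::{finite,linorder}) \<Rightarrow>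
    'a::real_or_complex^'n::{finite,linorder}^'m::{finite,linorder} \<Rightarrow> 'a^'n::{finite,linorder}^'m::{finite,linorder}" where
  "svd_lift S f X = (SOME Y. \<exists>U V x. unitary_matrix U \<and> unitary_matrix V \<and> x \<in> S \<and>
     X = svd_form U x V \<and> Y = svd_form U (f x) V)"

lemma svd_lift_eq:
  fixes U :: "'a::real_or_complex^'m::{finite,linorder}^'m::{finite,linorder}"
    and V :: "'a^'n::{finite,linorder}^'n::{finite,linorder}"
  assumes card: "CARD('m) \<le> CARD('n)" and f: "symmetric_on S f"
    and UV: "unitary_matrix U" "unitary_matrix V" and x: "x \<in> S"
  shows "svd_lift S f (svd_form U x V) = svd_form U (f x) V"
  unfolding svd_lift_def
proof (rule some_equality)
  show "\<exists>U' V' y. unitary_matrix U' \<and> unitary_matrix V' \<and> y \<in> S \<and>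
      svd_form U x V = svd_form U' y V' \<and> svd_form U (f x) V = svd_form U' (f y) V'"
    using UV x by blast
next
  fix Y assume "\<exists>U' V' y. unitary_matrix U' \<and> unitary_matrix V' \<and> y \<in> S \<and>
      svd_form U x V = svd_form U' y V' \<and> Y = svd_form U' (f y) V'"
  then obtain U' V' y where Y: "unitary_matrix U'" "unitary_matrix V'" "y \<in> S"
    "svd_form U x V = svd_form U' y V'" "Y = svd_form U' (f y) V'" by blast
  have "svd_form U (f x) V = svd_form U' (f y) V'"
  proof (rule svd_form_eqI[OF card UV Y(1,2,4)])
    fix Q assume "signed_permutation_matrix Q" "x = Q *v y"
    thus "f x = Q *v f y" using f Y(3) x by (simp add: symmetric_on_def)
  qed
  with Y(5) show "Y = svd_form U (f x) V" by simp
qed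

lemma bounded_linear_svd_form: "bounded_linear (\<lambda>x. svd_form U x V)"
  using linear_svd_form by (simp add: linear_conv_bounded_linear)

lemmas svd_form_add = linear_add[OF linear_svd_form]
  and svd_form_diff = linear_diff[OF linear_svd_form]
  and svd_form_scaleR = linear_scale[OF linear_svd_form]

text \<open>On the slice of matrices with the fixed frame \<open>U\<close>, \<open>V\<close> the
  lift acts as \<open>f\<close>; a linear left inverse of the slice map recovers
  \<open>f\<close>.\<close>

lemma differentiable_of_svd_lift:
  fixes U :: "'a::real_or_complex^'m::{finite,linorder}^'m::{finite,linorder}"
    and V :: "'a^'n::{finite,linorder}^'n::{finite,linorder}"
  assumes card: "CARD('m) \<le> CARD('n)" and f: "symmetric_on S f"
    and UV: "unitary_matrix U" "unitary_matrix V" and S: "open S" "x \<in> S"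
    and diff: "svd_lift S f differentiable (at (svd_form U x V))"
  shows "f differentiable (at x)"
proof -
  have "inj (\<lambda>x. svd_form U x V)"
    unfolding linear_injective_0[OF linear_svd_form] using norm_svd_form[OF card UV] by (metis norm_eq_zero)
  then obtain r where r: "linear r" "r \<circ> (\<lambda>x. svd_form U x V) = id"
    using linear_injective_left_inverse[OF linear_svd_form] by blast
  have "(r \<circ> (svd_lift S f \<circ> (\<lambda>x. svd_form U x V))) differentiable (at x)"
    using diff linear_imp_differentiable[OF r(1)] linear_imp_differentiable[OF linear_svd_form]
    by (intro differentiable_chain_at) simp_all
  moreover have "(r \<circ> (svd_lift S f \<circ> (\<lambda>x. svd_form U x V))) y = f y" if "y \<in> S" for y
    using svd_lift_eq[OF card f UV that] r(2) by (simp add: fun_eq_iff)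
  ultimately show ?thesis
    using S differentiable_cong_nhds[of "r \<circ> (svd_lift S f \<circ> (\<lambda>x. svd_form U x V))" f x]
    by (auto simp: eventually_nhds)
qed

lemma svd_lift_two_sided:
  fixes P :: "'a::real_or_complex^'m::{finite,linorder}^'m::{finite,linorder}"
    and Q :: "'a^'n::{finite,linorder}^'n::{finite,linorder}"
  assumes card: "CARD('m) \<le> CARD('n)" and f: "symmetric_on S f"
    and un: "unitary_matrix P" "unitary_matrix Q" "unitary_matrix U" "unitary_matrix V"
    and x: "x \<in> S" and Y: "Y = svd_form U x V"
  shows "svd_lift S f (P ** Y ** ctranspose Q) = P ** svd_lift S f Y ** ctranspose Q"
  using svd_lift_eq[OF card f unitary_mult[OF un(1,3)] unitary_mult[OF un(2,4)] x]
    svd_lift_eq[OF card f un(3,4) x]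
  by (simp add: Y svd_form_mult)

text \<open>\<open>X\<close> and the normal displacement \<open>D H\<close> share a frame, and in it
  \<open>norm k = norm (D H)\<close>, so a small \<open>H\<close> keeps \<open>x + k\<close> in
  \<open>S\<close>. The frame may depend on \<open>H\<close> in any way.\<close>

lemma eventually_simultaneous_svd:
  fixes U :: "'a::real_or_complex^'m::{finite,linorder}^'m::{finite,linorder}"
    and V :: "'a^'n::{finite,linorder}^'n::{finite,linorder}"
  assumes card: "CARD('m) \<le> CARD('n)" and UV: "unitary_matrix U" "unitary_matrix V"
    and S: "open S" "x \<in> S" and X: "X = svd_form U x V" and chart: "normal_chart X P P' Q Q' D"
  shows "\<forall>\<^sub>F H in nhds 0. \<exists>U V k. unitary_matrix U \<and> unitary_matrix V \<and> X = svd_form U x V \<and>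
    D H = svd_form U k V \<and> x + k \<in> S"
proof -
  interpret normal_chart X P P' Q Q' D by (rule chart)
  obtain r where r: "0 < r" "ball x r \<subseteq> S" using S by (auto simp: open_contains_ball)
  have "open (D -` ball 0 r)" using D_linear
    by (intro continuous_open_vimage linear_continuous_at) auto
  moreover have "0 \<in> D -` ball 0 r" using r by (simp add: D_0)
  ultimately have "\<forall>\<^sub>F H in nhds 0. H \<in> D -` ball 0 r" by (rule eventually_nhds_in_open)
  thus ?thesis
  proof eventually_elim
    case (elim H)
    obtain U1 V1 k where k: "unitary_matrix U1" "unitary_matrix V1" "X = svd_form U1 x V1"
      "D H = svd_form U1 k V1"
      using simultaneous_svd[OF card UV X D_normal[of H]] by metis
    have "norm k < r" using elim norm_svd_form[OF card k(1,2), of k] k(4) by simp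
    hence "x + k \<in> S" using r by (auto simp: dist_norm)
    with k show ?case by blast
  qed
qed

text \<open>Unitary equivariance of the lift pulls \<open>P H\<close> and \<open>Q H\<close> out,
  leaving only the normal displacement inside.\<close>

lemma svd_lift_chart:
  fixes U :: "'a::real_or_complex^'m::{finite,linorder}^'m::{finite,linorder}"
    and V :: "'a^'n::{finite,linorder}^'n::{finite,linorder}"
  assumes card: "CARD('m) \<le> CARD('n)" and f: "symmetric_on S f"
    and UV: "unitary_matrix U" "unitary_matrix V"
    and S: "open S" "x \<in> S" and X: "X = svd_form U x V" and chart: "normal_chart X P P' Q Q' D"
  shows "\<forall>\<^sub>F H in nhds 0. P H ** svd_lift S f (X + D H) ** ctranspose (Q H)
    = (svd_lift S f \<circ> normal_chart.chart X P Q D) H"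
  using eventually_simultaneous_svd[OF card UV S X chart]
proof eventually_elim
  case (elim H)
  then obtain U V k where k: "unitary_matrix U" "unitary_matrix V" "X = svd_form U x V"
    "D H = svd_form U k V" "x + k \<in> S" by blast
  have "X + D H = svd_form U (x + k) V" using k(3,4) by (metis svd_form_add)
  from svd_lift_two_sided[OF card f normal_chart.unitary_P[OF chart] normal_chart.unitary_Q[OF chart] k(1,2,5) this]
  show ?case by (simp add: normal_chart.chart_def[OF chart])
qed

text \<open>Stands in for continuity of singular values: a nearby \<open>Y\<close> is a point of the
  chart, and its normal displacement has a frame in common with \<open>X\<close>. The resulting
  frame need not be near the given one.\<close>

lemma svd_near:
  fixes U :: "'a::real_or_complex^'m::{finite,linorder}^'m::{finite,linorder}"
    and V :: "'a^'n::{finite,linorder}^'n::{finite,linorder}"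
  assumes card: "CARD('m) \<le> CARD('n)" and UV: "unitary_matrix U" "unitary_matrix V" and r: "0 < r"
  shows "\<forall>\<^sub>F Y in nhds (svd_form U x V). \<exists>U V y. unitary_matrix U \<and> unitary_matrix V \<and> y \<in> ball x r \<and> Y = svd_form U y V"
proof -
  define X where "X = svd_form U x V"
  obtain P P' Q Q' D where "normal_chart X P P' Q Q' D" by (rule normal_chart_exists)
  then interpret normal_chart X P P' Q Q' D .
  obtain S T g where ST: "open S" "0 \<in> S" "open T" "X \<in> T" and hom: "homeomorphism S T chart g"
    by (rule local_inverse) blast
  have gX: "g X = 0" using hom ST chart_0 by (metis homeomorphism_apply1)
  have "continuous_on T g" using hom by (simp add: homeomorphism_def)
  hence "isCont g X" using ST by (simp add: continuous_on_eq_continuous_at)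
  hence "(g \<longlongrightarrow> 0) (nhds X)"
    unfolding isCont_def using tendsto_at_iff_tendsto_nhds[of g X] gX by simp
  moreover have "\<forall>\<^sub>F H in nhds 0. \<exists>U V k. unitary_matrix U \<and> unitary_matrix V \<and> X = svd_form U x V \<and>
    D H = svd_form U k V \<and> x + k \<in> ball x r"
    by (rule eventually_simultaneous_svd[OF card UV open_ball _ X_def normal_chart_axioms]) (simp add: r)
  ultimately have "\<forall>\<^sub>F Y in nhds X. \<exists>U V k. unitary_matrix U \<and> unitary_matrix V \<and> X = svd_form U x V \<and>
    D (g Y) = svd_form U k V \<and> x + k \<in> ball x r" by (rule eventually_compose_filterlim[rotated])
  moreover have "\<forall>\<^sub>F Y in nhds X. Y \<in> T" using ST by (simp add: eventually_nhds_in_open)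
  ultimately show ?thesis unfolding X_def[symmetric]
  proof eventually_elim
    case (elim Y)
    then obtain U1 V1 k where k: "unitary_matrix U1" "unitary_matrix V1" "X = svd_form U1 x V1"
      "D (g Y) = svd_form U1 k V1" "x + k \<in> ball x r" by blast
    have "Y = chart (g Y)" using hom elim(2) by (simp add: homeomorphism_def)
    also have "\<dots> = P (g Y) ** svd_form U1 (x + k) V1 ** ctranspose (Q (g Y))"
      by (simp only: chart_def svd_form_add k(3)[symmetric] k(4)[symmetric])
    also have "\<dots> = svd_form (P (g Y) ** U1) (x + k) (Q (g Y) ** V1)"
      by (rule svd_form_mult)
    finally have "Y = svd_form (P (g Y) ** U1) (x + k) (Q (g Y) ** V1)" .
    with k(5) show ?case
      by (intro exI[of _ "P (g Y) ** U1"] exI[of _ "Q (g Y) ** V1"] exI[of _ "x + k"] conjI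
          unitary_mult unitary_P unitary_Q k(1,2))
  qed
qed

text \<open>
  The derivative in the normal directions is \<open>U [k] V\<^sup>* \<mapsto> U [f' k] V\<^sup>*\<close>. It is linear because it
  has an adjoint, namely the map of the same form built from the adjoint of \<open>f'\<close>.
\<close>

lemma svd_lift_differentiable:
  fixes U :: "'a::real_or_complex^'m::{finite,linorder}^'m::{finite,linorder}"
    and V :: "'a^'n::{finite,linorder}^'n::{finite,linorder}"
  assumes card: "CARD('m) \<le> CARD('n)" and f: "symmetric_on S f"
    and UV: "unitary_matrix U" "unitary_matrix V" and S: "open S" "x \<in> S"
    and diff: "f differentiable (at x)"
  shows "svd_lift S f differentiable (at (svd_form U x V))"
proof -
  define X where "X = svd_form U x V"
  obtain L where L: "(f has_derivative L) (at x)" using diff by (auto simp: differentiable_def)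
  have linL: "linear L" using L by (rule has_derivative_linear)
  \<comment> \<open>Differentiate the equivariance of \<open>f\<close> at \<open>x\<close>, near
    which it holds because \<open>Q\<close> fixes \<open>x\<close> and \<open>S\<close> is
    open.\<close>
  have commute: "L (Q *v v) = Q *v L v" if Q: "signed_permutation_matrix Q" and fx: "Q *v x = x" for Q v
  proof -
    have lin: "bounded_linear ((*v) Q)" by (simp add: matrix_vector_mul_bounded_linear)
    have d1: "((\<lambda>y. f (Q *v y)) has_derivative (\<lambda>v. L (Q *v v))) (at x)"
      using has_derivative_compose[OF bounded_linear_imp_has_derivative[OF lin], of f L x UNIV] L fx by simp
    have d2: "((\<lambda>y. Q *v f y) has_derivative (\<lambda>v. Q *v L v)) (at x)"
      by (rule bounded_linear.has_derivative[OF lin L])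
    have "open (S \<inter> (*v) Q -` S)" "x \<in> S \<inter> (*v) Q -` S"
      using S lin fx by (auto intro!: open_Int continuous_open_vimage linear_continuous_at)
    hence "((\<lambda>y. Q *v f y) has_derivative (\<lambda>v. L (Q *v v))) (at x)"
      using f Q by (intro has_derivative_transform_within_open[OF d1]) (auto simp: symmetric_on_def)
    from has_derivative_unique[OF this d2] show ?thesis by meson
  qed
  have "\<exists>U V k. unitary_matrix U \<and> unitary_matrix V \<and> X = svd_form U x V \<and> K = svd_form U k V"
    if "K \<in> normal_space X" for K
    using simultaneous_svd[OF card UV X_def that] by metis
  \<comment> \<open>The frames are chosen separately for each \<open>K\<close>, with no regularity
    in \<open>K\<close>.\<close>
  then obtain A B k where AB: "\<And>K. K \<in> normal_space X \<Longrightarrow> unitary_matrix (A K)"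
    "\<And>K. K \<in> normal_space X \<Longrightarrow> unitary_matrix (B K)"
    "\<And>K. K \<in> normal_space X \<Longrightarrow> X = svd_form (A K) x (B K)"
    "\<And>K. K \<in> normal_space X \<Longrightarrow> K = svd_form (A K) (k K) (B K)" by metis
  define \<Lambda> where "\<Lambda> K = svd_form (A K) (L (k K)) (B K)" for K
  define \<Lambda>' where "\<Lambda>' K = svd_form (A K) (adjoint L (k K)) (B K)" for K
  have \<Lambda>_normal: "\<Lambda> K \<in> normal_space X" if "K \<in> normal_space X" for K
    using svd_form_in_normal_space[OF card AB(1,2)[OF that], of "L (k K)" x] AB(3)[OF that]
    by (simp add: \<Lambda>_def)
  have adj: "inner (\<Lambda> K) M = inner K (\<Lambda>' M)" if "K \<in> normal_space X" "M \<in> normal_space X" for K M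
  proof -
    have "svd_form (A K) x (B K) = svd_form (A M) x (B M)"
      using AB(3)[OF that(1)] AB(3)[OF that(2)] by simp
    from inner_svd_form_adjoint[OF card AB(1,2)[OF that(1)] AB(1,2)[OF that(2)] this linL commute, of "k K" "k M"]
    show ?thesis unfolding \<Lambda>_def \<Lambda>'_def
      using AB(4)[OF that(1)] AB(4)[OF that(2)] by simp
  qed
  obtain P P' Q Q' D where "normal_chart X P P' Q Q' D" by (rule normal_chart_exists)
  then interpret normal_chart X P P' Q Q' D .
  \<comment> \<open>Only normal vectors can serve as tests, because the adjoint relation
    \<open>adj\<close> holds for these alone; the defects of linearity are normal
    themselves.\<close>
  have eq0: "M = 0" if "M \<in> normal_space X" "\<And>K. K \<in> normal_space X \<Longrightarrow> inner M K = 0" for M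
    using that(2)[OF that(1)] by simp
  have linD: "linear D" using D_linear by (rule bounded_linear.linear)
  note sub = subspace_add[OF subspace_normal_space] subspace_diff[OF subspace_normal_space]
    subspace_scale[OF subspace_normal_space]
  have lin: "linear (\<lambda>H. \<Lambda> (D H))"
  proof (rule linearI)
    fix H1 H2 :: "'a^'n::{finite,linorder}^'m::{finite,linorder}" and c :: real
    have "\<Lambda> (D (H1 + H2)) - (\<Lambda> (D H1) + \<Lambda> (D H2)) = 0"
      by (intro eq0 sub \<Lambda>_normal D_normal)
        (simp add: inner_diff_left inner_add_left adj D_normal, simp add: linear_add[OF linD] inner_add_left)
    thus "\<Lambda> (D (H1 + H2)) = \<Lambda> (D H1) + \<Lambda> (D H2)" by simp
    have "\<Lambda> (D (c *\<^sub>R H1)) - c *\<^sub>R \<Lambda> (D H1) = 0"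
      by (intro eq0 sub \<Lambda>_normal D_normal)
        (simp add: inner_diff_left adj D_normal, simp add: linear_scale[OF linD])
    thus "\<Lambda> (D (c *\<^sub>R H1)) = c *\<^sub>R \<Lambda> (D H1)" by simp
  qed
  obtain r where r: "0 < r" "ball x r \<subseteq> S" using S by (auto simp: open_contains_ball)
  have norm_k: "norm (k K) = norm K" if "K \<in> normal_space X" for K
    using norm_svd_form[OF card AB(1,2)[OF that], of "k K"] AB(4)[OF that] by simp
  have lift: "X + D H = svd_form (A (D H)) (x + k (D H)) (B (D H))" "x + k (D H) \<in> S"
    "svd_lift S f (X + D H) = svd_form (A (D H)) (f (x + k (D H))) (B (D H))"
    if "norm (D H) < r" for H
  proof -
    show "X + D H = svd_form (A (D H)) (x + k (D H)) (B (D H))"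
      using AB(3,4)[OF D_normal] by (metis svd_form_add)
    moreover show "x + k (D H) \<in> S" using r that norm_k[OF D_normal, of H] by (auto simp: dist_norm)
    ultimately show "svd_lift S f (X + D H) = svd_form (A (D H)) (f (x + k (D H))) (B (D H))"
      using svd_lift_eq[OF card f AB(1,2)[OF D_normal]] by metis
  qed
  have "((\<lambda>H. svd_lift S f (X + D H)) has_derivative (\<lambda>H. \<Lambda> (D H))) (at 0)"
    unfolding has_derivative_at_alt
  proof (intro conjI allI impI)
    show "bounded_linear (\<lambda>H. \<Lambda> (D H))" using lin by (simp add: linear_conv_bounded_linear)
    fix e :: real assume e: "0 < e"
    obtain C where C: "0 < C" "\<And>H. norm (D H) \<le> norm H * C"
      using bounded_linear.pos_bounded[OF D_linear] by blast
    \<comment> \<open>Dividing by \<open>C\<close> turns an error relative to \<open>D H\<close>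
      into one relative to \<open>H\<close>.\<close>
    obtain d where d: "0 < d" "\<And>y. norm (y - x) < d \<Longrightarrow> norm (f y - f x - L (y - x)) \<le> e / C * norm (y - x)"
      using L e C(1) unfolding has_derivative_at_alt by (metis divide_pos_pos)
    show "\<exists>d>0. \<forall>H. norm (H - 0) < d \<longrightarrow>
        norm (svd_lift S f (X + D H) - svd_lift S f (X + D 0) - \<Lambda> (D (H - 0))) \<le> e * norm (H - 0)"
    proof (intro exI[of _ "min d r / C"] conjI allI impI)
      show "0 < min d r / C" using d r C by simp
      fix H :: "'a^'n::{finite,linorder}^'m::{finite,linorder}" assume "norm (H - 0) < min d r / C"
      hence "norm H * C < min d r" using C(1) by (simp add: field_simps)
      hence DH: "norm (D H) < d" "norm (D H) < r" using C(2)[of H] by auto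
      have "svd_lift S f X = svd_form (A (D H)) (f x) (B (D H))"
        using svd_lift_eq[OF card f AB(1,2)[OF D_normal] S(2)] AB(3)[OF D_normal] by metis
      hence "svd_lift S f (X + D H) - svd_lift S f (X + D 0) - \<Lambda> (D (H - 0))
          = svd_form (A (D H)) (f (x + k (D H)) - f x - L (k (D H))) (B (D H))"
        using lift(3)[OF DH(2)] by (simp add: D_0 \<Lambda>_def svd_form_diff)
      hence "norm (svd_lift S f (X + D H) - svd_lift S f (X + D 0) - \<Lambda> (D (H - 0)))
          = norm (f (x + k (D H)) - f x - L (k (D H)))"
        using norm_svd_form[OF card AB(1,2)[OF D_normal[of H]]] by metis
      also have "\<dots> \<le> e / C * norm (D H)"
        using d(2)[of "x + k (D H)"] DH norm_k[OF D_normal, of H] by simp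
      also have "\<dots> \<le> e / C * (norm H * C)" using C e by (intro mult_left_mono) auto
      also have "\<dots> = e * norm H" using C by simp
      finally show "norm (svd_lift S f (X + D H) - svd_lift S f (X + D 0) - \<Lambda> (D (H - 0))) \<le> e * norm (H - 0)"
        by simp
    qed
  qed
  from has_derivative_two_sided[OF this]
  have dl: "(\<lambda>H. P H ** svd_lift S f (X + D H) ** ctranspose (Q H)) differentiable (at 0)"
    by (auto simp: differentiable_def)
  have "svd_lift S f \<circ> chart differentiable (at 0)"
    using dl unfolding differentiable_cong_nhds[OF svd_lift_chart[OF card f UV S X_def normal_chart_axioms]] .
  thus ?thesis unfolding X_def[symmetric] by (rule differentiable_chartD)
qed

text \<open>Only distances to signed permutations need checking. If \<open>Q\<close> fixes
  \<open>s\<close>, equivariance reduces to \<open>lip\<close>. Otherwise \<open>Q\<close> moves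
  \<open>s\<close> by at least \<open>4 * r\<close>, which leaves \<open>x\<close> and
  \<open>Q *v y\<close> at least \<open>2 * r\<close> apart, and two applications of
  \<open>bound\<close> suffice.\<close>

lemma svd_lift_lipschitz:
  fixes U U' :: "'a::real_or_complex^'m::{finite,linorder}^'m::{finite,linorder}"
    and V V' :: "'a^'n::{finite,linorder}^'n::{finite,linorder}"
  assumes card: "CARD('m) \<le> CARD('n)" and f: "symmetric_on (ball s r) f"
    and sep: "\<And>Q. signed_permutation_matrix Q \<Longrightarrow> Q *v s \<noteq> s \<Longrightarrow> 4 * r \<le> norm (s - Q *v s)"
    and lip: "\<And>x y. x \<in> ball s r \<Longrightarrow> y \<in> ball s r \<Longrightarrow> norm (f x - f y) \<le> C * norm (x - y)"
    and bound: "\<And>x. x \<in> ball s r \<Longrightarrow> norm (f x) \<le> C * r" and C: "0 \<le> C"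
    and un: "unitary_matrix U" "unitary_matrix V" "unitary_matrix U'" "unitary_matrix V'"
    and xy: "x \<in> ball s r" "y \<in> ball s r"
  shows "norm (svd_form U (f x) V - svd_form U' (f y) V') \<le> C * norm (svd_form U x V - svd_form U' y V')"
proof (rule norm_svd_form_diff_le[OF card un C])
  fix Q :: "real^'m::{finite,linorder}^'m::{finite,linorder}"
  assume Q: "signed_permutation_matrix Q"
  have Qys: "norm (Q *v s - Q *v y) < r"
    using xy(2) norm_signed_permutation[OF Q, of "s - y"] by (simp add: dist_norm matrix_vector_mult_diff_distrib)
  show "norm (f x - Q *v f y) \<le> C * norm (x - Q *v y)"
  proof (cases "Q *v s = s")
    case True
    hence "Q *v y \<in> ball s r" using Qys by (simp add: dist_norm)
    moreover from this have "f (Q *v y) = Q *v f y" using f xy Q by (simp add: symmetric_on_def)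
    ultimately show ?thesis using lip[OF xy(1), of "Q *v y"] by simp
  next
    case False
    have "norm (s - Q *v s) \<le> norm (s - x) + norm (x - Q *v y) + norm (Q *v s - Q *v y)"
      using norm_triangle_ineq[of "s - x" "x - Q *v y"] norm_triangle_ineq4[of "s - Q *v y" "Q *v s - Q *v y"]
      by simp
    hence "2 * r \<le> norm (x - Q *v y)" using sep[OF Q False] Qys xy(1) by (simp add: dist_norm)
    have "norm (f x - Q *v f y) \<le> norm (f x) + norm (f y)"
      using norm_triangle_ineq4[of "f x" "Q *v f y"] norm_signed_permutation[OF Q, of "f y"] by simp
    also have "\<dots> \<le> C * (2 * r)" using bound[OF xy(1)] bound[OF xy(2)] by simp
    also have "\<dots> \<le> C * norm (x - Q *v y)" using \<open>2 * r \<le> _\<close> C by (rule mult_left_mono)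
    finally show ?thesis .
  qed
qed

lemma signed_permutation_separation:
  fixes s :: "real^'m"
  obtains e where "0 < e" "\<And>Q. signed_permutation_matrix Q \<Longrightarrow> Q *v s \<noteq> s \<Longrightarrow> e \<le> norm (s - Q *v s)"
proof -
  define T where "T = (\<lambda>Q. norm (s - Q *v s)) ` {Q. signed_permutation_matrix Q \<and> Q *v s \<noteq> s}"
  have T: "finite T" unfolding T_def 
    by (intro finite_imageI finite_subset[OF _ finite_signed_permutations]) auto
  show thesis
  proof
    \<comment> \<open>The element 1 covers the case that every signed permutation fixes
      \<open>s\<close>.\<close>
    show "0 < Min (insert 1 T)" using T by (auto simp: T_def)
    show "Min (insert 1 T) \<le> norm (s - Q *v s)" if "signed_permutation_matrix Q" "Q *v s \<noteq> s" for Q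
      using T that by (intro Min_le) (auto simp: T_def)
  qed
qed

section \<open>First-order approximation of a spectral operator\<close>

lemma has_dir_deriv_scale:
  assumes "has_dir_deriv F z h l" "0 \<le> c"
  shows "has_dir_deriv F z (c *\<^sub>R h) (c *\<^sub>R l)"
proof (cases "c = 0")
  case True
  thus ?thesis by (simp add: has_dir_deriv_def)
next
  case False
  with assms(2) have c: "0 < c" by simp
  have c_image: "(\<lambda>t. c * t) ` {0<..} \<subseteq> {0<..}" using c by auto
  have "((\<lambda>t. c * t) has_derivative (\<lambda>t. c * t)) (at_right 0)"
    by (auto intro!: derivative_eq_intros)
  moreover have "((\<lambda>t. F (z + t *\<^sub>R h)) has_derivative (\<lambda>t. t *\<^sub>R l)) (at (c * 0) within (\<lambda>t. c * t) ` {0<..})"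
    using assms(1) c_image unfolding has_dir_deriv_iff_has_derivative by (auto elim: has_derivative_subset)
  ultimately have "((\<lambda>t. F (z + (c * t) *\<^sub>R h)) has_derivative (\<lambda>t. (c * t) *\<^sub>R l)) (at_right 0)"
    by (rule has_derivative_in_compose)
  thus ?thesis by (simp add: has_dir_deriv_iff_has_derivative mult.commute)
qed

lemma has_dir_deriv_cong:
  assumes "\<forall>\<^sub>F y in nhds z. F y = F2 y"
  shows "has_dir_deriv F z h l \<longleftrightarrow> has_dir_deriv F2 z h l"
  unfolding has_dir_deriv_def
proof (rule filterlim_cong[OF refl refl])
  have "F z = F2 z" using assms by (rule eventually_nhds_x_imp_x)
  thus "\<forall>\<^sub>F t in at_right 0. (F (z + t *\<^sub>R h) - F z) /\<^sub>R t = (F2 (z + t *\<^sub>R h) - F2 z) /\<^sub>R t"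
    using eventually_compose_filterlim[OF assms tendsto_line[of z h]] by (auto elim: eventually_mono)
qed

lemma dir_deriv_cong:
  assumes "\<forall>\<^sub>F y in nhds z. F y = F2 y"
  shows "dir_deriv F z = dir_deriv F2 z"
  using has_dir_deriv_cong[OF assms] by (simp add: dir_deriv_def fun_eq_iff)

text \<open>The derivative contained in strict differentiability must be 0, as all directional
  derivatives are; the strict limit then bounds the difference quotients between any two points near
  0.\<close>

lemma strictly_differentiable_small_lipschitz:
  assumes d: "strictly_differentiable_at d 0" and zero: "\<And>h. has_dir_deriv d 0 h 0" and e: "0 < e"
  obtains r where "0 < r" "\<And>v w. v \<in> ball 0 r \<Longrightarrow> w \<in> ball 0 r \<Longrightarrow> norm (d v - d w) \<le> e * norm (v - w)"
proof -
  have "(d has_derivative (\<lambda>_. 0)) (at 0)"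
  proof -
    obtain L where L: "(d has_derivative L) (at 0)"
      using d unfolding strictly_differentiable_at_def by blast
    have "L = (\<lambda>_. 0)" using has_dir_deriv_unique[OF has_derivative_imp_has_dir_deriv[OF L] zero] by blast
    with L show ?thesis by simp
  qed
  from d[unfolded strictly_differentiable_at_zero_deriv[OF this]] e
  have "\<forall>\<^sub>F p in at (0, 0) within {(v, w). v \<noteq> w}. dist (case p of (v, w) \<Rightarrow> (d v - d w) /\<^sub>R norm (v - w)) 0 < e"
    by (rule tendstoD)
  then obtain r where r: "0 < r"
    "\<And>v w. v \<noteq> w \<Longrightarrow> (v, w) \<noteq> (0, 0) \<Longrightarrow> dist (v, w) (0, 0) < r \<Longrightarrow> dist ((d v - d w) /\<^sub>R norm (v - w)) 0 < e"
    unfolding eventually_at by fastforce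
  show thesis
  proof
    \<comment> \<open>Half the radius, because the norm of a pair is bounded by the sum of the two
      norms.\<close>
    show "0 < r / 2" using r by simp
    fix v w :: 'a assume vw: "v \<in> ball 0 (r / 2)" "w \<in> ball 0 (r / 2)"
    show "norm (d v - d w) \<le> e * norm (v - w)"
    proof (cases "v = w")
      case False
      have "dist (v, w) (0, 0) \<le> norm v + norm w"
        unfolding dist_norm by (simp add: norm_Pair sqrt_sum_squares_le_sum)
      also have "\<dots> < r" using vw by simp
      finally have "dist ((d v - d w) /\<^sub>R norm (v - w)) 0 < e" using r(2) False by auto
      thus ?thesis using False by (simp add: divide_simps mult.commute)
    qed simp
  qed
qed

lemma symmetric_on_subset: "symmetric_on S f \<Longrightarrow> T \<subseteq> S \<Longrightarrow> symmetric_on T f"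
  by (auto simp: symmetric_on_def)

text \<open>Both \<open>s\<close> and \<open>Q *v s\<close> lie within \<open>r\<close> of
  \<open>Q *v x\<close>, so they are closer than the separation \<open>4 * r\<close> permits for
  distinct points.\<close>

lemma signed_permutation_fixes_center:
  assumes sep: "Q *v s \<noteq> s \<Longrightarrow> 4 * r \<le> norm (s - Q *v s)"
    and Q: "signed_permutation_matrix Q" and x: "x \<in> ball s r" "Q *v x \<in> ball s r"
  shows "Q *v s = s"
proof (rule ccontr)
  assume "Q *v s \<noteq> s"
  have "norm (Q *v x - Q *v s) < r"
    using x(1) norm_signed_permutation[OF Q, of "x - s"]
    by (simp add: dist_norm matrix_vector_mult_diff_distrib norm_minus_commute)
  hence "norm (s - Q *v s) < 2 * r"
    using x(2) norm_triangle_ineq[of "s - Q *v x" "Q *v x - Q *v s"] by (simp add: dist_norm)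
  thus False using sep[OF \<open>Q *v s \<noteq> s\<close>] norm_ge_zero[of "s - Q *v s"] by linarith
qed

text \<open>Inside the ball only matrices fixing \<open>s\<close> matter, and for these the
  equivariance of \<open>f\<close> passes to the difference quotients along \<open>h\<close> and
  \<open>Q *v h\<close>.\<close>

lemma symmetric_on_first_order:
  assumes f: "symmetric_on (ball s r) f" and r: "0 < r"
    and sep: "\<And>Q. signed_permutation_matrix Q \<Longrightarrow> Q *v s \<noteq> s \<Longrightarrow> 4 * r \<le> norm (s - Q *v s)"
    and p: "\<And>h. has_dir_deriv f s h (p h)"
  shows "symmetric_on (ball s r) (\<lambda>x. f s + p (x - s))"
  unfolding symmetric_on_def
proof (intro ballI allI impI)
  fix x Q assume x: "x \<in> ball s r" "Q *v x \<in> ball s r" and Q: "signed_permutation_matrix Q"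
  have Qs: "Q *v s = s" using signed_permutation_fixes_center[OF sep[OF Q] Q x] .
  have lin: "bounded_linear ((*v) Q)" by (rule matrix_vector_mul_bounded_linear)
  have fs: "Q *v f s = f s" using f Q Qs r unfolding symmetric_on_def by (metis centre_in_ball)
  have "has_dir_deriv f s (Q *v h) (Q *v p h)" for h
  proof -
    have "((\<lambda>t. Q *v ((f (s + t *\<^sub>R h) - f s) /\<^sub>R t)) \<longlongrightarrow> Q *v p h) (at_right 0)"
      using p[of h] unfolding has_dir_deriv_def by (rule bounded_linear.tendsto[OF lin])
    moreover have "\<forall>\<^sub>F t in at_right 0. Q *v ((f (s + t *\<^sub>R h) - f s) /\<^sub>R t) = (f (s + t *\<^sub>R (Q *v h)) - f s) /\<^sub>R t"
    proof -
      have "\<forall>\<^sub>F t in at_right 0. s + t *\<^sub>R h \<in> ball s r"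
        by (rule topological_tendstoD[OF tendsto_line]) (use r in auto)
      moreover have "\<forall>\<^sub>F t in at_right 0. s + t *\<^sub>R (Q *v h) \<in> ball s r"
        by (rule topological_tendstoD[OF tendsto_line]) (use r in auto)
      ultimately show ?thesis
      proof eventually_elim
        case (elim t)
        have "Q *v (s + t *\<^sub>R h) = s + t *\<^sub>R (Q *v h)"
          using Qs by (simp add: matrix_vector_right_distrib linear_scale[OF bounded_linear.linear[OF lin]])
        hence "f (s + t *\<^sub>R (Q *v h)) = Q *v f (s + t *\<^sub>R h)"
          using f Q elim unfolding symmetric_on_def by metis
        thus ?case
          by (simp add: linear_scale[OF bounded_linear.linear[OF lin]] matrix_vector_mult_diff_distrib fs)
      qed
    qed
    ultimately show ?thesis unfolding has_dir_deriv_def by (rule Lim_transform_eventually)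
  qed
  hence "p (Q *v (x - s)) = Q *v p (x - s)" using p has_dir_deriv_unique by blast
  thus "f s + p (Q *v x - s) = Q *v (f s + p (x - s))"
    using Qs fs by (simp add: matrix_vector_right_distrib matrix_vector_mult_diff_distrib)
qed

text \<open>Both hypotheses of the perturbation lemma lift from vectors to matrices:
  differentiability in either direction between vector map and lift, and the small Lipschitz
  constant through \<open>svd_lift_lipschitz\<close> for \<open>f - f2\<close>.\<close>

lemma B_subdifferential_svd_lift_subset:
  fixes U :: "'a::real_or_complex^'m::{finite,linorder}^'m::{finite,linorder}"
    and V :: "'a^'n::{finite,linorder}^'n::{finite,linorder}"
  assumes card: "CARD('m) \<le> CARD('n)" and UV: "unitary_matrix U" "unitary_matrix V" and r: "0 < r"
    and sep: "\<And>Q. signed_permutation_matrix Q \<Longrightarrow> Q *v s \<noteq> s \<Longrightarrow> 4 * r \<le> norm (s - Q *v s)"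
    and f: "symmetric_on (ball s r) f" and f2: "symmetric_on (ball s r) f2" and eq: "f s = f2 s"
    and diff: "\<And>x. x \<in> ball s r \<Longrightarrow> f differentiable (at x) \<Longrightarrow> f2 differentiable (at x)"
    and small: "\<And>e. 0 < e \<Longrightarrow> \<exists>d>0. \<forall>x\<in>ball s d. \<forall>y\<in>ball s d.
      norm ((f x - f2 x) - (f y - f2 y)) \<le> e * norm (x - y)"
  shows "B_subdifferential (svd_lift (ball s r) f) (svd_form U s V)
    \<subseteq> B_subdifferential (svd_lift (ball s r) f2) (svd_form U s V)"
proof (rule B_subdifferential_subset_small_perturbation)
  show "\<forall>\<^sub>F Y in nhds (svd_form U s V). svd_lift (ball s r) f differentiable (at Y) \<longrightarrow>
      svd_lift (ball s r) f2 differentiable (at Y)"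
    using svd_near[OF card UV r, of s]
  proof eventually_elim
    case (elim Y)
    then obtain U' V' y where Y: "unitary_matrix U'" "unitary_matrix V'" "y \<in> ball s r" "Y = svd_form U' y V'"
      by blast
    show ?case unfolding Y(4)
      using differentiable_of_svd_lift[OF card f Y(1,2) open_ball Y(3)] diff[OF Y(3)]
        svd_lift_differentiable[OF card f2 Y(1,2) open_ball Y(3)] by blast
  qed
  fix e :: real assume e: "0 < e"
  then obtain d where d: "0 < d" "\<And>x y. x \<in> ball s d \<Longrightarrow> y \<in> ball s d \<Longrightarrow>
    norm ((f x - f2 x) - (f y - f2 y)) \<le> e * norm (x - y)" using small by blast
  define q where "q = min d r"
  have q: "0 < q" "q \<le> d" "q \<le> r" using d r by (auto simp: q_def)
  have sym: "symmetric_on (ball s q) (\<lambda>x. f x - f2 x)"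
    using symmetric_on_subset[OF f subset_ball[OF q(3)]] symmetric_on_subset[OF f2 subset_ball[OF q(3)]]
    by (simp add: symmetric_on_def matrix_vector_mult_diff_distrib)
  have sep': "4 * q \<le> norm (s - Q *v s)" if "signed_permutation_matrix Q" "Q *v s \<noteq> s" for Q
    using sep[OF that] q by simp
  have lip: "norm ((f x - f2 x) - (f y - f2 y)) \<le> e * norm (x - y)" if "x \<in> ball s q" "y \<in> ball s q" for x y
    using d(2)[of x y] that q by simp
  \<comment> \<open>Equality at \<open>s\<close> makes the difference vanish there, so its size is
    controlled by the same small constant \<open>e\<close>.\<close>
  have bound: "norm (f x - f2 x) \<le> e * q" if "x \<in> ball s q" for x
  proof -
    have "norm (f x - f2 x) \<le> e * norm (x - s)" using lip[OF that, of s] q eq by simp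
    also have "\<dots> \<le> e * q" using that e by (intro mult_left_mono) (auto simp: dist_norm norm_minus_commute)
    finally show ?thesis .
  qed
  obtain c where c: "0 < c" "\<And>Y. Y \<in> ball (svd_form U s V) c \<Longrightarrow>
      \<exists>U V y. unitary_matrix U \<and> unitary_matrix V \<and> y \<in> ball s q \<and> Y = svd_form U y V"
    using svd_near[OF card UV q(1), of s] unfolding eventually_nhds_metric
    by (auto simp: dist_commute)
  show "\<exists>d>0. \<forall>Y\<in>ball (svd_form U s V) d. \<forall>Z\<in>ball (svd_form U s V) d.
      norm ((svd_lift (ball s r) f Y - svd_lift (ball s r) f2 Y)
        - (svd_lift (ball s r) f Z - svd_lift (ball s r) f2 Z)) \<le> e * norm (Y - Z)"
  proof (intro exI[of _ c] conjI ballI)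
    show "0 < c" by (rule c)
    fix Y Z :: "'a^'n::{finite,linorder}^'m::{finite,linorder}"
    assume "Y \<in> ball (svd_form U s V) c" "Z \<in> ball (svd_form U s V) c"
    then obtain U1 V1 y U2 V2 z where
      Y: "unitary_matrix U1" "unitary_matrix V1" "y \<in> ball s q" "Y = svd_form U1 y V1" and
      Z: "unitary_matrix U2" "unitary_matrix V2" "z \<in> ball s q" "Z = svd_form U2 z V2"
      using c(2) by metis
    have yz: "y \<in> ball s r" "z \<in> ball s r" using Y(3) Z(3) q by auto
    show "norm ((svd_lift (ball s r) f Y - svd_lift (ball s r) f2 Y)
        - (svd_lift (ball s r) f Z - svd_lift (ball s r) f2 Z)) \<le> e * norm (Y - Z)"
      unfolding Y(4) Z(4) svd_lift_eq[OF card f Y(1,2) yz(1)] svd_lift_eq[OF card f2 Y(1,2) yz(1)]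
        svd_lift_eq[OF card f Z(1,2) yz(2)] svd_lift_eq[OF card f2 Z(1,2) yz(2)] svd_form_diff[symmetric]
      using e by (intro svd_lift_lipschitz[OF card sym sep' lip bound _ Y(1,2) Z(1,2) Y(3) Z(3)]) auto
  qed
qed

text \<open>The directional derivative is the first-order model of the lift, written in the chart,
  with its orbit factors linearised at 0. \<open>B_subdifferential_two_sided\<close> compares these
  two functions.\<close>

lemma B_subdifferential_dir_deriv_svd_lift:
  fixes U :: "'a::real_or_complex^'m::{finite,linorder}^'m::{finite,linorder}"
    and V :: "'a^'n::{finite,linorder}^'n::{finite,linorder}"
  assumes card: "CARD('m) \<le> CARD('n)" and UV: "unitary_matrix U" "unitary_matrix V" and r: "0 < r"
    and sep: "\<And>Q. signed_permutation_matrix Q \<Longrightarrow> Q *v s \<noteq> s \<Longrightarrow> 4 * r \<le> norm (s - Q *v s)"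
    and f: "symmetric_on (ball s r) f"
    and lip: "\<And>x y. x \<in> ball s r \<Longrightarrow> y \<in> ball s r \<Longrightarrow> norm (f x - f y) \<le> C * norm (x - y)" and C: "0 \<le> C"
    and p: "\<And>h. has_dir_deriv f s h (p h)"
  shows "B_subdifferential (svd_lift (ball s r) (\<lambda>x. f s + p (x - s))) (svd_form U s V)
    = B_subdifferential (dir_deriv (svd_lift (ball s r) f) (svd_form U s V)) 0"
proof -
  define X where "X = svd_form U s V"
  define F where "F = (svd_lift (ball s r) f :: 'a^'n::{finite,linorder}^'m::{finite,linorder} \<Rightarrow> _)"
  define f2 where "f2 = (\<lambda>x. f s + p (x - s))"
  define F2 where "F2 = (svd_lift (ball s r) f2 :: 'a^'n::{finite,linorder}^'m::{finite,linorder} \<Rightarrow> _)"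
  have f2: "symmetric_on (ball s r) f2" unfolding f2_def by (rule symmetric_on_first_order[OF f r sep p])
  have s: "s \<in> ball s r" using r by simp
  obtain P P' Q Q' D where chart: "normal_chart X P P' Q Q' D" by (rule normal_chart_exists)
  then interpret normal_chart X P P' Q Q' D .
  \<comment> \<open>Along a normal direction the frame stays fixed, so the difference quotients are
    those of \<open>f\<close>, placed on the diagonal.\<close>
  have normal_deriv: "has_dir_deriv F X K (svd_form U1 (p k) V1)"
    if U1: "unitary_matrix U1" "unitary_matrix V1" and X1: "X = svd_form U1 s V1" and K: "K = svd_form U1 k V1"
    for U1 V1 k K
  proof -
    have FX: "F X = svd_form U1 (f s) V1" unfolding F_def X1 by (rule svd_lift_eq[OF card f U1 s])
    have "((\<lambda>t. svd_form U1 ((f (s + t *\<^sub>R k) - f s) /\<^sub>R t) V1) \<longlongrightarrow> svd_form U1 (p k) V1) (at_right 0)"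
      using p[of k] unfolding has_dir_deriv_def by (rule bounded_linear.tendsto[OF bounded_linear_svd_form])
    moreover have "\<forall>\<^sub>F t in at_right 0. s + t *\<^sub>R k \<in> ball s r"
      by (rule topological_tendstoD[OF tendsto_line]) (use r in auto)
    hence "\<forall>\<^sub>F t in at_right 0. svd_form U1 ((f (s + t *\<^sub>R k) - f s) /\<^sub>R t) V1 = (F (X + t *\<^sub>R K) - F X) /\<^sub>R t"
    proof eventually_elim
      case (elim t)
      have "X + t *\<^sub>R K = svd_form U1 (s + t *\<^sub>R k) V1"
        by (simp only: X1 K svd_form_add svd_form_scaleR)
      hence "F (X + t *\<^sub>R K) = svd_form U1 (f (s + t *\<^sub>R k)) V1"
        unfolding F_def using svd_lift_eq[OF card f U1 elim] by simp
      thus ?case by (simp add: FX svd_form_diff svd_form_scaleR)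
    qed
    ultimately show ?thesis unfolding has_dir_deriv_def by (rule Lim_transform_eventually)
  qed
  define Y where "Y H = dir_deriv F X (D H)" for H
  have Y: "has_dir_deriv F X (D H) (Y H)" for H
  proof -
    obtain U1 V1 k where "unitary_matrix U1" "unitary_matrix V1" "X = svd_form U1 s V1" "D H = svd_form U1 k V1"
      using simultaneous_svd[OF card UV X_def D_normal] by metis
    note deriv = normal_deriv[OF this]
    from deriv dir_deriv_eq[OF deriv] show ?thesis by (simp add: Y_def)
  qed
  have Y_le: "norm (Y H) \<le> C * norm (D H)" for H
  proof -
    obtain U1 V1 k where k: "unitary_matrix U1" "unitary_matrix V1" "X = svd_form U1 s V1" "D H = svd_form U1 k V1"
      using simultaneous_svd[OF card UV X_def D_normal] by metis
    have "Y H = svd_form U1 (p k) V1" using has_dir_deriv_unique[OF Y normal_deriv[OF k]] .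
    moreover have "norm (p k) \<le> C * norm k"
      using lip[OF _ s]
      by (intro norm_has_dir_deriv_le[OF p] eventually_mono[OF eventually_nhds_in_open[OF open_ball s]])
    ultimately show ?thesis using norm_svd_form[OF card k(1,2)] k(4) by simp
  qed
  have Y_lim: "(Y \<longlongrightarrow> 0) (nhds 0)"
  proof (rule Lim_null_comparison[of Y "\<lambda>H. C * norm (D H)"])
    show "\<forall>\<^sub>F H in nhds 0. norm (Y H) \<le> C * norm (D H)" using Y_le by simp
    have "isCont (\<lambda>H. C * norm (D H)) 0"
      by (intro continuous_intros bounded_linear.continuous[OF D_linear])
    thus "((\<lambda>H. C * norm (D H)) \<longlongrightarrow> 0) (nhds 0)"
      unfolding isCont_def using tendsto_at_iff_tendsto_nhds[of "\<lambda>H. C * norm (D H)" 0] by (simp add: D_0)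
  qed
  \<comment> \<open>\<open>C\<close> alone need not bound \<open>f\<close>, whose value at
    \<open>s\<close> may be nonzero; the second term supplies the bound \<open>C' * r\<close> that
    \<open>svd_lift_lipschitz\<close> requires.\<close>
  define C' where "C' = max C ((norm (f s) + C * r) / r)"
  have C': "0 \<le> C'" "C \<le> C'" using C by (auto simp: C'_def)
  have lip': "norm (f x - f y) \<le> C' * norm (x - y)" if "x \<in> ball s r" "y \<in> ball s r" for x y
    using lip[OF that] C' by (meson mult_right_mono norm_ge_zero order_trans)
  have bound': "norm (f x) \<le> C' * r" if "x \<in> ball s r" for x
  proof -
    have "norm (f x) \<le> norm (f s) + norm (f x - f s)" using norm_triangle_sub by blast
    also have "\<dots> \<le> norm (f s) + C * norm (x - s)" using lip[OF that s] by simp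
    also have "\<dots> \<le> norm (f s) + C * r"
      using that C by (intro add_left_mono mult_left_mono) (auto simp: dist_norm norm_minus_commute)
    also have "\<dots> = (norm (f s) + C * r) / r * r" using r by simp
    also have "\<dots> \<le> C' * r" using r by (intro mult_right_mono) (auto simp: C'_def)
    finally show ?thesis .
  qed
  obtain c where c: "0 < c" "\<And>Y. Y \<in> ball X c \<Longrightarrow>
      \<exists>U V y. unitary_matrix U \<and> unitary_matrix V \<and> y \<in> ball s r \<and> Y = svd_form U y V"
    using svd_near[OF card UV r, of s] unfolding eventually_nhds_metric X_def[symmetric]
    by (auto simp: dist_commute)
  have lipF: "norm (F Z1 - F Z2) \<le> C' * norm (Z1 - Z2)" if Z: "Z1 \<in> ball X c" "Z2 \<in> ball X c" for Z1 Z2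
  proof -
    obtain U1 V1 y U2 V2 z where
      Z1: "unitary_matrix U1" "unitary_matrix V1" "y \<in> ball s r" "Z1 = svd_form U1 y V1" and
      Z2: "unitary_matrix U2" "unitary_matrix V2" "z \<in> ball s r" "Z2 = svd_form U2 z V2"
      using c(2)[OF Z(1)] c(2)[OF Z(2)] by metis
    show ?thesis unfolding F_def Z1(4) Z2(4) svd_lift_eq[OF card f Z1(1-3)] svd_lift_eq[OF card f Z2(1-3)]
      by (rule svd_lift_lipschitz[OF card f sep lip' bound' C'(1) Z1(1,2) Z2(1,2) Z1(3) Z2(3)])
  qed
  have F_deriv: "has_dir_deriv F X H (P' 0 H ** F X + F X ** ctranspose (Q' 0 H) + Y H)" for H
  proof (rule has_dir_deriv_chartD[OF _ c(1) lipF])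
    have "has_dir_deriv (\<lambda>H. F (X + D H)) 0 H (Y H)"
      using Y[of H] by (simp add: has_dir_deriv_def D_0 linear_scale[OF bounded_linear.linear[OF D_linear]])
    from has_dir_deriv_two_sided[OF this]
    have "has_dir_deriv (\<lambda>H. P H ** F (X + D H) ** ctranspose (Q H)) 0 H
        (P' 0 H ** F X + F X ** ctranspose (Q' 0 H) + Y H)" by (simp add: D_0)
    thus "has_dir_deriv (F \<circ> chart) 0 H (P' 0 H ** F X + F X ** ctranspose (Q' 0 H) + Y H)"
      using has_dir_deriv_cong[OF svd_lift_chart[OF card f UV open_ball s X_def chart]]
      unfolding F_def by blast
  qed
  have "dir_deriv F X = (\<lambda>H. P' 0 H ** F X + F X ** ctranspose (Q' 0 H) + Y H)"
    using dir_deriv_eq[OF F_deriv] by blast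
  hence "B_subdifferential (dir_deriv F X) 0 = B_subdifferential (\<lambda>H. P H ** (F X + Y H) ** ctranspose (Q H)) 0"
    using B_subdifferential_two_sided[OF Y_lim, of "F X"] by simp
  also have "\<dots> = B_subdifferential (F2 \<circ> chart) 0"
  proof (rule B_subdifferential_cong)
    have "\<forall>\<^sub>F H in nhds 0. F X + Y H = F2 (X + D H)"
      using eventually_simultaneous_svd[OF card UV open_ball s X_def chart]
    proof eventually_elim
      case (elim H)
      then obtain U1 V1 k where k: "unitary_matrix U1" "unitary_matrix V1" "X = svd_form U1 s V1"
        "D H = svd_form U1 k V1" "s + k \<in> ball s r" by blast
      have "F X = svd_form U1 (f s) V1" unfolding F_def k(3) by (rule svd_lift_eq[OF card f k(1,2) s])
      moreover have "Y H = svd_form U1 (p k) V1" using has_dir_deriv_unique[OF Y normal_deriv[OF k(1-4)]] .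
      moreover have "X + D H = svd_form U1 (s + k) V1" using k(3,4) by (metis svd_form_add)
      moreover have "F2 (svd_form U1 (s + k) V1) = svd_form U1 (f2 (s + k)) V1"
        unfolding F2_def by (rule svd_lift_eq[OF card f2 k(1,2,5)])
      ultimately show ?case by (simp add: f2_def svd_form_add)
    qed
    with svd_lift_chart[OF card f2 UV open_ball s X_def chart]
    show "\<forall>\<^sub>F H in nhds 0. P H ** (F X + Y H) ** ctranspose (Q H) = (F2 \<circ> chart) H"
      by eventually_elim (simp add: F2_def)
  qed
  also have "\<dots> = B_subdifferential F2 X" by (rule B_subdifferential_chart)
  finally show ?thesis by (simp add: F_def F2_def f2_def X_def)
qed

text \<open>Frees the value of \<open>G\<close> from the ordered nonnegative singular values.
  Symmetry of \<open>g\<close> is invoked at these values only, which lie in \<open>D\<close>, while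
  \<open>x\<close> may be any diagonal of the matrix.\<close>

lemma spectral_operator_eq_svd_form:
  fixes U :: "'a::real_or_complex^'m::{finite,linorder}^'m::{finite,linorder}"
    and V :: "'a^'n::{finite,linorder}^'n::{finite,linorder}"
  assumes card: "CARD('m) \<le> CARD('n)" and g: "absolutely_symmetric_on D g"
    and D: "singular_values ` N \<subseteq> D" and G: "spectral_operator_on N g G"
    and X: "svd_form U x V \<in> N" and UV: "unitary_matrix U" "unitary_matrix V"
  shows "G (svd_form U x V) = svd_form U (g x) V"
proof -
  let ?s = "singular_values (svd_form U x V)"
  obtain U' V' where UV': "unitary_matrix U'" "unitary_matrix V'" "svd_form U x V = svd_form U' ?s V'"
    "G (svd_form U x V) = svd_form U' (g ?s) V'"
    using G X unfolding spectral_operator_on_def svd_pairs_def svd_form_def by blast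
  have "svd_form U (g x) V = svd_form U' (g ?s) V'"
  proof (rule svd_form_eqI[OF card UV UV'(1-3)])
    fix Q assume Q: "signed_permutation_matrix Q" and x: "x = Q *v ?s"
    have "?s \<in> D" using D X by blast
    hence "g (Q *v ?s) = Q *v g ?s" using g Q by (simp add: absolutely_symmetric_on_def)
    with arg_cong[OF x, of g] show "g x = Q *v g ?s" by (rule trans)
  qed
  with UV'(4) show ?thesis by simp
qed

theorem theorem4p4:
  fixes N :: "('a::real_or_complex^'n::{finite,linorder}^'m::{finite,linorder}) set"
    and D :: "(real^'m::{finite,linorder}) set"
    and g :: "real^'m::{finite,linorder} \<Rightarrow> real^'m::{finite,linorder}"
    and G :: "'a^'n::{finite,linorder}^'m::{finite,linorder} \<Rightarrow> 'a^'n::{finite,linorder}^'m::{finite,linorder}"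
    and X0 :: "'a^'n::{finite,linorder}^'m::{finite,linorder}"
    and s0 :: "real^'m::{finite,linorder}"
  assumes "CARD('m) \<le> CARD('n)"
    and "open N" and "N \<noteq> {}"
    and "open D" and "singular_values ` N \<subseteq> D"
    and "absolutely_symmetric_on D g"
    and "spectral_operator_on N g G"
    and "X0 \<in> N" and "s0 = singular_values X0"
    and "lipschitz_near g s0"
    and "dir_differentiable g s0"
    and "\<exists>B. open B \<and> s0 \<in> B \<and> B \<subseteq> D \<and>
           (\<forall>s\<in>B. g differentiable (at s) \<longleftrightarrow> dir_deriv g s0 differentiable (at (s - s0)))"
    and "strictly_differentiable_at (\<lambda>h. g (s0 + h) - g s0 - dir_deriv g s0 h) 0"
  shows "B_subdifferential G X0 = B_subdifferential (dir_deriv G X0) 0 \<and>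
         Clarke_jacobian G X0 = Clarke_jacobian (dir_deriv G X0) 0"
proof -
  note card = assms(1)
  define p where "p = dir_deriv g s0"
  have p: "has_dir_deriv g s0 h (p h)" for h
    using assms(11) dir_deriv_eq unfolding dir_differentiable_def p_def by metis
  obtain U V where UV: "unitary_matrix U" "unitary_matrix V" and X0: "X0 = svd_form U s0 V"
    using assms(7,8,9) unfolding spectral_operator_on_def svd_pairs_def svd_form_def by blast
  obtain B where B: "open B" "s0 \<in> B" "B \<subseteq> D"
    "\<And>s. s \<in> B \<Longrightarrow> g differentiable (at s) \<longleftrightarrow> p differentiable (at (s - s0))"
    using assms(12) unfolding p_def by blast
  obtain b where b: "0 < b" "ball s0 b \<subseteq> B" using B by (auto simp: open_contains_ball)
  obtain l C where l: "0 < l" "C-lipschitz_on (ball s0 l) g" using assms(10) unfolding lipschitz_near_def by blast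
  obtain e where e: "0 < e" "\<And>Q. signed_permutation_matrix Q \<Longrightarrow> Q *v s0 \<noteq> s0 \<Longrightarrow> e \<le> norm (s0 - Q *v s0)"
    using signed_permutation_separation[of s0] by blast
  \<comment> \<open>\<open>b\<close> keeps the ball in \<open>B\<close>, \<open>l\<close> gives the
    Lipschitz bound, and the quarter of \<open>e\<close> gives the separation
    \<open>4 * r\<close>.\<close>
  define r where "r = min (min b l) (e / 4)"
  have r: "0 < r" "r \<le> b" "r \<le> l" "4 * r \<le> e" using b l e by (auto simp: r_def)
  have sep: "4 * r \<le> norm (s0 - Q *v s0)" if "signed_permutation_matrix Q" "Q *v s0 \<noteq> s0" for Q
    using e(2)[OF that] r by simp
  have ballB: "ball s0 r \<subseteq> B" using b r subset_ball by blast
  have g: "symmetric_on (ball s0 r) g"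
    using assms(6) ballB B(3) unfolding symmetric_on_def absolutely_symmetric_on_def by blast
  have lip: "norm (g x - g y) \<le> C * norm (x - y)" if "x \<in> ball s0 r" "y \<in> ball s0 r" for x y
    using lipschitz_onD[OF l(2), of x y] that r by (simp add: dist_norm)
  have C: "0 \<le> C" using l(2) by (rule lipschitz_on_nonneg)
  define g2 where "g2 = (\<lambda>x. g s0 + p (x - s0))"
  have g2: "symmetric_on (ball s0 r) g2"
    unfolding g2_def by (rule symmetric_on_first_order[OF g r(1) sep p])
  have p0: "p 0 = 0"
    using has_dir_deriv_unique[OF p has_dir_deriv_scale[OF p, of 0 0]] by simp
  have g2_s0: "g s0 = g2 s0" by (simp add: g2_def p0)
  \<comment> \<open>A translation turns the assumption on the differentiability points of
    \<open>g\<close> and its directional derivative into one about \<open>g\<close> and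
    \<open>g2\<close>.\<close>
  have diff: "g differentiable (at x) \<longleftrightarrow> g2 differentiable (at x)" if "x \<in> ball s0 r" for x
  proof -
    have "p differentiable (at (x - s0)) \<longleftrightarrow> g2 differentiable (at x)"
    proof
      assume "p differentiable (at (x - s0))"
      hence "(p \<circ> (\<lambda>x. x - s0)) differentiable (at x)" by (intro differentiable_chain_at) auto
      thus "g2 differentiable (at x)" unfolding g2_def by (auto simp: o_def)
    next
      assume "g2 differentiable (at x)"
      hence "(g2 \<circ> (\<lambda>h. s0 + h)) differentiable (at (x - s0))" by (intro differentiable_chain_at) auto
      hence "(\<lambda>h. g2 (s0 + h) - g s0) differentiable (at (x - s0))" by (auto simp: o_def)
      thus "p differentiable (at (x - s0))" by (simp add: g2_def)
    qed
    thus ?thesis using B(4) ballB that by blast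
  qed
  have small: "\<exists>d>0. \<forall>x\<in>ball s0 d. \<forall>y\<in>ball s0 d. norm ((g x - g2 x) - (g y - g2 y)) \<le> e * norm (x - y)"
    if "0 < e" for e
  proof -
    let ?d = "\<lambda>h. g (s0 + h) - g s0 - p h"
    \<comment> \<open>Positive homogeneity of \<open>p\<close> makes the difference quotient of
      \<open>?d\<close> the error of the directional derivative of \<open>g\<close>.\<close>
    have "has_dir_deriv ?d 0 h 0" for h
    proof -
      have "((\<lambda>t. (g (s0 + t *\<^sub>R h) - g s0) /\<^sub>R t - p h) \<longlongrightarrow> 0) (at_right 0)"
        using p[of h] unfolding has_dir_deriv_def by (rule LIM_zero)
      moreover have "\<forall>\<^sub>F t in at_right 0. (g (s0 + t *\<^sub>R h) - g s0) /\<^sub>R t - p h = (?d (0 + t *\<^sub>R h) - ?d 0) /\<^sub>R t"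
        using eventually_at_right_less[of "0::real"]
      proof eventually_elim
        case (elim t)
        have "p (t *\<^sub>R h) = t *\<^sub>R p h"
          using has_dir_deriv_unique[OF p has_dir_deriv_scale[OF p]] elim by simp
        thus ?case using elim p0 by (simp add: scaleR_diff_right)
      qed
      ultimately show ?thesis unfolding has_dir_deriv_def by (rule Lim_transform_eventually)
    qed
    from strictly_differentiable_small_lipschitz[OF assms(13)[folded p_def] this that]
    obtain d where d: "0 < d" "\<And>v w. v \<in> ball 0 d \<Longrightarrow> w \<in> ball 0 d \<Longrightarrow> norm (?d v - ?d w) \<le> e * norm (v - w)"
      by blast
    have "norm ((g x - g2 x) - (g y - g2 y)) \<le> e * norm (x - y)" if "x \<in> ball s0 d" "y \<in> ball s0 d" for x y
      using d(2)[of "x - s0" "y - s0"] that by (simp add: g2_def dist_norm norm_minus_commute algebra_simps)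
    with d(1) show ?thesis by blast
  qed
  hence small': "\<exists>d>0. \<forall>x\<in>ball s0 d. \<forall>y\<in>ball s0 d. norm ((g2 x - g x) - (g2 y - g y)) \<le> e * norm (x - y)"
    if "0 < e" for e
    using that by (metis (no_types, lifting) minus_diff_eq norm_minus_commute minus_diff_minus)
  \<comment> \<open>B-subdifferential and directional derivative are local, so \<open>G\<close> may
    be replaced by the lift of \<open>g\<close> over the small ball.\<close>
  have near: "\<forall>\<^sub>F Y in nhds X0. G Y = svd_lift (ball s0 r) g Y"
    using svd_near[OF card UV r(1), of s0] eventually_nhds_in_open[OF assms(2,8)] unfolding X0[symmetric]
  proof eventually_elim
    case (elim Y)
    then obtain U V y where Y: "unitary_matrix U" "unitary_matrix V" "y \<in> ball s0 r" "Y = svd_form U y V" by blast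
    show ?case unfolding Y(4) svd_lift_eq[OF card g Y(1-3)]
      using spectral_operator_eq_svd_form[OF card assms(6,5,7) _ Y(1,2)] elim(2) Y(4) by simp
  qed
  have "B_subdifferential G X0 = B_subdifferential (svd_lift (ball s0 r) g) X0"
    by (rule B_subdifferential_cong[OF near])
  also have "\<dots> = B_subdifferential (svd_lift (ball s0 r) g2) X0"
    unfolding X0
    using B_subdifferential_svd_lift_subset[OF card UV r(1) sep g g2 g2_s0 _ small]
      B_subdifferential_svd_lift_subset[OF card UV r(1) sep g2 g g2_s0[symmetric] _ small'] diff
    by (intro subset_antisym) blast+
  also have "\<dots> = B_subdifferential (dir_deriv (svd_lift (ball s0 r) g) X0) 0"
    unfolding X0 g2_def by (rule B_subdifferential_dir_deriv_svd_lift[OF card UV r(1) sep g lip C p])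
  also have "\<dots> = B_subdifferential (dir_deriv G X0) 0"
    unfolding dir_deriv_cong[OF near] ..
  finally have "B_subdifferential G X0 = B_subdifferential (dir_deriv G X0) 0" .
  thus ?thesis by (simp add: Clarke_jacobian_def)
qed

end
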